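(* Let $G=(V,E)$ be an undirected graph with positive edge weights and $n=|V|$ vertices, let $t\ge1$, and let $T\subset V$. Then there exists a subsetwise $(T\times T)$-spanner of $G$ with stretch factor $t$ having $O\!\left(n+\sqrt{n}\,|T|^{1+\frac{2}{t+1}}\right)$ edges.
   Context: For a weighted graph $G$, $d_G(u,v)$ denotes the length of a shortest $u$–$v$ path in $G$. Given $S\subseteq V$ and $t\ge1$, a subgraph $H$ of $G$ is a subsetwise $(S\times S)$-spanner of $G$ with stretch factor $t$ if $d_H(u,v)\le t\cdot d_G(u,v)$ for all $u,v\in S$. *)

theory Defs
  imports Complex_Main "Graph_Theory.Graph_Theory"
begin

text \<open>
  An undirected simple graph is a symmetric loop-free finite digraph, as in the locale
  \<^locale>\<open>pair_graph\<close>: the undirected edge between u and v is represented by the two arcs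
  (u, v) and (v, u), which therefore carry the same weight.
\<close>

definition weighted_graph :: "'a pair_pre_digraph \<Rightarrow> ('a \<times> 'a \<Rightarrow> real) \<Rightarrow> bool" where
  "weighted_graph G w \<longleftrightarrow>
     pair_graph G \<and> (\<forall>(u, v) \<in> parcs G. 0 < w (u, v) \<and> w (u, v) = w (v, u))"

text \<open>Each edge is counted once, not once per orientation.\<close>

definition edges :: "'a pair_pre_digraph \<Rightarrow> 'a set set" where
  "edges G = {{u, v} | u v. (u, v) \<in> parcs G}"

text \<open>
  The distance is infinite if v is not reachable from u, and also if u or v is not a vertex.
\<close>

definition graph_dist :: "'a pair_pre_digraph \<Rightarrow> ('a \<times> 'a \<Rightarrow> real) \<Rightarrow> 'a \<Rightarrow> 'a \<Rightarrow> ereal" where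
  "graph_dist G w u v = wf_digraph.\<mu> (with_proj G) w u v"

text \<open>
  The locale condition on H makes the subgraph undirected. Since the distance from
  u to u in G is 0 for u in S, the stretch condition forces S to be contained in the
  vertex set of H.
\<close>

definition subsetwise_spanner ::
    "'a pair_pre_digraph \<Rightarrow> ('a \<times> 'a \<Rightarrow> real) \<Rightarrow> 'a set \<Rightarrow> real \<Rightarrow> 'a pair_pre_digraph \<Rightarrow> bool" where
  "subsetwise_spanner G w S t H \<longleftrightarrow>
     pair_graph H \<and> subgraph (with_proj H) (with_proj G) \<and>
     (\<forall>u\<in>S. \<forall>v\<in>S. graph_dist H w u v \<le> ereal t * graph_dist G w u v)"

end

theory Submission
  imports Defs "HOL-Analysis.Convex"
begin

text \<open>
  With \<open>k = \<lfloor>(t + 1) / 2\<rfloor>\<close>, a greedy \<open>(2k - 1)\<close>-spanner of the metric on T has \<open>O(|T| powr (1 + 1/k))\<close> pairs,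
  and preserving p pairs exactly costs \<open>O(n + \<surd>n p)\<close> edges. This settles odd integers t. For other t the
  exponent \<open>1 + 2/(t + 1)\<close> is smaller than \<open>1 + 1/k\<close>, and the slack between \<open>2k - 1\<close> and t is spent on
  preserving the pairs only up to a factor \<open>1 + O(1/N)\<close>, which is possible with
  \<open>O(n + N\<^sup>2 \<surd>n p powr (3/4))\<close> edges.

  Exact preservation is cheaper for local pairs: if the ball around a pair has at most m vertices, the
  pair costs \<open>\<surd>m\<close> edges instead of \<open>\<surd>n\<close>. For approximate preservation, choose centres with disjoint
  balls of m' vertices. A walk runs freely through vertices with small balls, cut into \<open>O(N)\<close>
  short and therefore local pieces; between the first and the last vertex with a large ball it
  detours through the nearest centres. Two rounds of this replacement give the bound.
\<close>

text \<open>The difficulty is that one constant must serve all real t. Write (t + 1) / 2 = k +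
  \<delta> with 0 \<le> \<delta> < 1. The slack over the greedy stretch is t - (2k - 1) = 2
  \<delta>, so the inner preserver may err only by a factor 1 + 2 \<delta> / (2k - 1). This forces N
  of order k / \<delta>, which is unbounded as \<delta> tends to 0. Two regimes settle it. If
  \<delta> / (k (k + \<delta>)) * ln |T| \<le> 1, then |T| powr (1 + 1/k) exceeds the wanted power
  by a factor of at most exp 1, and exact preservation is affordable. Otherwise k / \<delta> < ln
  |T|, so the factor N^2 is at most polylogarithmic in |T|; with p of order |T| powr (1 + 1/k), the
  power p powr (3/4) lies below the wanted one by at least a factor of order |T| powr (1/6), which
  absorbs N^2. The one exception to this gap is k = 1 with \<delta> \<ge> 1/2, where N is bounded
  anyway.\<close>

section \<open>Counting owned edges\<close>

lemma sum_edges_eq_sum_degree: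
  fixes g :: "'a \<Rightarrow> real"
  assumes "finite F" "finite U" "\<Union>F \<subseteq> U"
  shows "(\<Sum>f\<in>F. \<Sum>v\<in>f. g v) = (\<Sum>v\<in>U. real (card {f\<in>F. v \<in> f}) * g v)"
proof -
  have "(\<Sum>f\<in>F. \<Sum>v\<in>f. g v) = (\<Sum>f\<in>F. \<Sum>v\<in>{v\<in>U. v \<in> f}. g v)"
    using assms(3) by (intro sum.cong refl) auto
  also have "\<dots> = (\<Sum>v\<in>U. \<Sum>f\<in>{f\<in>F. v \<in> f}. g v)"
    using assms by (intro sum.swap_restrict) auto
  finally show ?thesis by simp
qed

definition adjacent_owners :: "'a set set \<Rightarrow> ('a set \<Rightarrow> 'b) \<Rightarrow> 'b \<Rightarrow> 'b set" where
  "adjacent_owners F ow s = {t. t \<noteq> s \<and> (\<exists>e\<in>F. \<exists>f\<in>F. ow e = s \<and> ow f = t \<and> e \<inter> f \<noteq> {})}"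

text \<open>Take the owner s with the largest average degree along its edges. It meets many other owners, all of
  whose edges lie on \<open>c\<^sup>2\<close> vertices, and by Cauchy-Schwarz one of them has a larger average.\<close>

lemma dense_owned_edges_False:
  fixes F :: "'a set set" and ow :: "'a set \<Rightarrow> 'b" and c :: real
  assumes fin: "finite F" and ne: "F \<noteq> {}" and two: "\<And>f. f \<in> F \<Longrightarrow> card f = 2"
    and h1: "\<And>v s. card {f\<in>F. ow f = s \<and> v \<in> f} \<le> 2"
    and h2: "\<And>s t. s \<noteq> t \<Longrightarrow>
      card {(e, v, f). e \<in> F \<and> ow e = s \<and> f \<in> F \<and> ow f = t \<and> v \<in> e \<and> v \<in> f} \<le> 4"
    and h3: "\<And>s. real (card (\<Union>{f\<in>F. ow f \<in> adjacent_owners F ow s})) \<le> c\<^sup>2"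
    and c: "0 < c"
    and deg: "\<And>v. v \<in> \<Union>F \<Longrightarrow> 4 < card {f\<in>F. v \<in> f}"
    and own: "\<And>s. s \<in> ow ` F \<Longrightarrow> 2 * c < real (card {f\<in>F. ow f = s})"
  shows False
proof -
  define d where "d v = real (card {f\<in>F. v \<in> f})" for v
  define N where "N s = real (card {f\<in>F. ow f = s})" for s
  define W where "W s = (\<Sum>e\<in>{f\<in>F. ow f = s}. \<Sum>v\<in>e. d v)" for s
  have finf: "finite f" if "f \<in> F" for f using two[OF that] by (metis card.infinite zero_neq_numeral)
  have finU: "finite (\<Union>F)" using fin finf by auto
  have d4: "d v > 4" if "v \<in> \<Union>F" for v using deg[OF that] by (simp add: d_def)
  have Npos: "N s > 0" if "s \<in> ow ` F" for s using own[OF that] c by (simp add: N_def)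
  have "\<exists>s\<in>ow ` F. \<forall>t\<in>ow ` F. W t / N t \<le> W s / N s"
  proof -
    have "finite (ow ` F)" "ow ` F \<noteq> {}" using fin ne by auto
    then have "Max ((\<lambda>s. W s / N s) ` ow ` F) \<in> (\<lambda>s. W s / N s) ` ow ` F"
      by (intro Max_in) auto
    then obtain s where "s \<in> ow ` F" "W s / N s = Max ((\<lambda>s. W s / N s) ` ow ` F)"
      by (metis (no_types, lifting) imageE)
    then show ?thesis using fin by (intro bexI[of _ s]) auto
  qed
  then obtain s where s: "s \<in> ow ` F" and smax: "\<And>t. t \<in> ow ` F \<Longrightarrow> W t / N t \<le> W s / N s"
    by blast
  define nb where "nb = adjacent_owners F ow s"
  have nb_sub: "nb \<subseteq> ow ` F" unfolding nb_def adjacent_owners_def by auto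
  have fnb: "finite nb" using nb_sub fin finite_subset by blast
  define F' where "F' = {f\<in>F. ow f \<in> nb}"
  have finF': "finite F'" using fin by (simp add: F'_def)
  \<comment> \<open>A is the degree sum of an average edge of s. The contradiction N s \<le> c will
    come from A * N s \<le> 8 |nb| \<le> A * c.\<close>
  define A where "A = W s / N s"
  have WA: "W s = A * N s" using Npos[OF s] by (simp add: A_def)
  obtain e0 where e0: "e0 \<in> F" "ow e0 = s" using s by auto
  have Wpos: "W s > 0"
    unfolding W_def
  proof (rule sum_pos2[where i=e0])
    show "finite {f \<in> F. ow f = s}" using fin by simp
    show "e0 \<in> {f \<in> F. ow f = s}" using e0 by simp
    have "e0 \<noteq> {}" using two[OF e0(1)] by auto
    then show "0 < (\<Sum>v\<in>e0. d v)"
      using finf[OF e0(1)] e0 d4 by (intro sum_pos) (fastforce)+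
    show "\<And>i. i \<in> {f \<in> F. ow f = s} \<Longrightarrow> 0 \<le> sum d i" by (auto simp: d_def intro!: sum_nonneg)
  qed
  have Apos: "A > 0" using Wpos Npos[OF s] by (simp add: A_def)
  let ?T = "\<lambda>t. {(e, v, f). e \<in> F \<and> ow e = s \<and> f \<in> F \<and> ow f = t \<and> v \<in> e \<and> v \<in> f}"
  \<comment> \<open>\<open>?S\<close> consists of the triples (e, v, f) in which an edge e of s
    meets at v an edge f of another owner. By \<open>h2\<close> there are at most 4 per neighbouring
    owner. From below, f ranges over at least d v - 2 \<ge> d v / 2 edges, since at most two edges
    at v belong to s and d v > 4.\<close>
  let ?S = "Sigma {f\<in>F. ow f = s} (\<lambda>e. Sigma e (\<lambda>v. {f\<in>F. ow f \<noteq> s \<and> v \<in> f}))"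
  have finT: "finite (?T t)" for t
    by (rule finite_subset[of _ "F \<times> \<Union>F \<times> F"]) (use fin finU in auto)
  have "?S \<subseteq> (\<Union>t\<in>nb. ?T t)"
    by (auto simp: nb_def adjacent_owners_def)
  then have "card ?S \<le> card (\<Union>t\<in>nb. ?T t)"
    using fnb finT by (intro card_mono) auto
  also have "\<dots> \<le> (\<Sum>t\<in>nb. card (?T t))" by (rule card_UN_le[OF fnb])
  also have "\<dots> \<le> (\<Sum>t\<in>nb. 4)"
  proof (rule sum_mono)
    fix t assume "t \<in> nb"
    then have "s \<noteq> t" by (auto simp: nb_def adjacent_owners_def)
    then show "card (?T t) \<le> 4" using h2[of s t] by simp
  qed
  finally have cS: "real (card ?S) \<le> 4 * real (card nb)" by simp
  have "real (card ?S) = (\<Sum>e\<in>{f\<in>F. ow f = s}. real (card (Sigma e (\<lambda>v. {f\<in>F. ow f \<noteq> s \<and> v \<in> f}))))"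
    using fin finf by (subst card_SigmaI) auto
  also have "\<dots> = (\<Sum>e\<in>{f\<in>F. ow f = s}. \<Sum>v\<in>e. real (card {f\<in>F. ow f \<noteq> s \<and> v \<in> f}))"
    using fin finf by (intro sum.cong refl, subst card_SigmaI) auto
  also have "\<dots> \<ge> (\<Sum>e\<in>{f\<in>F. ow f = s}. \<Sum>v\<in>e. d v / 2)"
  proof (intro sum_mono)
    fix e v assume e: "e \<in> {f\<in>F. ow f = s}" and v: "v \<in> e"
    have "card {f\<in>F. v \<in> f} = card ({f\<in>F. ow f \<noteq> s \<and> v \<in> f} \<union> {f\<in>F. ow f = s \<and> v \<in> f})"
      by (rule arg_cong[where f=card]) auto
    also have "\<dots> \<le> card {f\<in>F. ow f \<noteq> s \<and> v \<in> f} + card {f\<in>F. ow f = s \<and> v \<in> f}"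
      by (rule card_Un_le)
    also have "\<dots> \<le> card {f\<in>F. ow f \<noteq> s \<and> v \<in> f} + 2" using h1 by simp
    finally have "d v \<le> real (card {f\<in>F. ow f \<noteq> s \<and> v \<in> f}) + 2" unfolding d_def by linarith
    moreover have "d v > 4" using d4 e v by auto
    ultimately show "d v / 2 \<le> real (card {f\<in>F. ow f \<noteq> s \<and> v \<in> f})" by linarith
  qed
  finally have "W s / 2 \<le> real (card ?S)" unfolding W_def by (simp add: sum_divide_distrib)
  with cS have Wq: "W s \<le> 8 * real (card nb)" by linarith
  then have qpos: "real (card nb) > 0" using Wpos by linarith
  have part: "(\<Sum>t\<in>nb. \<Sum>e\<in>{f\<in>F. ow f = t}. g e) = (\<Sum>e\<in>F'. g e)" for g :: "'a set \<Rightarrow> real"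
  proof -
    have "(\<Sum>e\<in>F'. g e) = (\<Sum>t\<in>nb. \<Sum>e\<in>{f\<in>F'. ow f = t}. g e)"
      by (rule sum.group[OF finF' fnb, symmetric]) (auto simp: F'_def)
    also have "\<dots> = (\<Sum>t\<in>nb. \<Sum>e\<in>{f\<in>F. ow f = t}. g e)"
      by (intro sum.cong refl) (auto simp: F'_def)
    finally show ?thesis ..
  qed
  have NF': "(\<Sum>t\<in>nb. N t) = real (card F')" using part[of "\<lambda>_. 1"] by (simp add: N_def)
  have "real (card nb) * (2 * c) \<le> (\<Sum>t\<in>nb. N t)"
    using own nb_sub by (intro sum_bounded_below) (force simp: N_def)+
  then have F'q: "2 * c * real (card nb) \<le> real (card F')" by (simp add: NF' mult.commute)
  define U where "U = \<Union>F'"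
  have finUU: "finite U" unfolding U_def F'_def using finU by (rule rev_finite_subset) auto
  have cU: "real (card U) \<le> c\<^sup>2" using h3[of s] by (simp add: U_def F'_def nb_def)
  define d' where "d' v = real (card {f\<in>F'. v \<in> f})" for v
  have d'd: "d' v \<le> d v" for v unfolding d'_def d_def using fin by (auto simp: F'_def intro!: card_mono)
  have sd': "(\<Sum>v\<in>U. d' v) = 2 * real (card F')"
  proof -
    have "(\<Sum>v\<in>U. d' v) = (\<Sum>f\<in>F'. \<Sum>v\<in>f. 1)"
      using sum_edges_eq_sum_degree[OF finF' finUU, of "\<lambda>_. 1"] by (simp add: U_def d'_def)
    also have "\<dots> = (\<Sum>f\<in>F'. 2)" using two by (intro sum.cong) (auto simp: F'_def)
    finally show ?thesis by simp
  qed
  have "(\<Sum>t\<in>nb. W t) = (\<Sum>f\<in>F'. \<Sum>v\<in>f. d v)" unfolding W_def by (rule part)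
  also have "\<dots> = (\<Sum>v\<in>U. d' v * d v)"
    using sum_edges_eq_sum_degree[OF finF' finUU, of d] by (simp add: U_def d'_def)
  also have "\<dots> \<ge> (\<Sum>v\<in>U. (d' v)\<^sup>2)"
    using d'd by (intro sum_mono) (auto simp: power2_eq_square d'_def intro!: mult_left_mono)
  finally have W1: "(\<Sum>v\<in>U. (d' v)\<^sup>2) \<le> (\<Sum>t\<in>nb. W t)" .
  have WA': "(\<Sum>t\<in>nb. W t) \<le> A * real (card F')"
  proof -
    have "(\<Sum>t\<in>nb. W t) \<le> (\<Sum>t\<in>nb. A * N t)"
    proof (rule sum_mono)
      fix t assume "t \<in> nb"
      then have t: "t \<in> ow ` F" using nb_sub by blast
      then show "W t \<le> A * N t"
        using smax[OF t] Npos[OF t] unfolding A_def by (metis pos_divide_le_eq)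
    qed
    also have "\<dots> = A * (\<Sum>t\<in>nb. N t)" by (rule sum_distrib_left[symmetric])
    finally show ?thesis unfolding NF' .
  qed
  have "(2 * real (card F'))\<^sup>2 \<le> (\<Sum>v\<in>U. (d' v)\<^sup>2) * real (card U)"
    using sum_squared_le_sum_of_squares[of d' U] unfolding sd' .
  also have "\<dots> \<le> (A * real (card F')) * c\<^sup>2"
    using W1 WA' cU Apos by (intro mult_mono) auto
  finally have "(2 * real (card F'))\<^sup>2 \<le> A * real (card F') * c\<^sup>2" .
  moreover have F'pos: "real (card F') > 0"
    using F'q qpos c by (meson less_le_trans mult_pos_pos zero_less_numeral)
  ultimately have "real (card F') * (4 * real (card F')) \<le> real (card F') * (A * c\<^sup>2)"
    by (simp add: power2_eq_square mult_ac)
  then have a: "4 * real (card F') \<le> A * c\<^sup>2"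
    using F'pos by (rule mult_left_le_imp_le)
  have "8 * c * real (card nb) \<le> A * c\<^sup>2" using a F'q by linarith
  then have "8 * real (card nb) \<le> A * c" using c by (simp add: power2_eq_square)
  then have "A * N s \<le> A * c" using Wq WA by linarith
  then have "N s \<le> c" using Apos by simp
  then show False using own[OF s] c by (simp add: N_def)
qed

text \<open>Peeling: by \<open>dense_owned_edges_False\<close> a nonempty F has a vertex of degree
  at most 4 or an owner of at most 2c edges. Delete these edges and charge them to that vertex or
  owner. The hypotheses pass to subsets of F.\<close>

lemma card_owned_edges_le:
  fixes F :: "'a set set" and ow :: "'a set \<Rightarrow> 'b" and c :: real
  assumes fin: "finite F" and two: "\<And>f. f \<in> F \<Longrightarrow> card f = 2"
    and h1: "\<And>v s. card {f\<in>F. ow f = s \<and> v \<in> f} \<le> 2"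
    and h2: "\<And>s t. s \<noteq> t \<Longrightarrow>
      card {(e, v, f). e \<in> F \<and> ow e = s \<and> f \<in> F \<and> ow f = t \<and> v \<in> e \<and> v \<in> f} \<le> 4"
    and h3: "\<And>s. real (card (\<Union>{f\<in>F. ow f \<in> adjacent_owners F ow s})) \<le> c\<^sup>2"
    and c: "0 < c"
  shows "real (card F) \<le> 4 * real (card (\<Union>F)) + 2 * c * real (card (ow ` F))"
  using assms(1-5)
proof (induction "card F" arbitrary: F rule: less_induct)
  case less
  note fin = less.prems(1) and two = less.prems(2) and h1 = less.prems(3) and h2 = less.prems(4)
    and h3 = less.prems(5)
  have finf: "finite f" if "f \<in> F" for f using two[OF that] by (metis card.infinite zero_neq_numeral)
  have finU: "finite (\<Union>F)" using fin finf by auto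
  have IH: "real (card F') \<le> 4 * real (card (\<Union>F')) + 2 * c * real (card (ow ` F'))"
    if F': "F' \<subset> F" for F'
  proof (rule less.hyps)
    show "card F' < card F" using F' fin by (rule psubset_card_mono[rotated])
    show "finite F'" using F' fin finite_subset by blast
    show "card f = 2" if "f \<in> F'" for f using that F' two by auto
    show "card {f \<in> F'. ow f = s \<and> v \<in> f} \<le> 2" for v s
      by (rule order_trans[OF card_mono h1[of s v]]) (use F' fin in auto)
    show "card {(e, v, f). e \<in> F' \<and> ow e = s \<and> f \<in> F' \<and> ow f = t \<and> v \<in> e \<and> v \<in> f} \<le> 4"
      if "s \<noteq> t" for s t
    proof (rule order_trans[OF card_mono h2[OF that]])
      show "finite {(e, v, f). e \<in> F \<and> ow e = s \<and> f \<in> F \<and> ow f = t \<and> v \<in> e \<and> v \<in> f}"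
        by (rule finite_subset[of _ "F \<times> \<Union>F \<times> F"]) (use fin finU in auto)
    qed (use F' in auto)
    show "real (card (\<Union>{f\<in>F'. ow f \<in> adjacent_owners F' ow s})) \<le> c\<^sup>2" for s
    proof (rule order_trans[OF _ h3[of s]])
      have "\<Union>{f\<in>F'. ow f \<in> adjacent_owners F' ow s} \<subseteq> \<Union>{f\<in>F. ow f \<in> adjacent_owners F ow s}"
        using F' unfolding adjacent_owners_def by blast
      moreover have "finite (\<Union>{f\<in>F. ow f \<in> adjacent_owners F ow s})"
        using finU by (rule rev_finite_subset) auto
      ultimately show "real (card (\<Union>{f\<in>F'. ow f \<in> adjacent_owners F' ow s}))
        \<le> real (card (\<Union>{f\<in>F. ow f \<in> adjacent_owners F ow s}))"
        by (simp add: card_mono)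
    qed
  qed
  show ?case
  proof (cases "F = {}")
    case False
    consider (v) v where "v \<in> \<Union>F" "card {f\<in>F. v \<in> f} \<le> 4"
      | (s) s where "s \<in> ow ` F" "real (card {f\<in>F. ow f = s}) \<le> 2 * c"
      using dense_owned_edges_False[OF fin False two h1 h2 h3 c] by (meson not_le)
    then show ?thesis
    proof cases
      case v
      let ?F' = "{f\<in>F. v \<notin> f}"
      have sub: "?F' \<subset> F" using v(1) by auto
      have "F = ?F' \<union> {f\<in>F. v \<in> f}" by auto
      then have "card F \<le> card ?F' + card {f\<in>F. v \<in> f}" by (metis (lifting) card_Un_le)
      then have 1: "card F \<le> card ?F' + 4" using v(2) by linarith
      have "\<Union>?F' \<subseteq> \<Union>F - {v}" by auto
      then have "card (\<Union>?F') \<le> card (\<Union>F - {v})" using finU by (intro card_mono) auto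
      then have 2: "card (\<Union>?F') + 1 \<le> card (\<Union>F)"
        using card.remove[OF finU v(1)] by linarith
      have 3: "card (ow ` ?F') \<le> card (ow ` F)" using fin by (intro card_mono) auto
      have "2 * c * real (card (ow ` ?F')) \<le> 2 * c * real (card (ow ` F))"
        using 3 c by simp
      then show ?thesis using IH[OF sub] 1 2 by linarith
    next
      case s
      let ?F' = "{f\<in>F. ow f \<noteq> s}"
      have sub: "?F' \<subset> F" using s(1) by auto
      have "F = ?F' \<union> {f\<in>F. ow f = s}" by auto
      then have "card F \<le> card ?F' + card {f\<in>F. ow f = s}" by (metis (lifting) card_Un_le)
      then have 1: "real (card F) \<le> real (card ?F') + 2 * c" using s(2) by linarith
      have 2: "card (\<Union>?F') \<le> card (\<Union>F)" using finU by (intro card_mono) auto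
      have "ow ` ?F' \<subseteq> ow ` F - {s}" by auto
      then have "card (ow ` ?F') \<le> card (ow ` F - {s})" using fin by (intro card_mono) auto
      then have "card (ow ` ?F') + 1 \<le> card (ow ` F)"
        using card.remove[OF finite_imageI[OF fin] s(1)] by linarith
      then have "2 * c * (real (card (ow ` ?F')) + 1) \<le> 2 * c * real (card (ow ` F))"
        using c by (intro mult_left_mono) linarith+
      then show ?thesis using IH[OF sub] 1 2 by (simp add: algebra_simps)
    qed
  qed simp
qed

section \<open>Greedy spanners and the Moore bound\<close>

definition walk :: "'a set set \<Rightarrow> 'a list \<Rightarrow> bool" where
  "walk Q xs \<longleftrightarrow> xs \<noteq> [] \<and> successively (\<lambda>a b. {a, b} \<in> Q) xs"

text \<open>This plays the role of girth greater than \<open>2k\<close>, and avoids reasoning about cycles.\<close>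

definition unique_paths :: "nat \<Rightarrow> 'a set set \<Rightarrow> bool" where
  "unique_paths k Q \<longleftrightarrow> (\<forall>xs ys. walk Q xs \<longrightarrow> distinct xs \<longrightarrow> walk Q ys \<longrightarrow> distinct ys \<longrightarrow>
     hd xs = hd ys \<longrightarrow> last xs = last ys \<longrightarrow> length xs + length ys \<le> 2 * k + 2 \<longrightarrow> xs = ys)"

lemma unique_pathsD:
  assumes "unique_paths k Q" "walk Q xs" "distinct xs" "walk Q ys" "distinct ys"
    "hd xs = hd ys" "last xs = last ys" "length xs + length ys \<le> 2 * k + 2"
  shows "xs = ys"
  using assms unfolding unique_paths_def by blast

lemma walk_rev [simp]: "walk Q (rev xs) \<longleftrightarrow> walk Q xs"
  by (simp add: walk_def insert_commute)

lemma walk_append_iff: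
  assumes "xs \<noteq> []" "ys \<noteq> []"
  shows "walk Q (xs @ ys) \<longleftrightarrow> walk Q xs \<and> {last xs, hd ys} \<in> Q \<and> walk Q ys"
  using assms by (auto simp: walk_def successively_append_iff)

lemma walk_join:
  assumes "walk Q xs" "walk Q ys" "last xs = hd ys"
  shows "walk Q (xs @ tl ys)" "hd (xs @ tl ys) = hd xs" "last (xs @ tl ys) = last ys"
    "length (xs @ tl ys) + 1 = length xs + length ys"
proof -
  obtain y zs where ys: "ys = y # zs" using assms(2) by (cases ys) (auto simp: walk_def)
  have xs: "xs \<noteq> []" using assms(1) by (simp add: walk_def)
  show "walk Q (xs @ tl ys)"
    using assms by (cases zs) (auto simp: ys walk_def successively_append_iff)
  show "hd (xs @ tl ys) = hd xs" using xs by simp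
  show "last (xs @ tl ys) = last ys" using xs assms(3) by (simp add: ys)
  show "length (xs @ tl ys) + 1 = length xs + length ys" by (simp add: ys)
qed

lemma walk_subset:
  assumes "walk Q xs" "hd xs \<in> \<Union>Q"
  shows "set xs \<subseteq> \<Union>Q"
  using assms
proof (induction xs)
  case (Cons x xs)
  then show ?case by (cases xs) (auto simp: walk_def)
qed (simp add: walk_def)

lemma not_successively_decomp:
  assumes "\<not> successively P xs"
  obtains p q where "xs = p @ q" "p \<noteq> []" "q \<noteq> []" "\<not> P (last p) (hd q)"
  using assms
proof (induction xs arbitrary: thesis rule: induct_list012)
  case (3 x y zs)
  show ?case
  proof (cases "P x y")
    case True
    then have "\<not> successively P (y # zs)" using 3(4) by simp
    then obtain p q where "y # zs = p @ q" "p \<noteq> []" "q \<noteq> []" "\<not> P (last p) (hd q)"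
      using 3(2) by blast
    then show ?thesis by (intro 3(3)[of "x # p" q]) auto
  next
    case False
    then show ?thesis by (intro 3(3)[of "[x]" "y # zs"]) auto
  qed
qed auto

lemma walk_insertD:
  assumes "walk (insert {a, b} Q) xs" "\<not> {a, b} \<subseteq> set xs"
  shows "walk Q xs"
proof -
  have "successively (\<lambda>x y. {x, y} \<in> Q) xs"
  proof (rule successively_mono)
    show "successively (\<lambda>x y. {x, y} \<in> insert {a, b} Q) xs" using assms(1) by (simp add: walk_def)
    show "{x, y} \<in> Q" if "x \<in> set xs" "y \<in> set xs" "{x, y} \<in> insert {a, b} Q" for x y
      using that assms(2) by (metis empty_subsetI insertE insert_subset)
  qed
  then show ?thesis using assms(1) by (simp add: walk_def)
qed

text \<open>A distinct list uses {a, b} at most once: when it is split at that edge, neither half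
  contains both a and b.\<close>

lemma path_insert_cases:
  assumes "walk (insert {a, b} Q) xs" "distinct xs"
  obtains "walk Q xs"
  | p q where "xs = p @ q" "walk Q p" "walk Q q" "{last p, hd q} = {a, b}"
proof (cases "walk Q xs")
  case False
  then have "\<not> successively (\<lambda>a b. {a, b} \<in> Q) xs" using assms(1) by (simp add: walk_def)
  then obtain p q where pq: "xs = p @ q" "p \<noteq> []" "q \<noteq> []" "{last p, hd q} \<notin> Q"
    by (rule not_successively_decomp)
  have w: "walk (insert {a, b} Q) p" "walk (insert {a, b} Q) q"
    and e: "{last p, hd q} = {a, b}"
    using assms(1) pq by (auto simp: walk_append_iff)
  have disj: "set p \<inter> set q = {}" using assms(2) pq(1) by auto
  have mem: "last p \<in> set p" "hd q \<in> set q" using pq by auto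
  have "\<not> {a, b} \<subseteq> set p" "\<not> {a, b} \<subseteq> set q"
    unfolding e[symmetric] using disj mem by auto
  then have "walk Q p" "walk Q q" using w by (auto intro: walk_insertD)
  then show ?thesis using that(2) pq(1) e by blast
qed

text \<open>Lengths of lists count vertices: 2k + 2 vertices in two paths mean 2k edges, and
  \<open>no\<close> says that Q does not join a and b by fewer than 2k edges. Two short paths with
  common ends form a closed walk of at most 2k edges. If one of them uses {a, b}, the rest of it
  would join a and b too cheaply, unless both traverse {a, b} in the same direction; then their
  halves are compared within Q.\<close>

lemma unique_paths_insert:
  assumes U: "unique_paths k Q"
    and no: "\<And>xs. walk Q xs \<Longrightarrow> {hd xs, last xs} = {a, b} \<Longrightarrow> 2 * k < length xs"
  shows "unique_paths k (insert {a, b} Q)"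
proof -
  \<comment> \<open>Only one path uses the new edge: go back along p, forward along ys, and back
    along q.\<close>
  have one: False
    if "p @ q = xs" "walk Q p" "walk Q q" "{last p, hd q} = {a, b}" "walk Q ys"
      "hd xs = hd ys" "last xs = last ys" "length xs + length ys \<le> 2 * k + 2" for p q xs ys
  proof -
    have ne: "p \<noteq> []" "q \<noteq> []" "ys \<noteq> []" using that by (auto simp: walk_def)
    have h: "hd p = hd ys" "last q = last ys" using that ne by auto
    have rp: "walk Q (rev p)" "walk Q (rev q)" using that by auto
    have l: "last (rev p) = hd ys" using h ne by (simp add: last_rev)
    note j1 = walk_join[OF rp(1) that(5) l]
    have l2: "last (rev p @ tl ys) = hd (rev q)" using j1(3) h ne by (simp add: hd_rev)
    note j2 = walk_join[OF j1(1) rp(2) l2]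
    have "2 * k < length ((rev p @ tl ys) @ tl (rev q))"
    proof (rule no[OF j2(1)])
      show "{hd ((rev p @ tl ys) @ tl (rev q)), last ((rev p @ tl ys) @ tl (rev q))} = {a, b}"
        unfolding j2(2,3) j1(2) using that(4) ne by (simp add: hd_rev last_rev)
    qed
    moreover have "length ((rev p @ tl ys) @ tl (rev q)) + 2 = length xs + length ys"
      using j1(4) j2(4) that(1) by auto
    ultimately show False using that(8) by linarith
  qed
  show ?thesis
    unfolding unique_paths_def
  proof (intro allI impI)
    fix xs ys
    assume xs: "walk (insert {a, b} Q) xs" "distinct xs" and ys: "walk (insert {a, b} Q) ys" "distinct ys"
      and ends: "hd xs = hd ys" "last xs = last ys" and len: "length xs + length ys \<le> 2 * k + 2"
    show "xs = ys"
    proof (rule path_insert_cases[OF xs]; rule path_insert_cases[OF ys])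
      assume "walk Q xs" "walk Q ys"
      then show ?thesis using U xs ys ends len by (intro unique_pathsD[of k Q])
    next
      fix p q assume "walk Q xs" "ys = p @ q" "walk Q p" "walk Q q" "{last p, hd q} = {a, b}"
      then show ?thesis using one[of p q ys xs] ends len by simp
    next
      fix p q assume "xs = p @ q" "walk Q p" "walk Q q" "{last p, hd q} = {a, b}" "walk Q ys"
      then show ?thesis using one[of p q xs ys] ends len by simp
    next
      fix p q p' q'
      assume x: "xs = p @ q" "walk Q p" "walk Q q" "{last p, hd q} = {a, b}"
        and y: "ys = p' @ q'" "walk Q p'" "walk Q q'" "{last p', hd q'} = {a, b}"
      have ne: "p \<noteq> []" "q \<noteq> []" "p' \<noteq> []" "q' \<noteq> []" using x y by (auto simp: walk_def)
      then have pos: "length p > 0" "length q > 0" "length p' > 0" "length q' > 0" by auto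
      have len': "length p + length q + length p' + length q' \<le> 2 * k + 2" using len x y by simp
      have h: "hd p = hd p'" "last q = last q'" using ends x y ne by auto
      consider (same) "last p = last p'" "hd q = hd q'" | (opp) "last p = hd q'" "last p' = hd q"
        using x(4) y(4) by (metis doubleton_eq_iff)
      then show ?thesis
      proof cases
        case same
        have "p = p'"
          using U x y xs(2) ys(2) same h len' by (intro unique_pathsD[of k Q]) auto
        moreover have "q = q'"
          using U x y xs(2) ys(2) same h len' by (intro unique_pathsD[of k Q]) auto
        ultimately show ?thesis using x y by simp
      \<comment> \<open>Opposite directions: back along p and then forward along p' leads from one
        end of the new edge to the other.\<close>
      next
        case opp
        have rp: "walk Q (rev p)" using x by simp
        have l: "last (rev p) = hd p'" using h ne by (simp add: last_rev)
        note j = walk_join[OF rp y(2) l]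
        have "2 * k < length (rev p @ tl p')"
        proof (rule no[OF j(1)])
          show "{hd (rev p @ tl p'), last (rev p @ tl p')} = {a, b}"
            unfolding j(2,3) using x(4) opp ne by (simp add: hd_rev)
        qed
        moreover have "length (rev p @ tl p') + 1 = length p + length p'"
          using j(4) by (simp only: length_rev)
        ultimately show ?thesis using len' pos by linarith
      qed
    qed
  qed
qed

section \<open>The Moore bound and the greedy construction\<close>

text \<open>Count the distinct paths with k edges from a fixed vertex. Each extension step
  multiplies their number by at least D. Two of them with the same last vertex have 2k + 2 vertices
  in all, so they coincide by \<open>unique_paths\<close>; hence the last vertices are all
  different.\<close>

lemma moore_bound:
  assumes fin: "finite Q" and two: "\<And>f. f \<in> Q \<Longrightarrow> card f = 2" and ne: "Q \<noteq> {}"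
    and U: "unique_paths k Q"
    and deg: "\<And>v. v \<in> \<Union>Q \<Longrightarrow> D < card {f\<in>Q. v \<in> f}"
  shows "D ^ k \<le> card (\<Union>Q)"
proof -
  have finf: "finite f" if "f \<in> Q" for f using two[OF that] by (metis card.infinite zero_neq_numeral)
  have finU: "finite (\<Union>Q)" using fin finf by auto
  have noloop: "{x} \<notin> Q" for x using two[of "{x}"] by auto
  obtain f0 where f0: "f0 \<in> Q" using ne by auto
  then have "f0 \<noteq> {}" using two[OF f0] by auto
  then obtain v0 where v0: "v0 \<in> \<Union>Q" using f0 by auto
  define P where "P j = {xs. walk Q xs \<and> distinct xs \<and> hd xs = v0 \<and> length xs = Suc j}" for j
  have Psub: "set xs \<subseteq> \<Union>Q" if "xs \<in> P j" for xs j
    using that v0 walk_subset[of Q xs] by (auto simp: P_def)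
  have finP: "finite (P j)" for j
    by (rule finite_subset[OF _ finite_lists_length_eq[OF finU, of "Suc j"]]) (use Psub P_def in auto)
  define ext where "ext xs = {y. {last xs, y} \<in> Q \<and> y \<notin> set xs}" for xs
  have finext: "finite (ext xs)" for xs
    by (rule finite_subset[OF _ finU]) (auto simp: ext_def)
  have ext: "D \<le> card (ext xs)" if xs: "xs \<in> P j" and j: "j < k" for xs j
  proof -
    define x where "x = last xs"
    have xne: "xs \<noteq> []" using xs by (auto simp: P_def)
    then have xin: "x \<in> \<Union>Q" using Psub[OF xs] last_in_set[of xs] by (auto simp: x_def simp del: last_in_set)
    define N where "N = {y. {x, y} \<in> Q}"
    have finN: "finite N" by (rule finite_subset[OF _ finU]) (auto simp: N_def)
    have "{f\<in>Q. x \<in> f} \<subseteq> (\<lambda>y. {x, y}) ` N"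
    proof
      fix f assume f: "f \<in> {f\<in>Q. x \<in> f}"
      then have "card f = 2" using two by auto
      then obtain u v where "f = {u, v}" by (meson card_2_iff)
      then show "f \<in> (\<lambda>y. {x, y}) ` N" using f by (auto simp: N_def insert_commute)
    qed
    then have "card {f\<in>Q. x \<in> f} \<le> card N" using finN by (meson card_image_le card_mono finite_imageI le_trans)
    then have N: "D < card N" using deg[OF xin] by linarith
    \<comment> \<open>A neighbour y of x on the path must be the predecessor of x: otherwise the
      segment from y to x and the edge {y, x} are two short paths with the same ends. So only one of
      the more than D neighbours is lost.\<close>
    have "N \<inter> set xs \<subseteq> {last (butlast xs)}"
    proof
      fix y assume y: "y \<in> N \<inter> set xs"
      then obtain p r where pr: "xs = p @ y # r" by (meson IntD2 split_list)
      have yx: "y \<noteq> x" using y noloop by (auto simp: N_def)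
      then have r: "r \<noteq> []" using pr by (auto simp: x_def)
      have "y # r = [y, x]"
      proof (rule unique_pathsD[OF U])
        show "walk Q (y # r)"
          using xs pr by (cases "p = []") (auto simp: P_def walk_append_iff)
        show "distinct (y # r)" using xs pr by (auto simp: P_def)
        show "walk Q [y, x]" using y by (auto simp: walk_def N_def insert_commute)
        show "distinct [y, x]" using yx by simp
        show "hd (y # r) = hd [y, x]" by simp
        show "last (y # r) = last [y, x]" using pr by (simp add: x_def)
        show "length (y # r) + length [y, x] \<le> 2 * k + 2"
          using xs pr j by (auto simp: P_def)
      qed
      then show "y \<in> {last (butlast xs)}" using pr by (simp add: butlast_append)
    qed
    then have "card (N \<inter> set xs) \<le> card {last (butlast xs)}" by (intro card_mono) auto
    then have "card (N \<inter> set xs) \<le> 1" by simp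
    moreover have "N = ext xs \<union> (N \<inter> set xs)" by (auto simp: ext_def N_def x_def)
    then have "card N \<le> card (ext xs) + card (N \<inter> set xs)" by (metis card_Un_le)
    ultimately show ?thesis using N by linarith
  qed
  have step: "D * card (P j) \<le> card (P (Suc j))" if "j < k" for j
  proof -
    have "D * card (P j) = (\<Sum>xs\<in>P j. D)" by simp
    also have "\<dots> \<le> (\<Sum>xs\<in>P j. card (ext xs))" using ext[OF _ that] by (intro sum_mono) auto
    also have "\<dots> = card (Sigma (P j) ext)" using finP finext by (subst card_SigmaI) auto
    also have "\<dots> = card ((\<lambda>(xs, y). xs @ [y]) ` Sigma (P j) ext)"
      by (intro card_image[symmetric]) (auto simp: inj_on_def)
    also have "\<dots> \<le> card (P (Suc j))"
      by (intro card_mono finP)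
         (auto simp: P_def ext_def walk_append_iff walk_def successively_append_iff hd_append)
    finally show ?thesis .
  qed
  have "D ^ j \<le> card (P j)" if "j \<le> k" for j
    using that
  proof (induction j)
    case 0
    have "[v0] \<in> P 0" by (auto simp: P_def walk_def)
    then have "card (P 0) > 0" using finP card_gt_0_iff by blast
    then show ?case by simp
  next
    case (Suc j)
    then have "D * D ^ j \<le> D * card (P j)" by simp
    also have "\<dots> \<le> card (P (Suc j))" using step[of j] Suc.prems by simp
    finally show ?case by simp
  qed
  then have "D ^ k \<le> card (P k)" by simp
  also have "\<dots> = card (last ` P k)"
  proof (intro card_image[symmetric] inj_onI)
    fix xs ys assume "xs \<in> P k" "ys \<in> P k" "last xs = last ys"
    then show "xs = ys" by (intro unique_pathsD[OF U]) (auto simp: P_def)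
  qed
  also have "\<dots> \<le> card (\<Union>Q)"
  proof (intro card_mono finU image_subsetI)
    fix xs assume "xs \<in> P k"
    then show "last xs \<in> \<Union>Q" using Psub[of xs k] last_in_set[of xs] by (auto simp: P_def walk_def simp del: last_in_set)
  qed
  finally show ?thesis .
qed

lemma unique_paths_mono:
  assumes "unique_paths k Q" "Q' \<subseteq> Q"
  shows "unique_paths k Q'"
proof -
  have "walk Q xs" if "walk Q' xs" for xs
    using that assms(2) unfolding walk_def by (auto elim!: successively_mono)
  then show ?thesis using assms(1) unfolding unique_paths_def by blast
qed

text \<open>Peeling again: if all degrees exceeded D, \<open>moore_bound\<close> would give at least
  D ^ k vertices.\<close>

lemma card_le_of_unique_paths:
  assumes "finite Q" "\<And>f. f \<in> Q \<Longrightarrow> card f = 2" "unique_paths k Q" "card (\<Union>Q) < D ^ k"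
  shows "card Q \<le> D * card (\<Union>Q)"
  using assms
proof (induction "card Q" arbitrary: Q rule: less_induct)
  case less
  have finf: "finite f" if "f \<in> Q" for f using less.prems(2)[OF that] by (metis card.infinite zero_neq_numeral)
  have finU: "finite (\<Union>Q)" using less.prems(1) finf by auto
  show ?case
  proof (cases "Q = {}")
    case False
    then obtain v where v: "v \<in> \<Union>Q" "card {f\<in>Q. v \<in> f} \<le> D"
      using moore_bound[OF less.prems(1,2) False less.prems(3)] less.prems(4) by (meson not_le)
    let ?Q = "{f\<in>Q. v \<notin> f}"
    have sub: "?Q \<subset> Q" using v(1) by auto
    have "\<Union>?Q \<subseteq> \<Union>Q - {v}" by auto
    then have U: "card (\<Union>?Q) + 1 \<le> card (\<Union>Q)"
      using card.remove[OF finU v(1)] finU by (metis Suc_eq_plus1 Suc_le_mono card_mono finite_Diff)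
    have "card ?Q \<le> D * card (\<Union>?Q)"
    proof (rule less.hyps)
      show "card ?Q < card Q" using sub less.prems(1) by (rule psubset_card_mono[rotated])
      show "unique_paths k ?Q" using less.prems(3) by (rule unique_paths_mono) auto
    qed (use less.prems U in auto)
    moreover have "Q = ?Q \<union> {f\<in>Q. v \<in> f}" by auto
    then have "card Q \<le> card ?Q + card {f\<in>Q. v \<in> f}" by (metis (lifting) card_Un_le)
    ultimately have "card Q \<le> D * (card (\<Union>?Q) + 1)" using v(2) by simp
    also have "\<dots> \<le> D * card (\<Union>Q)" using U by (rule mult_left_mono) simp
    finally show ?thesis .
  qed simp
qed

text \<open>The edges are offered in order of increasing key, and one is rejected if the accepted
  ones already join its ends by at most 2k - 1 edges, that is 2k vertices. The walk replacing a
  rejected edge consists of earlier edges, hence of no larger key. An accepted edge meets the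
  hypothesis of \<open>unique_paths_insert\<close>, so the result is sparse by
  \<open>card_le_of_unique_paths\<close>.\<close>

lemma greedy_spanner:
  fixes key :: "'a set \<Rightarrow> 'b::linorder"
  assumes T: "finite T" "card T < D ^ k" and P: "finite P" "\<And>f. f \<in> P \<Longrightarrow> f \<subseteq> T \<and> card f = 2"
    and k: "1 \<le> k"
  obtains Q where "Q \<subseteq> P" "card Q \<le> D * card T"
    "\<And>a b. {a, b} \<in> P \<Longrightarrow> \<exists>xs. walk {f\<in>Q. key f \<le> key {a, b}} xs \<and> hd xs = a \<and> last xs = b \<and>
       length xs \<le> 2 * k"
proof -
  have "\<exists>Q\<subseteq>P. unique_paths k Q \<and> (\<forall>a b. {a, b} \<in> P \<longrightarrow>
      (\<exists>xs. walk {f\<in>Q. key f \<le> key {a, b}} xs \<and> hd xs = a \<and> last xs = b \<and> length xs \<le> 2 * k))"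
    using P
  proof (induction P rule: finite_ranking_induct[where f=key])
    case empty
    \<comment> \<open>Without edges a walk is a single vertex.\<close>
    have "unique_paths k ({} :: 'a set set)"
      unfolding unique_paths_def walk_def
    proof (intro allI impI)
      fix xs ys :: "'a list"
      assume xs: "xs \<noteq> [] \<and> successively (\<lambda>a b. {a, b} \<in> {}) xs"
        and ys: "ys \<noteq> [] \<and> successively (\<lambda>a b. {a, b} \<in> {}) ys" and "hd xs = hd ys"
      have single: "\<exists>z. zs = [z]" if "zs \<noteq> [] \<and> successively (\<lambda>a b. {a, b} \<in> {}) zs" for zs :: "'a list"
        using that by (cases zs) (auto simp: successively_Cons)
      show "xs = ys" using single[OF xs] single[OF ys] \<open>hd xs = hd ys\<close> by auto
    qed
    then show ?case by auto
  next
    case (insert e P)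
    obtain Q where Q: "Q \<subseteq> P" "unique_paths k Q"
      "\<And>a b. {a, b} \<in> P \<Longrightarrow>
        \<exists>xs. walk {f\<in>Q. key f \<le> key {a, b}} xs \<and> hd xs = a \<and> last xs = b \<and> length xs \<le> 2 * k"
    proof -
      have "\<exists>Q\<subseteq>P. unique_paths k Q \<and> (\<forall>a b. {a, b} \<in> P \<longrightarrow>
        (\<exists>xs. walk {f\<in>Q. key f \<le> key {a, b}} xs \<and> hd xs = a \<and> last xs = b \<and> length xs \<le> 2 * k))"
        by (rule insert.IH) (use insert.prems insert.hyps in auto)
      then show thesis using that by blast
    qed
    have "card e = 2" using insert.prems by simp
    then obtain a b where e: "e = {a, b}" by (meson card_2_iff)
    have mono: "walk Q'' xs" if "walk Q' xs" "Q' \<subseteq> Q''" for Q' Q'' :: "'a set set" and xs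
      using that unfolding walk_def by (auto elim!: successively_mono)
    show ?case
    proof (cases "\<exists>xs. walk Q xs \<and> {hd xs, last xs} = {a, b} \<and> length xs \<le> 2 * k")
      case True
      then obtain xs where xs: "walk Q xs" "{hd xs, last xs} = {a, b}" "length xs \<le> 2 * k" by blast
      have ne: "xs \<noteq> []" using xs(1) by (simp add: walk_def)
      \<comment> \<open>Elements are inserted in order of key, so all of Q passes the
        filter.\<close>
      have Qe: "Q = {f\<in>Q. key f \<le> key e}" using Q(1) insert.hyps by auto
      have "\<exists>xs. walk {f\<in>Q. key f \<le> key {a', b'}} xs \<and> hd xs = a' \<and> last xs = b' \<and> length xs \<le> 2 * k"
        if ab: "{a', b'} = e" for a' b'
      proof -
        have walk_e: "walk {f\<in>Q. key f \<le> key {a', b'}} xs" using xs(1) Qe ab by simp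
        consider "hd xs = a'" "last xs = b'" | "hd xs = b'" "last xs = a'"
          using xs(2) ab e by (metis doubleton_eq_iff)
        then show ?thesis
        proof cases
          case 1
          then show ?thesis using xs walk_e by auto
        next
          case 2
          then show ?thesis using xs walk_e ne by (intro exI[of _ "rev xs"]) (auto simp: hd_rev last_rev)
        qed
      qed
      then show ?thesis using Q by (intro exI[of _ Q]) auto
    next
      case False
      then have "unique_paths k (insert {a, b} Q)"
        by (intro unique_paths_insert[OF Q(2)]) (meson not_le)
      moreover have "\<exists>xs. walk {f\<in>insert e Q. key f \<le> key {a', b'}} xs \<and> hd xs = a' \<and> last xs = b' \<and>
          length xs \<le> 2 * k" if ab: "{a', b'} \<in> insert e P" for a' b'
      proof (cases "{a', b'} = e")
        case True
        then show ?thesis using k by (intro exI[of _ "[a', b']"]) (auto simp: walk_def)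
      next
        case False
        then obtain xs where "walk {f\<in>Q. key f \<le> key {a', b'}} xs" "hd xs = a'" "last xs = b'"
          "length xs \<le> 2 * k" using Q(3) ab by blast
        moreover from this(1) have "walk {f\<in>insert e Q. key f \<le> key {a', b'}} xs"
          by (rule mono) auto
        ultimately show ?thesis by blast
      qed
      ultimately show ?thesis using Q(1) e by (intro exI[of _ "insert e Q"]) auto
    qed
  qed
  then obtain Q where Q: "Q \<subseteq> P" "unique_paths k Q"
    "\<And>a b. {a, b} \<in> P \<Longrightarrow>
      \<exists>xs. walk {f\<in>Q. key f \<le> key {a, b}} xs \<and> hd xs = a \<and> last xs = b \<and> length xs \<le> 2 * k"
    by blast
  have sub: "\<Union>Q \<subseteq> T" using Q(1) P(2) by blast
  then have c: "card (\<Union>Q) \<le> card T" using T(1) by (rule card_mono[rotated])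
  have "card Q \<le> D * card (\<Union>Q)"
  proof (rule card_le_of_unique_paths)
    show "finite Q" using Q(1) P(1) finite_subset by blast
    show "card f = 2" if "f \<in> Q" for f using that Q(1) P(2) by blast
    show "card (\<Union>Q) < D ^ k" using c T(2) by linarith
  qed fact
  also have "\<dots> \<le> D * card T" using c by simp
  finally show ?thesis using that Q by blast
qed

section \<open>Shortest walks and exact preservers\<close>

fun ledges :: "'a list \<Rightarrow> 'a set set" where
  "ledges (x # y # zs) = insert {x, y} (ledges (y # zs))"
| "ledges _ = {}"

lemma walk_iff_ledges: "walk H xs \<longleftrightarrow> xs \<noteq> [] \<and> ledges xs \<subseteq> H"
  unfolding walk_def by (induction xs rule: ledges.induct) auto

lemma finite_ledges [simp]: "finite (ledges xs)"
  by (induction xs rule: ledges.induct) auto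

lemma ledges_subset: "f \<in> ledges xs \<Longrightarrow> f \<subseteq> set xs"
  by (induction xs rule: ledges.induct) auto

lemma ledges_append: "ledges (p @ v # q) = ledges (p @ [v]) \<union> ledges (v # q)"
  by (induction p rule: ledges.induct) (auto simp: insert_commute)

lemma ledges_rev [simp]: "ledges (rev xs) = ledges xs"
proof (induction xs rule: ledges.induct)
  case (1 x y zs)
  then show ?case using ledges_append[of "rev zs" y "[x]"] by (auto simp: insert_commute)
qed auto

text \<open>The outer parts repeat the end vertices of ys, so they depend on ys only through its
  ends. This is what allows ys to be exchanged for another list with the same ends;
  \<open>walk_sandwich\<close>, \<open>ends_sandwich\<close> and \<open>wlen_sandwich\<close> serve
  the same purpose.\<close>

lemma ledges_sandwich:
  assumes "ys \<noteq> []"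
  shows "ledges (p @ ys @ q) = ledges (p @ [hd ys]) \<union> ledges ys \<union> ledges (last ys # q)"
proof -
  obtain y zs where y: "ys = y # zs" using assms by (cases ys) auto
  obtain zs' y' where y': "ys = zs' @ [y']" using assms by (cases ys rule: rev_cases) auto
  have "ledges (p @ ys @ q) = ledges (p @ [y]) \<union> ledges (ys @ q)"
    using ledges_append[of p y "zs @ q"] y by simp
  also have "ledges (ys @ q) = ledges ys \<union> ledges (y' # q)"
    using ledges_append[of zs' y' q] y' by simp
  finally have eq: "ledges (p @ ys @ q) = ledges (p @ [y]) \<union> (ledges ys \<union> ledges (y' # q))" .
  have "hd ys = y" using y by simp
  moreover have "last ys = y'" using y' by simp
  ultimately show ?thesis by (simp only: eq Un_assoc)
qed

lemma walk_sandwich: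
  assumes "ys \<noteq> []"
  shows "walk H (p @ ys @ q) \<longleftrightarrow> walk H (p @ [hd ys]) \<and> walk H ys \<and> walk H (last ys # q)"
  using assms by (auto simp: walk_iff_ledges ledges_sandwich)

lemma ends_sandwich:
  assumes "ys \<noteq> []"
  shows "hd (p @ ys @ q) = hd (p @ [hd ys])" "last (p @ ys @ q) = last (last ys # q)"
  using assms by (auto simp: hd_append)

lemma ledges_hd: "distinct (y # d) \<Longrightarrow> f \<in> ledges (y # d) \<Longrightarrow> y \<in> f \<Longrightarrow> f = {y, hd d}"
  using ledges_subset[of f d] by (cases d) auto

lemma ledges_last: "distinct (a @ [x]) \<Longrightarrow> f \<in> ledges (a @ [x]) \<Longrightarrow> x \<in> f \<Longrightarrow> f = {last a, x}"
proof -
  assume a: "distinct (a @ [x])" "f \<in> ledges (a @ [x])" "x \<in> f"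
  have "f \<in> ledges (x # rev a)" using a(2) ledges_rev[of "x # rev a"] by simp
  then have "f = {x, hd (rev a)}" using a by (intro ledges_hd) auto
  moreover have "a \<noteq> []" using a(2) by auto
  ultimately show ?thesis by (simp add: hd_rev insert_commute)
qed

lemma card_ledges_at_le:
  assumes "distinct xs"
  shows "card {f\<in>ledges xs. v \<in> f} \<le> 2"
proof (cases "v \<in> set xs")
  case True
  then obtain a b where xs: "xs = a @ v # b" by (meson split_list)
  have "{f\<in>ledges xs. v \<in> f} \<subseteq> {{last a, v}, {v, hd b}}"
    using assms ledges_hd[of v b] ledges_last[of a v] unfolding xs ledges_append[of a v b] by auto
  then have "card {f\<in>ledges xs. v \<in> f} \<le> card {{last a, v}, {v, hd b}}" by (intro card_mono) auto
  also have "\<dots> \<le> 2" by (simp add: card_insert_if)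
  finally show ?thesis .
next
  case False
  then have none: "{f\<in>ledges xs. v \<in> f} = {}" using ledges_subset by blast
  show ?thesis unfolding none by simp
qed

text \<open>The order in which v and v' occur is unknown, hence the alternative with
  \<open>rev ys\<close>.\<close>

lemma sublist_between:
  assumes "v \<in> set xs" "v' \<in> set xs"
  obtains p ys q where "ys \<noteq> []" "hd ys = v" "last ys = v'" "xs = p @ ys @ q \<or> xs = p @ rev ys @ q"
proof -
  obtain p q where xs: "xs = p @ v # q" using assms(1) by (meson split_list)
  consider "v' \<in> set (v # q)" | "v' \<in> set p" using assms(2) xs by auto
  then show ?thesis
  proof cases
    case 1
    then obtain s t where st: "v # q = s @ v' # t" by (meson split_list)
    then have "hd (s @ [v']) = v" by (cases s) auto
    then show ?thesis using that[of "s @ [v']" p t] xs st by simp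
  next
    case 2
    then obtain s t where st: "p = s @ v' # t" by (meson split_list)
    show ?thesis using that[of "rev (v' # t @ [v])" s q] xs st by simp
  qed
qed

section \<open>Weighted graphs, distances and shortest walks\<close>

text \<open>Edges are two-element sets, so a subgraph on the same vertices is just a subset of E,
  and counting its edges is taking a cardinality.\<close>

locale wgraph =
  fixes V :: "'a set" and E :: "'a set set" and wt :: "'a set \<Rightarrow> real"
  assumes finite_V: "finite V"
    and edge_subset: "e \<in> E \<Longrightarrow> e \<subseteq> V"
    and card_edge: "e \<in> E \<Longrightarrow> card e = 2"
    and wt_pos: "e \<in> E \<Longrightarrow> 0 < wt e"
begin

lemma finite_E: "finite E"
  using finite_V edge_subset by (meson PowI finite_Pow_iff finite_subset subsetI)

fun wlen :: "'a list \<Rightarrow> real" where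
  "wlen (x # y # zs) = wt {x, y} + wlen (y # zs)"
| "wlen _ = 0"

lemma wlen_append: "wlen (p @ v # q) = wlen (p @ [v]) + wlen (v # q)"
  by (induction p rule: ledges.induct) auto

lemma wlen_rev [simp]: "wlen (rev xs) = wlen xs"
proof (induction xs rule: wlen.induct)
  case (1 x y zs)
  then show ?case using wlen_append[of "rev zs" y "[x]"] by (simp add: insert_commute)
qed auto

lemma wlen_sandwich:
  assumes "ys \<noteq> []"
  shows "wlen (p @ ys @ q) = wlen (p @ [hd ys]) + wlen ys + wlen (last ys # q)"
proof -
  obtain y zs where y: "ys = y # zs" using assms by (cases ys) auto
  obtain zs' y' where y': "ys = zs' @ [y']" using assms by (cases ys rule: rev_cases) auto
  have "wlen (p @ ys @ q) = wlen (p @ [y]) + wlen (ys @ q)"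
    using wlen_append[of p y "zs @ q"] y by simp
  also have "wlen (ys @ q) = wlen ys + wlen (y' # q)"
    using wlen_append[of zs' y' q] y' by simp
  finally have eq: "wlen (p @ ys @ q) = wlen (p @ [y]) + (wlen ys + wlen (y' # q))" .
  have "hd ys = y" using y by simp
  moreover have "last ys = y'" using y' by simp
  ultimately show ?thesis by (simp only: eq add.assoc)
qed

lemma wlen_nonneg: "walk E xs \<Longrightarrow> 0 \<le> wlen xs"
  by (induction xs rule: wlen.induct) (auto simp: walk_def dest!: wt_pos)

lemma wlen_pos: "walk E xs \<Longrightarrow> 2 \<le> length xs \<Longrightarrow> 0 < wlen xs"
proof (induction xs rule: wlen.induct)
  case (1 x y zs)
  then have "walk E (y # zs)" "0 < wt {x, y}" by (auto simp: walk_def intro: wt_pos)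
  then show ?case using wlen_nonneg[of "y # zs"] by simp
qed auto

text \<open>This expresses that the distance in H is at most r. The relation needs no value for
  unreachable pairs and is monotone in both H and r.\<close>

definition near :: "'a set set \<Rightarrow> 'a \<Rightarrow> 'a \<Rightarrow> real \<Rightarrow> bool" where
  "near H x y r \<longleftrightarrow> (\<exists>xs. walk H xs \<and> hd xs = x \<and> last xs = y \<and> wlen xs \<le> r)"

lemma nearI: "walk H xs \<Longrightarrow> hd xs = x \<Longrightarrow> last xs = y \<Longrightarrow> wlen xs \<le> r \<Longrightarrow> near H x y r"
  unfolding near_def by blast

lemma near_refl: "0 \<le> r \<Longrightarrow> near H x x r"
  by (rule nearI[of H "[x]"]) (auto simp: walk_def)

lemma near_edge: "{x, y} \<in> H \<Longrightarrow> wt {x, y} \<le> r \<Longrightarrow> near H x y r"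
  by (rule nearI[of H "[x, y]"]) (auto simp: walk_def)

lemma near_mono: "near H x y r \<Longrightarrow> H \<subseteq> H' \<Longrightarrow> r \<le> r' \<Longrightarrow> near H' x y r'"
  unfolding near_def walk_iff_ledges by (elim exE conjE, intro exI conjI) auto

lemma near_sym: "near H x y r \<Longrightarrow> near H y x r"
proof -
  assume "near H x y r"
  then obtain xs where "walk H xs" "hd xs = x" "last xs = y" "wlen xs \<le> r"
    unfolding near_def by blast
  then show ?thesis
    by (intro nearI[of H "rev xs"]) (auto simp: walk_def hd_rev last_rev insert_commute)
qed

lemma near_trans:
  assumes "near H x y r" "near H y z r'"
  shows "near H x z (r + r')"
proof -
  obtain xs where xs: "walk H xs" "hd xs = x" "last xs = y" "wlen xs \<le> r"
    using assms(1) unfolding near_def by blast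
  obtain ys where ys: "walk H ys" "hd ys = y" "last ys = z" "wlen ys \<le> r'"
    using assms(2) unfolding near_def by blast
  obtain zs where zs: "ys = y # zs" using ys by (cases ys) (auto simp: walk_def)
  have ne: "xs \<noteq> []" using xs by (simp add: walk_def)
  have 1: "walk H (xs @ zs)"
    using walk_sandwich[OF ne, of H "[]" zs] xs ys zs by (simp add: walk_def)
  have 2: "wlen (xs @ zs) = wlen xs + wlen ys"
    using wlen_sandwich[OF ne, of "[]" zs] xs ys zs by simp
  show ?thesis
    by (rule nearI[OF 1]) (use 2 xs ys zs ne in auto)
qed

lemma near_nonneg: "near E x y r \<Longrightarrow> 0 \<le> r"
  unfolding near_def using wlen_nonneg by force

definition shortest :: "'a list \<Rightarrow> bool" where
  "shortest xs \<longleftrightarrow> walk E xs \<and>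
     (\<forall>ys. walk E ys \<longrightarrow> hd ys = hd xs \<longrightarrow> last ys = last xs \<longrightarrow> wlen xs \<le> wlen ys)"

text \<open>Cut out a closed subwalk; positive weights make the rest strictly shorter. Hence
  shortest walks are distinct.\<close>

lemma not_distinct_shorten:
  assumes "walk E xs" "\<not> distinct xs"
  obtains ys where "walk E ys" "hd ys = hd xs" "last ys = last xs" "wlen ys < wlen xs"
    "length ys < length xs"
proof -
  obtain a v b c where xs: "xs = a @ [v] @ b @ [v] @ c" using not_distinct_decomp[OF assms(2)] by blast
  let ?m = "[v] @ b @ [v]"
  have eq: "xs = a @ ?m @ c" using xs by simp
  have w: "walk E (a @ [v])" "walk E ?m" "walk E (v # c)"
    using assms(1) walk_sandwich[of ?m E a c] unfolding eq by simp_all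
  have l: "wlen xs = wlen (a @ [v]) + wlen ?m + wlen (v # c)"
    using wlen_sandwich[of ?m a c] unfolding eq by simp
  have "0 < wlen ?m" using w(2) by (rule wlen_pos) simp
  moreover have "wlen (a @ v # c) = wlen (a @ [v]) + wlen (v # c)" by (rule wlen_append)
  moreover have "walk E (a @ v # c)" using walk_sandwich[of "[v]" E a c] w by (simp add: walk_def[of E "[v]"])
  ultimately show ?thesis using that[of "a @ v # c"] l eq by (simp add: hd_append)
qed

lemma shortest_distinct: "shortest xs \<Longrightarrow> distinct xs"
  unfolding shortest_def using not_distinct_shorten[of xs] by (metis not_le)

lemma ex_distinct_walk:
  assumes "walk E xs"
  shows "\<exists>ys. walk E ys \<and> distinct ys \<and> hd ys = hd xs \<and> last ys = last xs \<and> wlen ys \<le> wlen xs"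
  using assms
proof (induction "length xs" arbitrary: xs rule: less_induct)
  case less
  show ?case
  proof (cases "distinct xs")
    case False
    then obtain ys where ys: "walk E ys" "hd ys = hd xs" "last ys = last xs" "wlen ys < wlen xs"
      "length ys < length xs" using less.prems not_distinct_shorten by blast
    then show ?thesis using less.hyps[of ys] by (metis less_imp_le order_trans)
  qed (use less.prems in auto)
qed

text \<open>The first vertex is listed separately because a one-element list is a walk even outside
  V.\<close>

lemma walk_E_subset: "walk E xs \<Longrightarrow> set xs \<subseteq> insert (hd xs) V"
proof (induction xs)
  case (Cons x xs)
  then show ?case using edge_subset by (cases xs) (auto simp: walk_def)
qed simp

text \<open>Only the distinct walks have to be compared, and there are finitely many of
  them.\<close>

lemma ex_shortest:
  assumes "walk E xs"
  obtains ys where "shortest ys" "hd ys = hd xs" "last ys = last xs"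
proof -
  let ?S = "{ys. walk E ys \<and> distinct ys \<and> hd ys = hd xs \<and> last ys = last xs}"
  have "?S \<subseteq> {ys. set ys \<subseteq> insert (hd xs) V \<and> distinct ys}"
    using walk_E_subset by fastforce
  then have fin: "finite ?S"
    using finite_subset_distinct[of "insert (hd xs) V"] finite_V finite_subset by blast
  have ne: "?S \<noteq> {}" using ex_distinct_walk[OF assms] by blast
  obtain ys where ys: "ys \<in> ?S" "\<And>zs. zs \<in> ?S \<Longrightarrow> wlen ys \<le> wlen zs"
    using fin ne by (metis (no_types, lifting) arg_min_if_finite(1) arg_min_least)
  have "shortest ys"
    unfolding shortest_def
  proof (intro conjI allI impI)
    show "walk E ys" using ys by simp
    fix zs assume zs: "walk E zs" "hd zs = hd ys" "last zs = last ys"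
    then obtain zs' where "walk E zs'" "distinct zs'" "hd zs' = hd zs" "last zs' = last zs"
      "wlen zs' \<le> wlen zs" using ex_distinct_walk by blast
    then show "wlen ys \<le> wlen zs" using ys(2)[of zs'] zs ys(1) by simp
  qed
  then show ?thesis using that ys(1) by auto
qed

lemma ex_min_near:
  assumes "near E x y r"
  obtains d where "near E x y d" "\<And>s. near E x y s \<Longrightarrow> d \<le> s" "0 \<le> d"
proof -
  obtain xs where xs: "walk E xs" "hd xs = x" "last xs = y" using assms unfolding near_def by blast
  obtain ys where ys: "shortest ys" "hd ys = hd xs" "last ys = last xs" using ex_shortest[OF xs(1)] .
  have w: "walk E ys" using ys(1) by (simp add: shortest_def)
  show ?thesis
  proof (rule that)
    show "near E x y (wlen ys)" by (rule nearI[OF w]) (use ys xs in auto)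
    show "wlen ys \<le> s" if "near E x y s" for s
      using that ys xs unfolding near_def shortest_def by fastforce
    show "0 \<le> wlen ys" using w by (rule wlen_nonneg)
  qed
qed

lemma shortest_rev: "shortest xs \<Longrightarrow> shortest (rev xs)"
proof -
  assume xs: "shortest xs"
  then have ne: "xs \<noteq> []" by (simp add: shortest_def walk_def)
  show ?thesis
    unfolding shortest_def
  proof (intro conjI allI impI)
    show "walk E (rev xs)" using xs by (simp add: shortest_def)
    fix ys assume ys: "walk E ys" "hd ys = hd (rev xs)" "last ys = last (rev xs)"
    then have "ys \<noteq> []" by (simp add: walk_def)
    then have "walk E (rev ys)" "hd (rev ys) = hd xs" "last (rev ys) = last xs"
      using ys ne by (auto simp: hd_rev last_rev)
    then have "wlen xs \<le> wlen (rev ys)" using xs unfolding shortest_def by blast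
    then show "wlen (rev xs) \<le> wlen ys" by simp
  qed
qed

lemma shortest_subwalk:
  assumes "shortest (p @ ys @ q)" "ys \<noteq> []"
  shows "shortest ys"
  unfolding shortest_def
proof (intro conjI allI impI)
  have w: "walk E (p @ [hd ys])" "walk E ys" "walk E (last ys # q)"
    using assms walk_sandwich[OF assms(2)] by (auto simp: shortest_def)
  then show "walk E ys" by simp
  fix zs assume zs: "walk E zs" "hd zs = hd ys" "last zs = last ys"
  then have ne: "zs \<noteq> []" by (simp add: walk_def)
  have "walk E (p @ zs @ q)" using walk_sandwich[OF ne, of E p q] w zs by simp
  moreover have "hd (p @ zs @ q) = hd (p @ ys @ q)" "last (p @ zs @ q) = last (p @ ys @ q)"
    using ends_sandwich[OF ne, of p q] ends_sandwich[OF assms(2), of p q] zs by simp_all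
  ultimately have "wlen (p @ ys @ q) \<le> wlen (p @ zs @ q)"
    using assms(1) unfolding shortest_def by blast
  then show "wlen ys \<le> wlen zs"
    using wlen_sandwich[OF ne, of p q] wlen_sandwich[OF assms(2), of p q] zs by simp
qed

lemma near_on_walk:
  assumes "walk E xs" "v \<in> set xs" "v' \<in> set xs"
  shows "near E v v' (wlen xs)"
proof -
  obtain p ys q where ys: "ys \<noteq> []" "hd ys = v" "last ys = v'" "xs = p @ ys @ q \<or> xs = p @ rev ys @ q"
    using sublist_between[OF assms(2,3)] .
  have "walk E ys \<and> wlen ys \<le> wlen xs"
  proof -
    obtain zs where zs: "zs \<noteq> []" "xs = p @ zs @ q" "zs = ys \<or> zs = rev ys" using ys by auto
    have w: "walk E (p @ [hd zs])" "walk E zs" "walk E (last zs # q)"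
      using assms(1) walk_sandwich[OF zs(1), of E p q] zs(2) by simp_all
    have "wlen zs \<le> wlen xs"
      using wlen_sandwich[OF zs(1), of p q] w(1,3)[THEN wlen_nonneg] zs(2) by simp
    then show ?thesis using w(2) zs(3) by auto
  qed
  then show ?thesis using ys by (intro nearI[of E ys]) auto
qed

section \<open>Greedy choice of shortest walks, and the exact preserver\<close>

text \<open>If a shortest walk is chosen with as few edges outside F as possible, then it has no such edge
  between two vertices of a walk that already lies in F: otherwise it could be rerouted.\<close>

lemma min_new_edges_between:
  assumes s: "shortest s" "ledges s \<subseteq> F"
    and t: "shortest (p @ m @ q)" "m \<noteq> []"
    and min: "\<And>t'. shortest t' \<Longrightarrow> hd t' = hd (p @ m @ q) \<Longrightarrow> last t' = last (p @ m @ q) \<Longrightarrow>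
      card (ledges (p @ m @ q) - F) \<le> card (ledges t' - F)"
    and mem: "hd m \<in> set s" "last m \<in> set s"
  shows "ledges m \<subseteq> F"
proof -
  obtain a ys b where ys: "ys \<noteq> []" "hd ys = hd m" "last ys = last m"
    "s = a @ ys @ b \<or> s = a @ rev ys @ b"
    using sublist_between[OF mem] .
  have sy: "shortest ys"
    using ys(4)
  proof
    assume "s = a @ ys @ b"
    then show ?thesis using s(1) ys(1) shortest_subwalk by blast
  next
    assume "s = a @ rev ys @ b"
    then have "shortest (rev ys)" using s(1) ys(1) shortest_subwalk[of a "rev ys" b] by simp
    then show ?thesis using shortest_rev[of "rev ys"] by simp
  qed
  have ysF: "ledges ys \<subseteq> F"
  proof -
    obtain zs where zs: "zs \<noteq> []" "s = a @ zs @ b" "zs = ys \<or> zs = rev ys" using ys by auto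
    then have "ledges zs \<subseteq> F" using s(2) ledges_sandwich[OF zs(1), of a b] by auto
    then show ?thesis using zs(3) by auto
  qed
  have sm: "shortest m" using t shortest_subwalk by blast
  have len: "wlen ys = wlen m" using sy sm ys unfolding shortest_def by (metis order_antisym)
  let ?t' = "p @ ys @ q"
  have wt': "walk E ?t'"
    using walk_sandwich[OF ys(1), of E p q] walk_sandwich[OF t(2), of E p q] t(1) sy ys
    by (simp add: shortest_def)
  have ends: "hd ?t' = hd (p @ m @ q)" "last ?t' = last (p @ m @ q)"
    using ends_sandwich[OF ys(1), of p q] ends_sandwich[OF t(2), of p q] ys by simp_all
  have "wlen ?t' = wlen (p @ m @ q)"
    using wlen_sandwich[OF ys(1), of p q] wlen_sandwich[OF t(2), of p q] ys len by simp
  then have "shortest ?t'" using t(1) wt' ends unfolding shortest_def by simp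
  then have le: "card (ledges (p @ m @ q) - F) \<le> card (ledges ?t' - F)" using min ends by blast
  define R where "R = ledges (p @ [hd m]) \<union> ledges (last m # q)"
  have R: "ledges (p @ m @ q) = R \<union> ledges m" "ledges ?t' = R \<union> ledges ys"
    using ledges_sandwich[OF t(2), of p q] ledges_sandwich[OF ys(1), of p q] ys
    by (auto simp: R_def)
  have dist: "distinct (p @ m @ q)" using t(1) by (rule shortest_distinct)
  \<comment> \<open>The parts around m share with m only single vertices. So exchanging m for ys
    saves all new edges of m and adds none, as the edges of ys lie in F.\<close>
  have disj: "R \<inter> ledges m = {}"
  proof (rule ccontr)
    assume "R \<inter> ledges m \<noteq> {}"
    then obtain f where f: "f \<in> R" "f \<in> ledges m" by auto
    have "f \<in> E" using f(2) sm by (auto simp: shortest_def walk_iff_ledges)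
    then have c: "card f = 2" by (rule card_edge)
    have fm: "f \<subseteq> set m" using f(2) by (rule ledges_subset)
    have "f \<subseteq> insert (hd m) (set p) \<or> f \<subseteq> insert (last m) (set q)"
      using f(1) ledges_subset unfolding R_def by fastforce
    then have "f \<subseteq> {hd m} \<or> f \<subseteq> {last m}" using fm dist by auto
    then have "card f \<le> 1" by (metis card.empty card_1_singleton_iff le_numeral_extra(4) subset_singletonD zero_le_one One_nat_def)
    then show False using c by simp
  qed
  have finR: "finite R" by (simp add: R_def)
  have "card (ledges (p @ m @ q) - F) = card ((R - F) \<union> (ledges m - F))"
    unfolding R by (rule arg_cong[where f=card]) auto
  also have "\<dots> = card (R - F) + card (ledges m - F)"
    using disj finR by (intro card_Un_disjoint) auto
  finally have "card (R - F) + card (ledges m - F) \<le> card (R - F)"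
    using le R(2) ysF by (simp add: Un_Diff Diff_eq_empty_iff[THEN iffD2])
  then have "card (ledges m - F) = 0" by simp
  then show ?thesis by simp
qed

text \<open>Let x and y be the first and the last vertex of t on s. Between them t has no new edge,
  by \<open>min_new_edges_between\<close>. Outside, only the edge entering x and the edge leaving y
  can touch s.\<close>

lemma card_new_edges_touching_le:
  assumes s: "shortest s" "ledges s \<subseteq> F"
    and t: "shortest t"
    and min: "\<And>t'. shortest t' \<Longrightarrow> hd t' = hd t \<Longrightarrow> last t' = last t \<Longrightarrow>
      card (ledges t - F) \<le> card (ledges t' - F)"
  shows "card {(e, v). e \<in> ledges t - F \<and> v \<in> e \<and> v \<in> set s} \<le> 2"
proof (cases "set t \<inter> set s = {}")
  case True
  then have none: "{(e, v). e \<in> ledges t - F \<and> v \<in> e \<and> v \<in> set s} = {}"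
    using ledges_subset by fastforce
  show ?thesis unfolding none by simp
next
  case False
  then have "\<exists>x\<in>set t. x \<in> set s" by auto
  from split_list_first_prop[OF this] obtain a x b
    where t1: "t = a @ x # b" "x \<in> set s" "\<forall>y\<in>set a. y \<notin> set s" by blast
  have "\<exists>y\<in>set (x # b). y \<in> set s" using t1 by auto
  from split_list_last_prop[OF this] obtain c y d
    where t2: "x # b = c @ y # d" "y \<in> set s" "\<forall>z\<in>set d. z \<notin> set s" by blast
  define m where "m = c @ [y]"
  have m: "m \<noteq> []" "hd m = x" "last m = y"
    using t2(1) by (auto simp: m_def) (cases c; auto)
  have teq: "t = a @ m @ d" using t1(1) t2(1) by (simp add: m_def)
  have "distinct (a @ x # b)" "distinct (a @ m @ d)" using shortest_distinct[OF t] t1(1) teq by metis+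
  then have dist: "distinct (a @ [x])" "distinct (y # d)" by (auto simp: m_def)
  have "ledges m \<subseteq> F"
    using s t min m t1(2) t2(2) unfolding teq by (intro min_new_edges_between[of s F a m d]) auto
  then have sub: "ledges t - F \<subseteq> ledges (a @ [x]) \<union> ledges (y # d)"
    unfolding teq ledges_sandwich[OF m(1)] m by auto
  have "{(e, v). e \<in> ledges t - F \<and> v \<in> e \<and> v \<in> set s} \<subseteq> {({last a, x}, x), ({y, hd d}, y)}"
  proof (rule subsetI)
    fix ev assume "ev \<in> {(e, v). e \<in> ledges t - F \<and> v \<in> e \<and> v \<in> set s}"
    then obtain e v where ev: "ev = (e, v)" and e: "e \<in> ledges t" "e \<notin> F" "v \<in> e" "v \<in> set s"
      by blast
    have "e \<in> ledges (a @ [x]) \<or> e \<in> ledges (y # d)" using e sub by auto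
    then have "e = {last a, x} \<and> v = x \<or> e = {y, hd d} \<and> v = y"
    proof
      assume e': "e \<in> ledges (a @ [x])"
      have "v = x" using ledges_subset[OF e'] e t1(3) by auto
      then show ?thesis using ledges_last[OF dist(1) e'] e by simp
    next
      assume e': "e \<in> ledges (y # d)"
      have "v = y" using ledges_subset[OF e'] e t2(3) by auto
      then show ?thesis using ledges_hd[OF dist(2) e'] e by simp
    qed
    then show "ev \<in> {({last a, x}, x), ({y, hd d}, y)}" using ev by blast
  qed
  then have "card {(e, v). e \<in> ledges t - F \<and> v \<in> e \<and> v \<in> set s}
      \<le> card {({last a, x}, x), ({y, hd d}, y)}"
    by (intro card_mono) auto
  also have "\<dots> \<le> 2" by (simp add: card_insert_if)
  finally show ?thesis .
qed

text \<open>The pairs are served one after the other, and \<open>ow e\<close> is the pair whose walk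
  brought e in. Of two pairs, the later one has at most two incidences of its own edges with the
  earlier walk; the disjunction records this without recording the order.\<close>

definition greedy_family ::
    "('a \<times> 'a) set \<Rightarrow> ('a \<times> 'a \<Rightarrow> 'a list) \<Rightarrow> ('a set \<Rightarrow> 'a \<times> 'a) \<Rightarrow> 'a set set \<Rightarrow> bool" where
  "greedy_family Q \<pi> ow F \<longleftrightarrow> F = (\<Union>q\<in>Q. ledges (\<pi> q)) \<and>
    (\<forall>q\<in>Q. shortest (\<pi> q) \<and> hd (\<pi> q) = fst q \<and> last (\<pi> q) = snd q) \<and>
    (\<forall>e\<in>F. ow e \<in> Q \<and> e \<in> ledges (\<pi> (ow e))) \<and>
    (\<forall>s\<in>Q. \<forall>t\<in>Q. s \<noteq> t \<longrightarrow>
      card {(e, v). e \<in> F \<and> ow e = s \<and> v \<in> e \<and> v \<in> set (\<pi> t)} \<le> 2 \<or>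
      card {(e, v). e \<in> F \<and> ow e = t \<and> v \<in> e \<and> v \<in> set (\<pi> s)} \<le> 2)"

lemma greedy_familyD:
  assumes "greedy_family Q \<pi> ow F"
  shows "F = (\<Union>q\<in>Q. ledges (\<pi> q))"
    and "q \<in> Q \<Longrightarrow> shortest (\<pi> q) \<and> hd (\<pi> q) = fst q \<and> last (\<pi> q) = snd q"
    and "e \<in> F \<Longrightarrow> ow e \<in> Q \<and> e \<in> ledges (\<pi> (ow e))"
    and "s \<in> Q \<Longrightarrow> t \<in> Q \<Longrightarrow> s \<noteq> t \<Longrightarrow>
      card {(e, v). e \<in> F \<and> ow e = s \<and> v \<in> e \<and> v \<in> set (\<pi> t)} \<le> 2 \<or>
      card {(e, v). e \<in> F \<and> ow e = t \<and> v \<in> e \<and> v \<in> set (\<pi> s)} \<le> 2"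
  using assms unfolding greedy_family_def by blast+

lemma ex_greedy_family:
  assumes "finite Q" "\<And>q. q \<in> Q \<Longrightarrow> \<exists>r. near E (fst q) (snd q) r"
  shows "\<exists>\<pi> ow F. greedy_family Q \<pi> ow F"
  using assms
proof (induction Q rule: finite_induct)
  case empty
  show ?case by (simp add: greedy_family_def)
next
  case (insert q Q)
  obtain \<pi> ow F where G: "greedy_family Q \<pi> ow F"
    using insert.IH[OF insert.prems[OF insertI2]] by blast
  note F = greedy_familyD(1)[OF G] and \<pi> = greedy_familyD(2)[OF G] and ow = greedy_familyD(3)[OF G]
    and touch = greedy_familyD(4)[OF G]
  obtain xs where "walk E xs" "hd xs = fst q" "last xs = snd q"
    using insert.prems[of q] unfolding near_def by blast
  then have "\<exists>ys. shortest ys \<and> hd ys = fst q \<and> last ys = snd q" using ex_shortest by metis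
  \<comment> \<open>Among the shortest walks take one with the fewest new edges, as
    \<open>card_new_edges_touching_le\<close> requires.\<close>
  then obtain p where p: "shortest p" "hd p = fst q" "last p = snd q"
    and min: "\<And>t'. shortest t' \<Longrightarrow> hd t' = fst q \<Longrightarrow> last t' = snd q \<Longrightarrow>
      card (ledges p - F) \<le> card (ledges t' - F)"
    using ex_has_least_nat[of "\<lambda>ys. shortest ys \<and> hd ys = fst q \<and> last ys = snd q" _
      "\<lambda>ys. card (ledges ys - F)"] by blast
  define \<pi>' where "\<pi>' = \<pi>(q := p)"
  define ow' where "ow' e = (if e \<in> F then ow e else q)" for e
  define F' where "F' = F \<union> ledges p"
  have old: "\<pi>' s = \<pi> s" if "s \<in> Q" for s using that insert.hyps by (auto simp: \<pi>'_def)
  have newq: "\<pi>' q = p" by (simp add: \<pi>'_def)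
  have ow_old: "e \<in> F' \<and> ow' e = s \<and> P \<longleftrightarrow> e \<in> F \<and> ow e = s \<and> P" if "s \<in> Q" for e s P
    using that insert.hyps by (auto simp: ow'_def F'_def)
  have ow_new: "e \<in> F' \<and> ow' e = q \<and> P \<longleftrightarrow> e \<in> ledges p - F \<and> P" for e P
    using ow insert.hyps by (auto simp: ow'_def F'_def)
  have new: "card {(e, v). e \<in> F' \<and> ow' e = q \<and> v \<in> e \<and> v \<in> set (\<pi>' t)} \<le> 2" if "t \<in> Q" for t
  proof -
    have "card {(e, v). e \<in> ledges p - F \<and> v \<in> e \<and> v \<in> set (\<pi> t)} \<le> 2"
      using \<pi>[OF that] F that p min by (intro card_new_edges_touching_le) auto
    moreover have "{(e, v). e \<in> F' \<and> ow' e = q \<and> v \<in> e \<and> v \<in> set (\<pi>' t)} =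
        {(e, v). e \<in> ledges p - F \<and> v \<in> e \<and> v \<in> set (\<pi> t)}"
      by (simp only: ow_new old[OF that])
    ultimately show ?thesis by simp
  qed
  have "greedy_family (insert q Q) \<pi>' ow' F'"
    unfolding greedy_family_def
  proof (intro conjI ballI impI)
    show "F' = (\<Union>s\<in>insert q Q. ledges (\<pi>' s))" using old newq F by (auto simp: F'_def)
    fix s assume s: "s \<in> insert q Q"
    show "shortest (\<pi>' s)" "hd (\<pi>' s) = fst s" "last (\<pi>' s) = snd s"
      using s p \<pi>[of s] old[of s] newq by (cases "s = q"; simp)+
    fix t assume t: "t \<in> insert q Q" and "s \<noteq> t"
    then consider "s = q" "t \<in> Q" | "t = q" "s \<in> Q" | "s \<in> Q" "t \<in> Q" using s by blast
    then show "card {(e, v). e \<in> F' \<and> ow' e = s \<and> v \<in> e \<and> v \<in> set (\<pi>' t)} \<le> 2 \<or>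
      card {(e, v). e \<in> F' \<and> ow' e = t \<and> v \<in> e \<and> v \<in> set (\<pi>' s)} \<le> 2"
    proof cases
      case 3
      have "{(e, v). e \<in> F' \<and> ow' e = a \<and> v \<in> e \<and> v \<in> set (\<pi>' b)} =
        {(e, v). e \<in> F \<and> ow e = a \<and> v \<in> e \<and> v \<in> set (\<pi> b)}" if "a \<in> Q" "b \<in> Q" for a b
        by (simp only: ow_old[OF that(1)] old[OF that(2)])
      then show ?thesis using touch[OF 3 \<open>s \<noteq> t\<close>] 3 by simp
    qed (use new in auto)
  next
    fix e assume e: "e \<in> F'"
    show "ow' e \<in> insert q Q" "e \<in> ledges (\<pi>' (ow' e))"
      using e ow old newq by (auto simp: ow'_def F'_def)
  qed
  then show ?case by blast
qed

text \<open>\<open>card_owned_edges_le\<close> is applied with c = sqrt M, so the edges whose owners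
  are adjacent to s must lie on at most M vertices. A ball around the start of the longest walk
  among those of s and its neighbours contains them all; this is why a condition on local balls can
  replace the number of all vertices.\<close>

lemma exact_preserver:
  assumes Q: "finite Q" and M: "0 < M"
    and loc: "\<And>u v. (u, v) \<in> Q \<Longrightarrow>
      \<exists>r. near E u v r \<and> real (card {y\<in>V. near E u y (3 * r)}) \<le> M"
  obtains F where "F \<subseteq> E" "real (card F) \<le> 4 * real (card V) + 2 * sqrt M * real (card Q)"
    "\<And>u v r. (u, v) \<in> Q \<Longrightarrow> near E u v r \<Longrightarrow> near F u v r"
proof -
  have "\<exists>r. near E (fst q) (snd q) r" if "q \<in> Q" for q using loc[of "fst q" "snd q"] that by auto
  then obtain \<pi> ow F where G: "greedy_family Q \<pi> ow F" using ex_greedy_family[OF Q] by blast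
  note F = greedy_familyD(1)[OF G] and \<pi> = greedy_familyD(2)[OF G] and ow = greedy_familyD(3)[OF G]
    and touch = greedy_familyD(4)[OF G]
  have w: "walk E (\<pi> q)" if "q \<in> Q" for q using \<pi>[OF that] by (simp add: shortest_def)
  have FE: "F \<subseteq> E" unfolding F using w by (auto simp: walk_iff_ledges)
  have finF: "finite F" using FE finite_E finite_subset by blast
  have UF: "\<Union>F \<subseteq> V" using FE edge_subset by blast
  have finU: "finite (\<Union>F)" using UF finite_V finite_subset by blast
  have h1: "card {f\<in>F. ow f = s \<and> v \<in> f} \<le> 2" for v s
  proof (cases "s \<in> Q")
    case True
    have "card {f\<in>F. ow f = s \<and> v \<in> f} \<le> card {f\<in>ledges (\<pi> s). v \<in> f}"
      using ow by (intro card_mono) auto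
    also have "\<dots> \<le> 2" using \<pi>[OF True] shortest_distinct by (intro card_ledges_at_le) auto
    finally show ?thesis .
  next
    case False
    then have none: "{f\<in>F. ow f = s \<and> v \<in> f} = {}" using ow by auto
    show ?thesis unfolding none by simp
  qed
  let ?T = "\<lambda>s t. {(e, v, f). e \<in> F \<and> ow e = s \<and> f \<in> F \<and> ow f = t \<and> v \<in> e \<and> v \<in> f}"
  have finT: "finite (?T s t)" for s t
    by (rule finite_subset[of _ "F \<times> \<Union>F \<times> F"]) (use finF finU in auto)
  \<comment> \<open>Two incidences (e, v), and at each v at most two edges owned by t.\<close>
  have h2': "card (?T s t) \<le> 4"
    if "card {(e, v). e \<in> F \<and> ow e = s \<and> v \<in> e \<and> v \<in> set (\<pi> t)} \<le> 2" for s t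
  proof -
    let ?X = "{(e, v). e \<in> F \<and> ow e = s \<and> v \<in> e \<and> v \<in> set (\<pi> t)}"
    have finX: "finite ?X" by (rule finite_subset[of _ "F \<times> \<Union>F"]) (use finF finU in auto)
    have "card (?T s t) \<le> card ((\<lambda>((e, v), f). (e, v, f)) ` Sigma ?X (\<lambda>(e, v). {f\<in>F. ow f = t \<and> v \<in> f}))"
    proof (intro card_mono finite_imageI finite_SigmaI finX)
      show "?T s t \<subseteq> (\<lambda>((e, v), f). (e, v, f)) ` Sigma ?X (\<lambda>(e, v). {f\<in>F. ow f = t \<and> v \<in> f})"
      proof clarify
        fix e v f assume a: "e \<in> F" "f \<in> F" "v \<in> e" "v \<in> f" "s = ow e" "t = ow f"
        then have "v \<in> set (\<pi> (ow f))" using ow[of f] ledges_subset by blast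
        then show "(e, v, f) \<in> (\<lambda>((e, v), f). (e, v, f)) `
          (SIGMA (e', v):{(e', v). e' \<in> F \<and> ow e' = ow e \<and> v \<in> e' \<and> v \<in> set (\<pi> (ow f))}.
            {f'\<in>F. ow f' = ow f \<and> v \<in> f'})"
          using a by (intro image_eqI[of _ _ "((e, v), f)"]) auto
      qed
    qed (use finF in auto)
    also have "\<dots> \<le> card (Sigma ?X (\<lambda>(e, v). {f\<in>F. ow f = t \<and> v \<in> f}))"
      by (intro card_image_le finite_SigmaI finX) (use finF in auto)
    also have "\<dots> = (\<Sum>(e, v)\<in>?X. card {f\<in>F. ow f = t \<and> v \<in> f})"
      using finX finF by (subst card_SigmaI) (auto simp: case_prod_unfold)
    also have "\<dots> \<le> (\<Sum>(e, v)\<in>?X. 2)" using h1 by (intro sum_mono) (auto simp: case_prod_unfold)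
    also have "\<dots> \<le> 4" using that by (simp add: case_prod_unfold)
    finally show ?thesis .
  qed
  have h2: "card (?T s t) \<le> 4" if "s \<noteq> t" for s t
  proof (cases "s \<in> Q \<and> t \<in> Q")
    case True
    then consider "card {(e, v). e \<in> F \<and> ow e = s \<and> v \<in> e \<and> v \<in> set (\<pi> t)} \<le> 2"
      | "card {(e, v). e \<in> F \<and> ow e = t \<and> v \<in> e \<and> v \<in> set (\<pi> s)} \<le> 2"
      using touch \<open>s \<noteq> t\<close> by blast
    then show ?thesis
    proof cases
      case 2
      have "card (?T s t) \<le> card ((\<lambda>(e, v, f). (f, v, e)) ` ?T t s)"
        by (intro card_mono finite_imageI finT) force
      also have "\<dots> \<le> card (?T t s)" by (intro card_image_le finT)
      finally show ?thesis using h2'[OF 2] by linarith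
    qed (rule h2')
  next
    case False
    then have none: "?T s t = {}" using ow by auto
    show ?thesis unfolding none by simp
  qed
  have h3: "real (card (\<Union>{f\<in>F. ow f \<in> adjacent_owners F ow s})) \<le> (sqrt M)\<^sup>2" for s
  proof (cases "adjacent_owners F ow s = {}")
    case True
    then show ?thesis using M by simp
  next
    case False
    let ?nb = "adjacent_owners F ow s"
    have sQ: "s \<in> Q" and nbQ: "?nb \<subseteq> Q" using False ow unfolding adjacent_owners_def by blast+
    have common: "\<exists>z. z \<in> set (\<pi> s) \<and> z \<in> set (\<pi> t)" if t: "t \<in> insert s ?nb" for t
    proof (cases "t = s")
      case True
      have "\<pi> s \<noteq> []" using w[OF sQ] by (simp add: walk_def)
      then show ?thesis using True by (intro exI[of _ "hd (\<pi> s)"]) simp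
    next
      case False
      then obtain e f z where "e \<in> F" "f \<in> F" "ow e = s" "ow f = t" "z \<in> e" "z \<in> f"
        using t unfolding adjacent_owners_def by blast
      then show ?thesis using ow ledges_subset by (metis subsetD)
    qed
    have fin: "finite (insert s ?nb)" using nbQ Q finite_subset by blast
    have "\<exists>t\<in>insert s ?nb. \<forall>t'\<in>insert s ?nb. wlen (\<pi> t') \<le> wlen (\<pi> t)"
    proof -
      have "Max ((\<lambda>t. wlen (\<pi> t)) ` insert s ?nb) \<in> (\<lambda>t. wlen (\<pi> t)) ` insert s ?nb"
        using fin by (intro Max_in) auto
      then obtain t where "t \<in> insert s ?nb" "wlen (\<pi> t) = Max ((\<lambda>t. wlen (\<pi> t)) ` insert s ?nb)"
        by (metis (no_types, lifting) imageE)
      then show ?thesis using fin by (intro bexI[of _ t]) auto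
    qed
    then obtain t0 where t0: "t0 \<in> insert s ?nb"
      and t0max: "\<And>t. t \<in> insert s ?nb \<Longrightarrow> wlen (\<pi> t) \<le> wlen (\<pi> t0)" by blast
    have t0Q: "t0 \<in> Q" using t0 sQ nbQ by auto
    obtain u v where uv: "t0 = (u, v)" by (cases t0)
    obtain r where r: "near E u v r" "real (card {y\<in>V. near E u y (3 * r)}) \<le> M"
      using loc[of u v] t0Q uv by auto
    have Lr: "wlen (\<pi> t0) \<le> r"
      using r(1) \<pi>[OF t0Q] uv unfolding near_def shortest_def by fastforce
    have u0: "u \<in> set (\<pi> t0)"
      using \<pi>[OF t0Q] uv w[OF t0Q] hd_in_set[of "\<pi> t0"] by (auto simp: walk_def simp del: hd_in_set)
    \<comment> \<open>From u, any vertex y on the walk of a neighbour is reached along the walk of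
      t0, then along that of s, then along the neighbour's own. Each leg is at most r, because the
      walk of t0 is the longest; this is the origin of the radius 3r.\<close>
    have "\<Union>{f\<in>F. ow f \<in> ?nb} \<subseteq> {y\<in>V. near E u y (3 * r)}"
    proof clarify
      fix f y assume f: "f \<in> F" "ow f \<in> ?nb" "y \<in> f"
      define t where "t = ow f"
      have t: "t \<in> insert s ?nb" "t \<in> Q" using f nbQ by (auto simp: t_def)
      have yt: "y \<in> set (\<pi> t)" using ow[OF f(1)] f(3) ledges_subset by (auto simp: t_def)
      obtain z z' where z: "z \<in> set (\<pi> s)" "z \<in> set (\<pi> t0)" "z' \<in> set (\<pi> s)" "z' \<in> set (\<pi> t)"
        using common[OF t0] common[OF t(1)] by blast
      have "near E u z (wlen (\<pi> t0))" by (rule near_on_walk[OF w[OF t0Q] u0 z(2)])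
      moreover have "near E z z' (wlen (\<pi> s))" by (rule near_on_walk[OF w[OF sQ] z(1,3)])
      moreover have "near E z' y (wlen (\<pi> t))" by (rule near_on_walk[OF w[OF t(2)] z(4) yt])
      ultimately have "near E u y (wlen (\<pi> t0) + wlen (\<pi> s) + wlen (\<pi> t))"
        using near_trans by blast
      moreover have "wlen (\<pi> t0) + wlen (\<pi> s) + wlen (\<pi> t) \<le> 3 * r"
        using t0max[of s] t0max[OF t(1)] Lr by simp
      ultimately have "near E u y (3 * r)" by (rule near_mono[OF _ order_refl])
      then show "y \<in> V \<and> near E u y (3 * r)" using f UF by blast
    qed
    then have "card (\<Union>{f\<in>F. ow f \<in> ?nb}) \<le> card {y\<in>V. near E u y (3 * r)}"
      using finite_V by (intro card_mono) auto
    then show ?thesis using r(2) M by simp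
  qed
  have "real (card F) \<le> 4 * real (card (\<Union>F)) + 2 * sqrt M * real (card (ow ` F))"
    by (rule card_owned_edges_le[OF finF _ h1 h2 h3]) (use FE card_edge M in auto)
  also have "\<dots> \<le> 4 * real (card V) + 2 * sqrt M * real (card Q)"
  proof (intro add_mono mult_left_mono)
    show "real (card (\<Union>F)) \<le> real (card V)" using card_mono[OF finite_V UF] by simp
    have "ow ` F \<subseteq> Q" using ow by auto
    then show "real (card (ow ` F)) \<le> real (card Q)" using card_mono[OF Q] by simp
  qed (use M in auto)
  finally have cF: "real (card F) \<le> 4 * real (card V) + 2 * sqrt M * real (card Q)" .
  have "near F u v r" if "(u, v) \<in> Q" "near E u v r" for u v r
  proof (rule nearI[of F "\<pi> (u, v)"])
    show "walk F (\<pi> (u, v))" using w[OF that(1)] that(1) F by (auto simp: walk_iff_ledges)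
    show "wlen (\<pi> (u, v)) \<le> r"
      using that(2) \<pi>[OF that(1)] unfolding near_def shortest_def by fastforce
  qed (use \<pi>[OF that(1)] in auto)
  then show ?thesis using that[OF FE cF] by blast
qed

end

section \<open>Ball packings and approximate preservers\<close>

lemma card_disjoint_balls_le:
  assumes "finite B" "finite X" "\<And>a. a \<in> B \<Longrightarrow> S a \<subseteq> X \<and> m \<le> card (S a)"
    "\<And>a b. a \<in> B \<Longrightarrow> b \<in> B \<Longrightarrow> a \<noteq> b \<Longrightarrow> S a \<inter> S b = {}"
  shows "card B * m \<le> card X"
proof -
  have "card B * m = (\<Sum>a\<in>B. m)" by simp
  also have "\<dots> \<le> (\<Sum>a\<in>B. card (S a))" using assms(3) by (intro sum_mono) auto
  also have "\<dots> = card (\<Union>a\<in>B. S a)"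
    using assms finite_subset by (intro card_UN_disjoint[symmetric]) blast+
  also have "\<dots> \<le> card X" using assms(2,3) by (intro card_mono) blast+
  finally show ?thesis .
qed

context wgraph begin

definition nball :: "'a \<Rightarrow> real \<Rightarrow> 'a set" where
  "nball x r = {y\<in>V. near E x y r}"

lemma finite_nball [simp]: "finite (nball x r)"
  using finite_V by (simp add: nball_def)

lemma nball_subset: "near E a u s \<Longrightarrow> s + r \<le> t \<Longrightarrow> nball u r \<subseteq> nball a t"
  unfolding nball_def using near_trans near_mono[OF _ order_refl] by blast

lemma nball_mono: "r \<le> t \<Longrightarrow> nball u r \<subseteq> nball u t"
  unfolding nball_def using near_mono[OF _ order_refl] by blast

lemma card_nball_mono: "nball u r \<subseteq> nball a t \<Longrightarrow> card (nball u r) \<le> card (nball a t)"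
  by (rule card_mono) auto

lemma near_first_step:
  assumes "near E x y r" "x \<noteq> y"
  obtains u where "{x, u} \<in> E" "near E u y (r - wt {x, u})"
proof -
  obtain xs where xs: "walk E xs" "hd xs = x" "last xs = y" "wlen xs \<le> r"
    using assms(1) unfolding near_def by blast
  then obtain u zs where "xs = x # u # zs"
    using assms(2) by (cases xs rule: remdups_adj.cases) (auto simp: walk_def)
  then show ?thesis
    using that[of u] xs nearI[of E "u # zs" u y "r - wt {x, u}"] by (auto simp: walk_def)
qed

lemma near_in_V: "near E x y r \<Longrightarrow> y \<in> V \<Longrightarrow> x \<in> V"
  using near_first_step[of x y r] edge_subset by (metis insert_subset)

text \<open>The size of a ball around v changes only at the finitely many distances from v to other
  vertices. For m = 0 every real radius would qualify and there would be no least one.\<close>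

lemma ex_min_radius:
  assumes "1 \<le> m" "m \<le> card (nball v r)"
  shows "\<exists>R. m \<le> card (nball v R) \<and> (\<forall>s. m \<le> card (nball v s) \<longrightarrow> R \<le> s)"
proof -
  define d where "d y = (SOME d. near E v y d \<and> (\<forall>s. near E v y s \<longrightarrow> d \<le> s))" for y
  have d: "near E v y (d y) \<and> (\<forall>s. near E v y s \<longrightarrow> d y \<le> s)" if "near E v y s" for y s
  proof -
    have "\<exists>d. near E v y d \<and> (\<forall>s. near E v y s \<longrightarrow> d \<le> s)" using ex_min_near[OF that] by metis
    then show ?thesis unfolding d_def by (rule someI_ex)
  qed
  define X where "X = {t \<in> d ` V. m \<le> card (nball v t)}"
  have finX: "finite X" using finite_V by (simp add: X_def)
  have below: "\<exists>t\<in>X. t \<le> s" if "m \<le> card (nball v s)" for s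
  proof -
    have ne: "nball v s \<noteq> {}" using that assms(1) by auto
    let ?t = "Max (d ` nball v s)"
    have t: "?t \<in> d ` nball v s" using ne by (intro Max_in) auto
    have "nball v s \<subseteq> nball v ?t"
    proof
      fix y assume y: "y \<in> nball v s"
      then have "near E v y (d y)" using d[of y s] by (simp add: nball_def)
      moreover have "d y \<le> ?t" using y by (intro Max_ge) auto
      ultimately show "y \<in> nball v ?t" using y near_mono[OF _ order_refl] by (auto simp: nball_def)
    qed
    then have "m \<le> card (nball v ?t)" using that card_nball_mono le_trans by blast
    moreover have "?t \<le> s" using t d by (auto simp: nball_def)
    moreover have "?t \<in> d ` V" using t by (auto simp: nball_def)
    ultimately show ?thesis by (auto simp: X_def)
  qed
  then have ne: "X \<noteq> {}" using assms(2) by blast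
  have "Min X \<in> X" using finX ne by (rule Min_in)
  moreover have "Min X \<le> s" if "m \<le> card (nball v s)" for s
    using below[OF that] Min_le[OF finX] order_trans by blast
  ultimately show ?thesis by (intro exI[of _ "Min X"]) (auto simp: X_def)
qed

text \<open>Let R v be the least radius at which the ball around v has m vertices. Vertices are
  taken in order of increasing R and kept if their ball avoids those kept before. The ball of a
  rejected v meets a kept ball of no larger radius, so a centre lies within 2 R v.\<close>

lemma ball_packing:
  assumes m: "1 \<le> m"
  obtains A R where "A \<subseteq> V" "\<And>a. a \<in> A \<Longrightarrow> m \<le> card (nball a (R a))"
    "\<And>a r. a \<in> A \<Longrightarrow> m \<le> card (nball a r) \<Longrightarrow> R a \<le> r"
    "\<And>a b. a \<in> A \<Longrightarrow> b \<in> A \<Longrightarrow> a \<noteq> b \<Longrightarrow> nball a (R a) \<inter> nball b (R b) = {}"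
    "\<And>v r. v \<in> V \<Longrightarrow> m \<le> card (nball v r) \<Longrightarrow> \<exists>a\<in>A. near E v a (2 * r)"
proof -
  define R where "R v = (SOME R. m \<le> card (nball v R) \<and> (\<forall>s. m \<le> card (nball v s) \<longrightarrow> R \<le> s))" for v
  have R: "m \<le> card (nball v (R v)) \<and> (\<forall>s. m \<le> card (nball v s) \<longrightarrow> R v \<le> s)"
    if "m \<le> card (nball v s)" for v s
    using someI_ex[OF ex_min_radius[OF m that]] unfolding R_def .
  define W where "W = {v\<in>V. \<exists>r. m \<le> card (nball v r)}"
  have finW: "finite W" using finite_V by (simp add: W_def)
  have RW: "m \<le> card (nball v (R v))" if "v \<in> W" for v using that R by (auto simp: W_def)
  have Rpos: "0 \<le> R v" if "v \<in> W" for v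
  proof -
    have "nball v (R v) \<noteq> {}" using RW[OF that] m by auto
    then show ?thesis unfolding nball_def using near_nonneg by blast
  qed
  have "S \<subseteq> W \<Longrightarrow> \<exists>A\<subseteq>S. (\<forall>a\<in>A. \<forall>b\<in>A. a \<noteq> b \<longrightarrow> nball a (R a) \<inter> nball b (R b) = {}) \<and>
      (\<forall>v\<in>S. \<exists>a\<in>A. near E v a (2 * R v))" if "finite S" for S
    using that
  proof (induction S rule: finite_ranking_induct[where f=R])
    case (insert x S)
    then obtain A where A: "A \<subseteq> S" "\<forall>a\<in>A. \<forall>b\<in>A. a \<noteq> b \<longrightarrow> nball a (R a) \<inter> nball b (R b) = {}"
      "\<forall>v\<in>S. \<exists>a\<in>A. near E v a (2 * R v)" by blast
    have x: "x \<in> W" using insert.prems by simp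
    show ?case
    proof (cases "\<exists>a\<in>A. nball a (R a) \<inter> nball x (R x) \<noteq> {}")
      case True
      then obtain a z where a: "a \<in> A" "near E a z (R a)" "near E x z (R x)"
        by (auto simp: nball_def)
      have "near E x a (R x + R a)" using near_trans[OF a(3) near_sym[OF a(2)]] .
      moreover have "R a \<le> R x" using insert.hyps a(1) A(1) by blast
      ultimately have "near E x a (2 * R x)" using near_mono[OF _ order_refl] by auto
      then show ?thesis using A a(1) by (intro exI[of _ A]) auto
    next
      case False
      have "near E x x (2 * R x)" using Rpos[OF x] by (intro near_refl) simp
      then show ?thesis using A False by (intro exI[of _ "insert x A"]) (auto simp: Int_commute)
    qed
  qed auto
  from this[OF finW order_refl] obtain A where A: "A \<subseteq> W"
    "\<forall>a\<in>A. \<forall>b\<in>A. a \<noteq> b \<longrightarrow> nball a (R a) \<inter> nball b (R b) = {}"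
    "\<forall>v\<in>W. \<exists>a\<in>A. near E v a (2 * R v)"
    by (elim exE conjE) (rule that)
  show ?thesis
  proof (rule that[of A R])
    show "A \<subseteq> V" using A(1) by (auto simp: W_def)
    show "m \<le> card (nball a (R a))" if "a \<in> A" for a using RW A(1) that by blast
    show "R a \<le> r" if "a \<in> A" "m \<le> card (nball a r)" for a r using R[OF that(2)] that by blast
    show "\<exists>a\<in>A. near E v a (2 * r)" if v: "v \<in> V" "m \<le> card (nball v r)" for v r
    proof -
      have "v \<in> W" using v by (auto simp: W_def)
      then obtain a where a: "a \<in> A" "near E v a (2 * R v)" using A(3) by blast
      have "R v \<le> r" using R[OF v(2)] v by blast
      then have "near E v a (2 * r)" using near_mono[OF a(2) order_refl] by simp
      then show ?thesis using a(1) by blast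
    qed
    show "nball a (R a) \<inter> nball b (R b) = {}" if "a \<in> A" "b \<in> A" "a \<noteq> b" for a b
      using A(2) that by simp
  qed
qed

text \<open>Each vertex outside A that can reach A keeps the first edge of a shortest walk to A.
  This preserves distances to the set A with at most one edge per vertex; the centre that is reached
  may differ from the given one.\<close>

lemma shortest_path_forest:
  assumes A: "A \<subseteq> V"
  obtains F where "F \<subseteq> E" "card F \<le> card V"
    "\<And>v a r. v \<in> V \<Longrightarrow> a \<in> A \<Longrightarrow> near E v a r \<Longrightarrow> \<exists>a\<in>A. near F v a r"
proof -
  define P where "P v d \<longleftrightarrow> (\<exists>a\<in>A. near E v a d)" for v d
  have finA: "finite A" using A finite_V finite_subset by blast
  have exmin: "\<exists>d. P v d \<and> (\<forall>s. P v s \<longrightarrow> d \<le> s)" if "P v r" for v r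
  proof -
    define d where "d a = (SOME d. near E v a d \<and> (\<forall>s. near E v a s \<longrightarrow> d \<le> s))" for a
    have d: "near E v a (d a) \<and> (\<forall>s. near E v a s \<longrightarrow> d a \<le> s)" if "near E v a s" for a s
    proof -
      have "\<exists>d. near E v a d \<and> (\<forall>s. near E v a s \<longrightarrow> d \<le> s)" using ex_min_near[OF that] by metis
      then show ?thesis unfolding d_def by (rule someI_ex)
    qed
    let ?X = "d ` {a\<in>A. \<exists>s. near E v a s}"
    have X: "finite ?X" "?X \<noteq> {}" using finA \<open>P v r\<close> by (auto simp: P_def)
    have "Min ?X \<in> ?X" using X by (rule Min_in)
    then obtain a s where a: "Min ?X = d a" "a \<in> A" "near E v a s" by blast
    then have "P v (Min ?X)" using d[OF a(3)] unfolding P_def by auto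
    moreover have "Min ?X \<le> s" if s: "P v s" for s
    proof -
      obtain a where a: "a \<in> A" "near E v a s" using s by (auto simp: P_def)
      then have "Min ?X \<le> d a" using X(1) by (intro Min_le) auto
      then show ?thesis using d[OF a(2)] a(2) by fastforce
    qed
    ultimately show ?thesis by blast
  qed
  define \<rho> where "\<rho> v = (SOME d. P v d \<and> (\<forall>s. P v s \<longrightarrow> d \<le> s))" for v
  have \<rho>: "P v (\<rho> v)" "\<And>s. P v s \<Longrightarrow> \<rho> v \<le> s" if "P v r" for v r
    using someI_ex[OF exmin[OF that]] unfolding \<rho>_def by auto
  define W where "W = {v\<in>V. v \<notin> A \<and> (\<exists>r. P v r)}"
  have "\<exists>u. {v, u} \<in> E \<and> P u (\<rho> v - wt {v, u})" if "v \<in> W" for v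
  proof -
    obtain a where a: "a \<in> A" "near E v a (\<rho> v)" using \<rho>(1) \<open>v \<in> W\<close> by (auto simp: W_def P_def)
    then have "v \<noteq> a" using \<open>v \<in> W\<close> by (auto simp: W_def)
    with a show ?thesis using near_first_step[OF a(2)] unfolding P_def by metis
  qed
  then obtain par where par: "\<And>v. v \<in> W \<Longrightarrow> {v, par v} \<in> E \<and> P (par v) (\<rho> v - wt {v, par v})"
    by metis
  define F where "F = (\<lambda>v. {v, par v}) ` W"
  \<comment> \<open>Induction on the number of vertices closer to A, since \<rho> drops strictly
    along \<open>par\<close>.\<close>
  have reach: "\<exists>a\<in>A. near F v a (\<rho> v)" if "v \<in> V" "P v r" for v r
    using that
  proof (induction "card {u\<in>V. (\<exists>r. P u r) \<and> \<rho> u < \<rho> v}" arbitrary: v r rule: less_induct)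
    case less
    show ?case
    proof (cases "v \<in> A")
      case True
      have "0 \<le> \<rho> v" using \<rho>(1)[OF less.prems(2)] near_nonneg by (auto simp: P_def)
      then show ?thesis using True near_refl by blast
    next
      case False
      then have v: "v \<in> W" using less.prems by (auto simp: W_def)
      let ?u = "par v"
      have u: "{v, ?u} \<in> E" "P ?u (\<rho> v - wt {v, ?u})" using par[OF v] by auto
      have uV: "?u \<in> V" using edge_subset[OF u(1)] by simp
      have le: "\<rho> ?u \<le> \<rho> v - wt {v, ?u}" using \<rho>(2)[OF u(2)] u(2) by blast
      then have lt: "\<rho> ?u < \<rho> v" using wt_pos[OF u(1)] by simp
      have "{w\<in>V. (\<exists>r. P w r) \<and> \<rho> w < \<rho> ?u} \<subset> {w\<in>V. (\<exists>r. P w r) \<and> \<rho> w < \<rho> v}"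
      proof (rule psubsetI)
        show "{w\<in>V. (\<exists>r. P w r) \<and> \<rho> w < \<rho> ?u} \<subseteq> {w\<in>V. (\<exists>r. P w r) \<and> \<rho> w < \<rho> v}"
          using lt by auto
        have "?u \<in> {w\<in>V. (\<exists>r. P w r) \<and> \<rho> w < \<rho> v}" using uV u(2) lt by blast
        then show "{w\<in>V. (\<exists>r. P w r) \<and> \<rho> w < \<rho> ?u} \<noteq> {w\<in>V. (\<exists>r. P w r) \<and> \<rho> w < \<rho> v}"
          by blast
      qed
      then have "card {w\<in>V. (\<exists>r. P w r) \<and> \<rho> w < \<rho> ?u} < card {w\<in>V. (\<exists>r. P w r) \<and> \<rho> w < \<rho> v}"
        using finite_V by (intro psubset_card_mono) auto
      from less.hyps[OF this uV u(2)] obtain a where a: "a \<in> A" "near F ?u a (\<rho> ?u)" by blast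
      have "near F v ?u (wt {v, ?u})" using v by (intro near_edge) (auto simp: F_def)
      then have "near F v a (wt {v, ?u} + \<rho> ?u)" using a(2) by (rule near_trans)
      moreover have "wt {v, ?u} + \<rho> ?u \<le> \<rho> v" using le by simp
      ultimately have "near F v a (\<rho> v)" by (rule near_mono[OF _ order_refl])
      then show ?thesis using a(1) by blast
    qed
  qed
  show ?thesis
  proof (rule that[of F])
    show "F \<subseteq> E" using par by (auto simp: F_def)
    have "card F \<le> card W" unfolding F_def using finite_V by (intro card_image_le) (simp add: W_def)
    also have "\<dots> \<le> card V" using finite_V by (intro card_mono) (auto simp: W_def)
    finally show "card F \<le> card V" .
    fix v a r assume v: "v \<in> V" "a \<in> A" "near E v a r"
    then have P: "P v r" by (auto simp: P_def)
    obtain a' where "a' \<in> A" "near F v a' (\<rho> v)" using reach[OF v(1) P] by blast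
    then show "\<exists>a\<in>A. near F v a r" using near_mono[OF _ order_refl \<rho>(2)[OF P P]] by blast
  qed
qed

section \<open>Cutting walks into short pieces\<close>

text \<open>Either the whole walk fits into \<delta>, or z is the last vertex before the edge {z,
  z'} that crosses \<delta>. A single edge may itself be longer than \<delta>, so it is kept apart
  from the piece; counted together with it, every cut uses up more than \<delta>.\<close>

lemma walk_prefix:
  assumes "walk E xs" "0 \<le> \<delta>"
  shows "\<exists>z l. near E (hd xs) z l \<and> l \<le> \<delta> \<and> ((z = last xs \<and> l \<le> wlen xs) \<or>
    (\<exists>z' l'. {z, z'} \<in> E \<and> near E z' (last xs) l' \<and> l + wt {z, z'} + l' \<le> wlen xs \<and>
      \<delta> < l + wt {z, z'}))"
  using assms
proof (induction xs arbitrary: \<delta> rule: wlen.induct)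
  case (1 x y zs)
  have e: "{x, y} \<in> E" and w: "walk E (y # zs)" using 1(2) by (auto simp: walk_def)
  show ?case
  proof (cases "wt {x, y} \<le> \<delta>")
    case False
    have "near E y (last (y # zs)) (wlen (y # zs))" by (rule nearI[OF w]) auto
    moreover have "near E x x 0" by (rule near_refl) simp
    ultimately show ?thesis
      using False e 1(3) by (intro exI[of _ x] exI[of _ 0] conjI disjI2 exI[of _ y]
          exI[of _ "wlen (y # zs)"]) auto
  next
    case True
    then obtain z l where zl: "near E y z l" "l \<le> \<delta> - wt {x, y}"
      "(z = last (y # zs) \<and> l \<le> wlen (y # zs)) \<or>
       (\<exists>z' l'. {z, z'} \<in> E \<and> near E z' (last (y # zs)) l' \<and> l + wt {z, z'} + l' \<le> wlen (y # zs) \<and>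
         \<delta> - wt {x, y} < l + wt {z, z'})"
      using 1(1)[OF w, of "\<delta> - wt {x, y}"] by auto
    have "near E x z (wt {x, y} + l)" using near_trans[OF near_edge[OF e order_refl] zl(1)] .
    moreover have "last (x # y # zs) = last (y # zs)" by simp
    moreover have "wlen (x # y # zs) = wt {x, y} + wlen (y # zs)" by simp
    ultimately show ?thesis
      using zl(2,3) by (intro exI[of _ z] exI[of _ "wt {x, y} + l"]) (auto simp: algebra_simps)
  qed
next
  case ("2_2" v)
  then show ?case by (intro exI[of _ v] exI[of _ 0]) (auto intro: near_refl)
qed (simp add: walk_def)

definition stretch_on :: "'a set set \<Rightarrow> ('a \<times> 'a) set \<Rightarrow> real \<Rightarrow> bool" where
  "stretch_on H Q t \<longleftrightarrow> (\<forall>(u, v)\<in>Q. \<forall>r. near E u v r \<longrightarrow> near H u v (t * r))"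

lemma stretch_onD: "stretch_on H Q t \<Longrightarrow> (u, v) \<in> Q \<Longrightarrow> near E u v r \<Longrightarrow> near H u v (t * r)"
  unfolding stretch_on_def by blast

lemma stretch_on_subset: "stretch_on H Q t \<Longrightarrow> Q' \<subseteq> Q \<Longrightarrow> stretch_on H Q' t"
  unfolding stretch_on_def by blast

lemma stretch_on_mono: "stretch_on H Q t \<Longrightarrow> H \<subseteq> H' \<Longrightarrow> stretch_on H' Q t"
  unfolding stretch_on_def using near_mono[OF _ _ order_refl] by blast

text \<open>Cuts a walk into at most N pieces of length at most \<open>\<delta>\<close>, joined by single edges, up to the
  first piece that starts at a vertex with a large ball.\<close>

definition scanned ::
    "nat \<Rightarrow> real \<Rightarrow> 'a \<Rightarrow> 'a \<Rightarrow> real \<Rightarrow> nat \<Rightarrow> ('a \<times> 'a) set \<Rightarrow> 'a set set \<Rightarrow> 'a \<Rightarrow> real \<Rightarrow> real \<Rightarrow> bool"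
  where "scanned m \<delta> u v L N Q B x l1 l2 \<longleftrightarrow> finite Q \<and> Q \<subseteq> V \<times> V \<and> card Q \<le> N \<and>
    B \<subseteq> E \<and> card B \<le> N \<and> (\<forall>(y, z)\<in>Q. near E y z \<delta> \<and> card (nball y (8 * \<delta>)) < m) \<and>
    l1 + l2 \<le> L \<and> near E x v l2 \<and> (x = v \<or> m \<le> card (nball x (8 * \<delta>))) \<and>
    (\<forall>H t. 1 \<le> t \<longrightarrow> B \<subseteq> H \<longrightarrow> stretch_on H Q t \<longrightarrow> near H u x (t * l1))"

text \<open>Each round that continues spends more than \<delta> of the length, so N rounds suffice.
  The crossing edges are collected in B and bought outright; only the pieces in Q suffer the stretch
  t.\<close>

lemma scan_walk:
  assumes "near E u v L" "L \<le> real N * \<delta>" "u \<in> V" "0 < \<delta>"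
  shows "\<exists>Q B x l1 l2. scanned m \<delta> u v L N Q B x l1 l2"
  using assms(1-3)
proof (induction N arbitrary: u L)
  case 0
  have "u = v"
  proof (rule ccontr)
    assume "u \<noteq> v"
    then obtain y where y: "{u, y} \<in> E" "near E y v (L - wt {u, y})" using 0(1) near_first_step by blast
    then show False using near_nonneg[OF y(2)] wt_pos[OF y(1)] 0(2) by simp
  qed
  then show ?case
    using 0 near_nonneg[OF 0(1)]
    by (intro exI[of _ "{}"] exI[of _ u] exI[of _ 0] exI[of _ L]) (auto simp: scanned_def intro: near_refl)
next
  case (Suc N)
  have Lpos: "0 \<le> L" using near_nonneg[OF Suc.prems(1)] .
  show ?case
  proof (cases "m \<le> card (nball u (8 * \<delta>))")
    case True
    then show ?thesis
      using Suc.prems(1) by (intro exI[of _ "{}"] exI[of _ u] exI[of _ 0] exI[of _ L]) (auto simp: scanned_def intro: near_refl)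
  next
    case light: False
    obtain xs where xs: "walk E xs" "hd xs = u" "last xs = v" "wlen xs \<le> L"
      using Suc.prems(1) unfolding near_def by blast
    obtain z l where z: "near E u z l" "l \<le> \<delta>"
      and zz: "(z = v \<and> l \<le> L) \<or>
        (\<exists>z' l'. {z, z'} \<in> E \<and> near E z' v l' \<and> l + wt {z, z'} + l' \<le> L \<and> \<delta> < l + wt {z, z'})"
      using walk_prefix[OF xs(1), of \<delta>] assms(4) xs(2-4) by fastforce
    have zV: "z \<in> V" using near_in_V[OF near_sym[OF z(1)] Suc.prems(3)] .
    have nz: "near E u z \<delta>" using near_mono[OF z(1) order_refl z(2)] .
    from zz show ?thesis
    proof
      assume zv: "z = v \<and> l \<le> L"
      have "near H u v (t * l)" if "stretch_on H {(u, v)} t" for H t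
        using stretch_onD[OF that] z(1) zv by blast
      then show ?thesis
        using zv zV nz light Suc.prems(3)
        by (intro exI[of _ "{(u, v)}"] exI[of _ "{}"] exI[of _ v] exI[of _ l] exI[of _ 0])
           (auto simp: scanned_def intro: near_refl)
    next
      assume "\<exists>z' l'. {z, z'} \<in> E \<and> near E z' v l' \<and> l + wt {z, z'} + l' \<le> L \<and> \<delta> < l + wt {z, z'}"
      then obtain z' l' where z': "{z, z'} \<in> E" "near E z' v l'" "l + wt {z, z'} + l' \<le> L"
        "\<delta> < l + wt {z, z'}" by blast
      have "l' \<le> real N * \<delta>" using z'(3,4) Suc.prems(2) by (simp add: algebra_simps)
      moreover have "z' \<in> V" using edge_subset[OF z'(1)] by simp
      ultimately obtain Q B x l1 l2 where sc: "scanned m \<delta> z' v l' N Q B x l1 l2"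
        using Suc.IH[OF z'(2)] by blast
      then have IH: "finite Q" "card Q \<le> N" "B \<subseteq> E"
        "card B \<le> N" "\<forall>(y, z)\<in>Q. near E y z \<delta> \<and> card (nball y (8 * \<delta>)) < m" "l1 + l2 \<le> l'"
        "near E x v l2" "x = v \<or> m \<le> card (nball x (8 * \<delta>))"
        "\<And>H t. 1 \<le> t \<Longrightarrow> B \<subseteq> H \<Longrightarrow> stretch_on H Q t \<Longrightarrow> near H z' x (t * l1)" "Q \<subseteq> V \<times> V"
        unfolding scanned_def by blast+
      have finB: "finite B" using IH(3) finite_E finite_subset by blast
      have "near H u x (t * (l + wt {z, z'} + l1))"
        if H: "1 \<le> t" "insert {z, z'} B \<subseteq> H" "stretch_on H (insert (u, z) Q) t" for H t
      proof -
        have 1: "near H u z (t * l)" using stretch_onD[OF H(3) _ z(1)] by simp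
        have "1 * wt {z, z'} \<le> t * wt {z, z'}"
          using H(1) wt_pos[OF z'(1)] by (intro mult_right_mono) auto
        then have 2: "near H z z' (t * wt {z, z'})" using H(2) by (intro near_edge) auto
        have 3: "near H z' x (t * l1)"
          using IH(9)[OF H(1)] H(2) stretch_on_subset[OF H(3)] by blast
        show ?thesis using near_trans[OF near_trans[OF 1 2] 3] by (simp add: algebra_simps)
      qed
      moreover have "card (insert (u, z) Q) \<le> Suc N" "card (insert {z, z'} B) \<le> Suc N"
        using IH(1,2,4) finB by (auto simp: card_insert_if)
      ultimately show ?thesis
        using IH(1,3,5,6,7,8,10) z' nz light zV Suc.prems(3)
        by (intro exI[of _ "insert (u, z) Q"] exI[of _ "insert {z, z'} B"] exI[of _ x]
            exI[of _ "l + wt {z, z'} + l1"] exI[of _ l2]) (auto simp: scanned_def)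
    qed
  qed
qed

section \<open>Pairs of centres and the refinement step\<close>

text \<open>These are the possible detours between centres, with r in the role of the distance of
  the pair being served. The radius 6r is three times the bound 2r on the distance, as
  \<open>exact_preserver\<close> demands; R b \<le> r keeps the packed ball of b inside the ball
  around a, so that the partners b can be counted.\<close>

definition bunch_pairs :: "nat \<Rightarrow> 'a set \<Rightarrow> ('a \<Rightarrow> real) \<Rightarrow> ('a \<times> 'a) set" where
  "bunch_pairs m A R =
     {(a, b). a \<in> A \<and> b \<in> A \<and> (\<exists>r. near E a b (2 * r) \<and> R b \<le> r \<and> card (nball a (6 * r)) < m)}"

text \<open>For fixed a, the packed balls of its partners are disjoint and lie in one ball of fewer
  than m vertices, the one for the largest r. So a has at most m / m' partners; likewise there are
  at most |V| / m' centres.\<close>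

lemma card_bunch_pairs_le:
  assumes A: "A \<subseteq> V" and big: "\<And>a. a \<in> A \<Longrightarrow> m' \<le> card (nball a (R a))"
    and disj: "\<And>a b. a \<in> A \<Longrightarrow> b \<in> A \<Longrightarrow> a \<noteq> b \<Longrightarrow> nball a (R a) \<inter> nball b (R b) = {}"
  shows "card (bunch_pairs m A R) * m' * m' \<le> card V * m"
proof -
  have finA: "finite A" using A finite_V finite_subset by blast
  define S where "S a = {b. (a, b) \<in> bunch_pairs m A R}" for a
  have SA: "S a \<subseteq> A" for a by (auto simp: S_def bunch_pairs_def)
  have finS: "finite (S a)" for a using SA finA finite_subset by blast
  have S: "card (S a) * m' \<le> m" for a
  proof (cases "S a = {}")
    case False
    have "\<forall>b. \<exists>r. b \<in> S a \<longrightarrow> near E a b (2 * r) \<and> R b \<le> r \<and> card (nball a (6 * r)) < m"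
      by (auto simp: S_def bunch_pairs_def)
    then obtain r where r: "\<And>b. b \<in> S a \<Longrightarrow> near E a b (2 * r b) \<and> R b \<le> r b \<and> card (nball a (6 * r b)) < m"
      by metis
    let ?r = "Max (r ` S a)"
    have "?r \<in> r ` S a" using finS False by (intro Max_in) auto
    then obtain b0 where b0: "b0 \<in> S a" "?r = r b0" by auto
    have r0: "0 \<le> ?r" using near_nonneg[of a b0 "2 * r b0"] r[OF b0(1)] b0(2) by simp
    have "card (S a) * m' \<le> card (nball a (6 * ?r))"
    proof (rule card_disjoint_balls_le)
      fix b assume b: "b \<in> S a"
      have "r b \<le> ?r" using b finS by (intro Max_ge) auto
      then have "nball b (R b) \<subseteq> nball a (6 * ?r)"
        using r[OF b] r0 by (intro nball_subset[of a b "2 * r b"]) auto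
      then show "nball b (R b) \<subseteq> nball a (6 * ?r) \<and> m' \<le> card (nball b (R b))"
        using big b SA by blast
    next
      fix b c assume "b \<in> S a" "c \<in> S a" "b \<noteq> c"
      then show "nball b (R b) \<inter> nball c (R c) = {}" using disj SA by blast
    qed (use finS in auto)
    also have "\<dots> \<le> m" using r[OF b0(1)] b0(2) by simp
    finally show ?thesis .
  qed simp
  have cA: "card A * m' \<le> card V"
  proof (rule card_disjoint_balls_le)
    fix a assume "a \<in> A"
    then show "nball a (R a) \<subseteq> V \<and> m' \<le> card (nball a (R a))" using big by (auto simp: nball_def)
  qed (use finA finite_V disj in auto)
  have "bunch_pairs m A R = Sigma A S" by (auto simp: S_def bunch_pairs_def)
  then have "card (bunch_pairs m A R) * m' = (\<Sum>a\<in>A. card (S a)) * m'"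
    using finA finS by simp
  also have "\<dots> = (\<Sum>a\<in>A. card (S a) * m')" by (rule sum_distrib_right)
  also have "\<dots> \<le> (\<Sum>a\<in>A. m)" using S by (intro sum_mono) auto
  finally have "card (bunch_pairs m A R) * m' \<le> card A * m" by simp
  then have "card (bunch_pairs m A R) * m' * m' \<le> card A * m * m'" by (rule mult_le_mono1)
  also have "\<dots> \<le> card V * m" using cA by (simp add: ac_simps)
  finally show ?thesis .
qed

text \<open>The part of the walk between its first and its last vertex with a large ball is bypassed
  through the nearest centres; only the two remaining parts are cut into pieces.\<close>

lemma refine_pair:
  assumes A: "A \<subseteq> V"
    and Rmin: "\<And>a r. a \<in> A \<Longrightarrow> m' \<le> card (nball a r) \<Longrightarrow> R a \<le> r"
    and hit: "\<And>v r. v \<in> V \<Longrightarrow> m' \<le> card (nball v r) \<Longrightarrow> \<exists>a\<in>A. near F v a (2 * r)"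
    and F: "F \<subseteq> E" and N: "32 \<le> N" and uv: "u \<in> V" "v \<in> V"
    and loc: "near E u v r0" "card (nball u (8 * r0)) < m"
  shows "\<exists>Q B. finite Q \<and> Q \<subseteq> V \<times> V \<and> card Q \<le> 2 * N \<and> B \<subseteq> E \<and> card B \<le> 2 * N \<and>
    (\<forall>(y, z)\<in>Q. \<exists>r. near E y z r \<and> card (nball y (8 * r)) < m') \<and>
    (\<forall>H t. 1 \<le> t \<longrightarrow> B \<subseteq> H \<longrightarrow> F \<subseteq> H \<longrightarrow> stretch_on H Q t \<longrightarrow>
      stretch_on H (bunch_pairs m A R) 1 \<longrightarrow> stretch_on H {(u, v)} (t + 64 / real N))"
proof -
  obtain d where d: "near E u v d" "\<And>s. near E u v s \<Longrightarrow> d \<le> s" "0 \<le> d"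
    by (rule ex_min_near[OF loc(1)]) (rule that)
  have Npos: "0 < real N" using N by simp
  have enough: "stretch_on H {(u, v)} (t + 64 / real N)"
    if le: "1 \<le> t" and "near H u v ((t + 64 / real N) * d)" for H t
    unfolding stretch_on_def
  proof clarify
    fix r assume "near E u v r"
    then have "(t + 64 / real N) * d \<le> (t + 64 / real N) * r"
      using d(2) le Npos by (intro mult_left_mono) auto
    with that(2) show "near H u v ((t + 64 / real N) * r)" by (rule near_mono[OF _ order_refl])
  qed
  show ?thesis
  proof (cases "d = 0")
    \<comment> \<open>This case is separate because \<open>scan_walk\<close> needs \<delta> >
      0.\<close>
    case True
    have "u = v"
    proof (rule ccontr)
      assume "u \<noteq> v"
      then obtain y where y: "{u, y} \<in> E" "near E y v (d - wt {u, y})"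
        using d(1) near_first_step by blast
      then show False using near_nonneg[OF y(2)] wt_pos[OF y(1)] True by simp
    qed
    then have "near H u v ((t + 64 / real N) * d)" for H t using True by (simp add: near_refl)
    then show ?thesis
      by (intro exI[of _ "{}"] conjI allI impI) (auto intro: enough)
  next
    case False
    define \<delta> where "\<delta> = d / real N"
    have \<delta>: "0 < \<delta>" "d = real N * \<delta>" using d(3) False Npos by (auto simp: \<delta>_def)
    \<comment> \<open>The bound 32 \<le> N is there so that detours of up to 32 \<delta> do not
      exceed d. It also gives l1 + 16 \<delta> + 6 d \<le> 8 d further down, which explains the
      factor 8 in the locality condition.\<close>
    have \<delta>d: "32 * \<delta> \<le> d" using N \<delta> by simp
    have local: "\<exists>r. near E y z r \<and> card (nball y (8 * r)) < m'"
      if "near E y z \<delta> \<and> card (nball y (8 * \<delta>)) < m'" for y z using that by blast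
    obtain Q1 B1 x l1 l2 where "scanned m' \<delta> u v d N Q1 B1 x l1 l2"
      using scan_walk[OF d(1) _ uv(1) \<delta>(1)] \<delta>(2) by blast
    then have 1: "finite Q1" "card Q1 \<le> N" "B1 \<subseteq> E" "card B1 \<le> N"
      "\<And>y z. (y, z) \<in> Q1 \<Longrightarrow> near E y z \<delta> \<and> card (nball y (8 * \<delta>)) < m'"
      "l1 + l2 \<le> d" "near E x v l2" "x = v \<or> m' \<le> card (nball x (8 * \<delta>))"
      "\<And>H t. 1 \<le> t \<Longrightarrow> B1 \<subseteq> H \<Longrightarrow> stretch_on H Q1 t \<Longrightarrow> near H u x (t * l1)"
      "Q1 \<subseteq> V \<times> V"
      unfolding scanned_def by blast+
    have l2: "0 \<le> l2" using near_nonneg[OF 1(7)] .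
    have E1: "stretch_on E Q 1" for Q by (simp add: stretch_on_def)
    have l1: "0 \<le> l1" using near_nonneg[of u x l1] 1(9)[of 1 E] 1(3) E1 by simp
    have xV: "x \<in> V" using near_in_V[OF 1(7) uv(2)] .
    show ?thesis
    proof (cases "x = v")
      case True
      have "near H u v ((t + 64 / real N) * d)" if H: "1 \<le> t" "B1 \<subseteq> H" "stretch_on H Q1 t" for H t
      proof -
        have "t * l1 \<le> (t + 64 / real N) * d"
          using H(1) 1(6) l2 d(3) Npos l1 by (intro mult_mono) auto
        then show ?thesis using 1(9)[OF H] True near_mono[OF _ order_refl] by blast
      qed
      then show ?thesis
        using 1(1-5,10) enough by (intro exI[of _ Q1] exI[of _ B1] conjI allI impI) (auto intro: local)
    next
      case False
      then have hx: "m' \<le> card (nball x (8 * \<delta>))" using 1(8) by blast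
      have l2d: "l2 \<le> real N * \<delta>" using 1(6) l1 \<delta>(2) by linarith
      \<comment> \<open>A second scan, from the other end v towards x. It ends at a vertex with a
        large ball in any case, because x is one.\<close>
      obtain Q2 B2 y k1 k2 where "scanned m' \<delta> v x l2 N Q2 B2 y k1 k2"
        using scan_walk[OF near_sym[OF 1(7)] l2d uv(2) \<delta>(1)] by blast
      then have 2: "finite Q2" "card Q2 \<le> N" "B2 \<subseteq> E" "card B2 \<le> N"
        "\<And>y z. (y, z) \<in> Q2 \<Longrightarrow> near E y z \<delta> \<and> card (nball y (8 * \<delta>)) < m'"
        "k1 + k2 \<le> l2" "near E y x k2" "y = x \<or> m' \<le> card (nball y (8 * \<delta>))"
        "\<And>H t. 1 \<le> t \<Longrightarrow> B2 \<subseteq> H \<Longrightarrow> stretch_on H Q2 t \<Longrightarrow> near H v y (t * k1)"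
        "Q2 \<subseteq> V \<times> V"
        unfolding scanned_def by blast+
      have k2: "0 \<le> k2" using near_nonneg[OF 2(7)] .
      have k1: "0 \<le> k1" using near_nonneg[of v y k1] 2(9)[of 1 E] 2(3) E1 by simp
      have yV: "y \<in> V" using near_in_V[OF 2(7) xV] .
      have hy: "m' \<le> card (nball y (8 * \<delta>))" using 2(8) hx by blast
      obtain a where a: "a \<in> A" "near F x a (16 * \<delta>)" using hit[OF xV hx] by auto
      obtain b where b: "b \<in> A" "near F y b (16 * \<delta>)" using hit[OF yV hy] by auto
      have aE: "near E x a (16 * \<delta>)" and bE: "near E y b (16 * \<delta>)"
        using near_mono[OF a(2) F order_refl] near_mono[OF b(2) F order_refl] .
      have "m' \<le> card (nball b (24 * \<delta>))"
      proof -
        have "nball y (8 * \<delta>) \<subseteq> nball b (24 * \<delta>)"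
          using \<delta>(1) by (intro nball_subset[OF near_sym[OF bE]]) auto
        then show ?thesis using hy card_nball_mono le_trans by blast
      qed
      then have Rb: "R b \<le> d" using Rmin[OF b(1)] \<delta>d \<delta>(1) by fastforce
      have ab: "near E a b (k2 + 32 * \<delta>)"
        using near_trans[OF near_trans[OF near_sym[OF aE] near_sym[OF 2(7)]] bE]
        by (simp add: algebra_simps)
      have "near E a b (2 * d)"
        using near_mono[OF ab order_refl] 2(6) k1 1(6) l1 \<delta>d by simp
      moreover have "card (nball a (6 * d)) < m"
      proof -
        have "near E u x l1" using 1(9)[of 1 E] 1(3) E1 by simp
        then have ua: "near E u a (l1 + 16 * \<delta>)" using aE by (rule near_trans)
        have "d \<le> r0" using d(2) loc(1) .
        then have "nball a (6 * d) \<subseteq> nball u (8 * r0)"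
          using 1(6) l2 \<delta>d d(3) \<delta>(1) by (intro nball_subset[OF ua]) linarith
        then show ?thesis using loc(2) card_nball_mono le_less_trans by blast
      qed
      ultimately have bunch: "(a, b) \<in> bunch_pairs m A R"
        using a(1) b(1) Rb by (auto simp: bunch_pairs_def)
      have goal: "near H u v ((t + 64 / real N) * d)"
        if H: "1 \<le> t" "B1 \<union> B2 \<subseteq> H" "F \<subseteq> H" "stretch_on H (Q1 \<union> Q2) t"
          "stretch_on H (bunch_pairs m A R) 1" for H t
      proof -
        have s1: "near H u x (t * l1)" using 1(9) H stretch_on_subset[OF H(4)] by blast
        have s2: "near H v y (t * k1)" using 2(9) H stretch_on_subset[OF H(4)] by blast
        have s3: "near H a b (k2 + 32 * \<delta>)" using stretch_onD[OF H(5) bunch ab] by simp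
        have s4: "near H x a (16 * \<delta>)" "near H y b (16 * \<delta>)"
          using near_mono[OF a(2) H(3) order_refl] near_mono[OF b(2) H(3) order_refl] .
        \<comment> \<open>Out to x, up to the centre a, over to b, down to y, and on to v. The
          detour adds 16 + 32 + 16 = 64 times \<delta> = d / N, whence the loss 64 / N.\<close>
        have "near H u v (t * l1 + 16 * \<delta> + (k2 + 32 * \<delta>) + 16 * \<delta> + t * k1)"
          using near_trans[OF near_trans[OF near_trans[OF near_trans[OF s1 s4(1)] s3]
            near_sym[OF s4(2)]] near_sym[OF s2]] .
        moreover have "t * l1 + 16 * \<delta> + (k2 + 32 * \<delta>) + 16 * \<delta> + t * k1 \<le> (t + 64 / real N) * d"
        proof -
          have "1 * k2 \<le> t * k2" using H(1) k2 by (intro mult_right_mono) auto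
          moreover have "t * (l1 + k1 + k2) \<le> t * d"
            using H(1) 1(6) 2(6) by (intro mult_left_mono) auto
          moreover have "64 / real N * d = 64 * \<delta>" by (simp add: \<delta>_def)
          ultimately show ?thesis by (simp add: algebra_simps)
        qed
        ultimately show ?thesis by (rule near_mono[OF _ order_refl])
      qed
      have c: "card (Q1 \<union> Q2) \<le> 2 * N" "card (B1 \<union> B2) \<le> 2 * N"
        using card_Un_le[of Q1 Q2] card_Un_le[of B1 B2] 1(2,4) 2(2,4) by linarith+
      show ?thesis
        using 1(1,3,10) 2(1,3,10) c 1(5) 2(5) goal enough
        by (intro exI[of _ "Q1 \<union> Q2"] exI[of _ "B1 \<union> B2"] conjI allI impI) (auto intro: local)
    qed
  qed
qed

text \<open>All pairs share one packing, one forest and one set of pairs of centres, so these are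
  paid for once. Only the pieces and the joining edges are multiplied by the number of pairs, and
  locality sharpens from m to m'.\<close>

lemma refine_pairs:
  assumes Q: "finite Q" "Q \<subseteq> V \<times> V" and m': "1 \<le> m'" and N: "32 \<le> N"
    and loc: "\<And>u v. (u, v) \<in> Q \<Longrightarrow> \<exists>r. near E u v r \<and> card (nball u (8 * r)) < m"
  obtains Q' X B where "finite Q'" "Q' \<subseteq> V \<times> V" "card Q' \<le> 2 * N * card Q"
    "\<And>u v. (u, v) \<in> Q' \<Longrightarrow> \<exists>r. near E u v r \<and> card (nball u (8 * r)) < m'"
    "X \<subseteq> E" "card X \<le> card V + 2 * N * card Q"
    "finite B" "\<And>u v. (u, v) \<in> B \<Longrightarrow> \<exists>r. near E u v r \<and> card (nball u (3 * r)) < m"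
    "card B * m' * m' \<le> card V * m"
    "\<And>H t. 1 \<le> t \<Longrightarrow> X \<subseteq> H \<Longrightarrow> stretch_on H Q' t \<Longrightarrow> stretch_on H B 1 \<Longrightarrow>
      stretch_on H Q (t + 64 / real N)"
proof -
  obtain A R where A: "A \<subseteq> V" "\<And>a. a \<in> A \<Longrightarrow> m' \<le> card (nball a (R a))"
    "\<And>a r. a \<in> A \<Longrightarrow> m' \<le> card (nball a r) \<Longrightarrow> R a \<le> r"
    "\<And>a b. a \<in> A \<Longrightarrow> b \<in> A \<Longrightarrow> a \<noteq> b \<Longrightarrow> nball a (R a) \<inter> nball b (R b) = {}"
    "\<And>v r. v \<in> V \<Longrightarrow> m' \<le> card (nball v r) \<Longrightarrow> \<exists>a\<in>A. near E v a (2 * r)"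
    by (rule ball_packing[OF m']) (rule that)
  obtain F where F: "F \<subseteq> E" "card F \<le> card V"
    "\<And>v a r. v \<in> V \<Longrightarrow> a \<in> A \<Longrightarrow> near E v a r \<Longrightarrow> \<exists>a\<in>A. near F v a r"
    by (rule shortest_path_forest[OF A(1)]) (rule that)
  have hit: "\<exists>a\<in>A. near F v a (2 * r)" if "v \<in> V" "m' \<le> card (nball v r)" for v r
    using A(5)[OF that] F(3)[OF that(1)] by blast
  define B where "B = bunch_pairs m A R"
  define good where "good u v Q1 B1 \<longleftrightarrow> finite Q1 \<and> Q1 \<subseteq> V \<times> V \<and> card Q1 \<le> 2 * N \<and>
    B1 \<subseteq> E \<and> card B1 \<le> 2 * N \<and>
    (\<forall>(y, z)\<in>Q1. \<exists>r. near E y z r \<and> card (nball y (8 * r)) < m') \<and>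
    (\<forall>H t. 1 \<le> t \<longrightarrow> B1 \<subseteq> H \<longrightarrow> F \<subseteq> H \<longrightarrow> stretch_on H Q1 t \<longrightarrow>
      stretch_on H B 1 \<longrightarrow> stretch_on H {(u, v)} (t + 64 / real N))" for u v Q1 B1
  have "\<exists>Q1 B1. good (fst q) (snd q) Q1 B1" if qQ: "q \<in> Q" for q
  proof -
    obtain u v where q: "q = (u, v)" by (cases q)
    then have uv: "u \<in> V" "v \<in> V" using qQ Q(2) by auto
    obtain r where r: "near E u v r" "card (nball u (8 * r)) < m" using loc qQ q by blast
    show ?thesis
      using refine_pair[OF A(1,3) hit F(1) N uv r] unfolding good_def B_def q by simp
  qed
  then obtain f g where fg: "\<And>q. q \<in> Q \<Longrightarrow> good (fst q) (snd q) (f q) (g q)" by metis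
  have f: "finite (f q)" "f q \<subseteq> V \<times> V" "card (f q) \<le> 2 * N"
    "\<And>y z. (y, z) \<in> f q \<Longrightarrow> \<exists>r. near E y z r \<and> card (nball y (8 * r)) < m'"
    and g: "g q \<subseteq> E" "card (g q) \<le> 2 * N"
    and fg_stretch: "\<And>H t. 1 \<le> t \<Longrightarrow> g q \<subseteq> H \<Longrightarrow> F \<subseteq> H \<Longrightarrow> stretch_on H (f q) t \<Longrightarrow>
      stretch_on H B 1 \<Longrightarrow> stretch_on H {q} (t + 64 / real N)"
    if "q \<in> Q" for q
    using fg[OF that] unfolding good_def by (auto split: prod.splits)
  show ?thesis
  proof (rule that[of "\<Union>q\<in>Q. f q" "F \<union> (\<Union>q\<in>Q. g q)" B])
    show "finite (\<Union>q\<in>Q. f q)" by (intro finite_UN_I Q(1) f(1))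
    show "(\<Union>q\<in>Q. f q) \<subseteq> V \<times> V" by (rule UN_least) (rule f(2))
    have "card (\<Union>q\<in>Q. f q) \<le> (\<Sum>q\<in>Q. card (f q))" by (rule card_UN_le[OF Q(1)])
    also have "\<dots> \<le> (\<Sum>q\<in>Q. 2 * N)" using f(3) by (intro sum_mono) simp
    finally show "card (\<Union>q\<in>Q. f q) \<le> 2 * N * card Q" by (simp add: mult.commute)
    show "\<exists>r. near E u v r \<and> card (nball u (8 * r)) < m'" if "(u, v) \<in> (\<Union>q\<in>Q. f q)" for u v
      using that f(4) by blast
    show "F \<union> (\<Union>q\<in>Q. g q) \<subseteq> E" using F(1) g(1) by blast
    have "card (\<Union>q\<in>Q. g q) \<le> (\<Sum>q\<in>Q. card (g q))" by (rule card_UN_le[OF Q(1)])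
    also have "\<dots> \<le> (\<Sum>q\<in>Q. 2 * N)" using g(2) by (intro sum_mono) simp
    finally have "card (\<Union>q\<in>Q. g q) \<le> 2 * N * card Q" by (simp add: mult.commute)
    then show "card (F \<union> (\<Union>q\<in>Q. g q)) \<le> card V + 2 * N * card Q"
      using card_Un_le[of F "\<Union>q\<in>Q. g q"] F(2) by linarith
    show "finite B"
      by (rule finite_subset[of _ "V \<times> V"]) (use A(1) finite_V in \<open>auto simp: B_def bunch_pairs_def\<close>)
    show "\<exists>r. near E u v r \<and> card (nball u (3 * r)) < m" if uv: "(u, v) \<in> B" for u v
    proof -
      obtain r where "near E u v (2 * r)" "card (nball u (6 * r)) < m"
        using uv unfolding B_def bunch_pairs_def by blast
      then show ?thesis by (intro exI[of _ "2 * r"]) simp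
    qed
    show "card B * m' * m' \<le> card V * m" unfolding B_def by (rule card_bunch_pairs_le[OF A(1,2,4)])
    fix H t
    assume H: "1 \<le> t" "F \<union> (\<Union>q\<in>Q. g q) \<subseteq> H" "stretch_on H (\<Union>q\<in>Q. f q) t" "stretch_on H B 1"
    show "stretch_on H Q (t + 64 / real N)"
      unfolding stretch_on_def
    proof clarify
      fix u v r assume q: "(u, v) \<in> Q" and r: "near E u v r"
      have "stretch_on H (f (u, v)) t" by (rule stretch_on_subset[OF H(3)]) (use q in blast)
      moreover have "g (u, v) \<subseteq> H" "F \<subseteq> H" using H(2) q by blast+
      ultimately have "stretch_on H {(u, v)} (t + 64 / real N)"
        using fg_stretch[OF q H(1)] H(4) by blast
      then show "near H u v ((t + 64 / real N) * r)" using r by (rule stretch_onD[OF _ singletonI])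
    qed
  qed
qed

section \<open>Two rounds of refinement\<close>

text \<open>Up to constants and an additive O(n): the first round leaves n^2 / (n/q)^2 = q^2 pairs
  of centres at cost sqrt n each, the second n (n/q) / (n/q^2)^2 = q^3 pairs at cost sqrt (n/q)
  each. The N^2 q^4 final pieces are local at size n/q^2 and cost sqrt n / q each. All of this is
  within N^2 sqrt n q^3.\<close>

lemma near_exact_preserver:
  assumes Q: "finite Q" "Q \<subseteq> V \<times> V" "\<And>u v. (u, v) \<in> Q \<Longrightarrow> \<exists>r. near E u v r"
    and q: "1 \<le> q" "real (card Q) \<le> q ^ 4" "q\<^sup>2 \<le> real (card V)" and N: "32 \<le> N"
  obtains F where "F \<subseteq> E" "stretch_on F Q (1 + 128 / real N)"
    "real (card F) \<le> 14 * real (card V) + 38 * (real N)\<^sup>2 * sqrt (real (card V)) * q ^ 3"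
proof -
  define n where "n = real (card V)"
  have n1: "1 \<le> n" using q(1,3) one_le_power[of q 2] unfolding n_def by linarith
  have q2: "q \<le> q\<^sup>2" using q(1) by (simp add: power2_eq_square)
  have qn: "q \<le> n" "q\<^sup>2 \<le> n" using q2 q(3) by (auto simp: n_def)
  txt \<open>Ball sizes \<open>n/q\<close> and \<open>n/q\<^sup>2\<close> balance the costs of the pairs of centres against that of the pieces.\<close>
  define m1 where "m1 = nat \<lceil>n / q\<rceil>"
  define m2 where "m2 = nat \<lceil>n / q\<^sup>2\<rceil>"
  \<comment> \<open>Rounding up at most doubles the two sizes, as both quotients are at least 1 by
    q^2 \<le> n.\<close>
  have ceil: "1 \<le> nat \<lceil>x\<rceil> \<and> x \<le> real (nat \<lceil>x\<rceil>) \<and> real (nat \<lceil>x\<rceil>) \<le> 2 * x" if "1 \<le> x" for x :: real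
    using that by (auto simp: nat_ceiling_le_eq le_nat_iff) linarith+
  have m1: "1 \<le> m1" "n / q \<le> real m1" "real m1 \<le> 2 * n / q"
    using ceil[of "n / q"] qn q(1) by (auto simp: m1_def)
  have m2: "1 \<le> m2" "n / q\<^sup>2 \<le> real m2" "real m2 \<le> 2 * n / q\<^sup>2"
    using ceil[of "n / q\<^sup>2"] qn q(1) by (auto simp: m2_def)
  \<comment> \<open>Before the first round locality is void: no ball has card V + 1
    vertices.\<close>
  have all: "\<exists>r. near E u v r \<and> card (nball u (8 * r)) < card V + 1" if uv: "(u, v) \<in> Q" for u v
  proof -
    obtain r where r: "near E u v r" using Q(3)[OF uv] by blast
    have "card (nball u (8 * r)) \<le> card V" using finite_V by (intro card_mono) (auto simp: nball_def)
    then show ?thesis using r by (intro exI[of _ r]) simp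
  qed
  obtain Q1 X1 B1 where 1: "finite Q1" "Q1 \<subseteq> V \<times> V" "card Q1 \<le> 2 * N * card Q"
    "\<And>u v. (u, v) \<in> Q1 \<Longrightarrow> \<exists>r. near E u v r \<and> card (nball u (8 * r)) < m1"
    "X1 \<subseteq> E" "card X1 \<le> card V + 2 * N * card Q"
    "finite B1" "\<And>u v. (u, v) \<in> B1 \<Longrightarrow> \<exists>r. near E u v r \<and> card (nball u (3 * r)) < card V + 1"
    "card B1 * m1 * m1 \<le> card V * (card V + 1)"
    "\<And>H t. 1 \<le> t \<Longrightarrow> X1 \<subseteq> H \<Longrightarrow> stretch_on H Q1 t \<Longrightarrow> stretch_on H B1 1 \<Longrightarrow>
      stretch_on H Q (t + 64 / real N)"
    by (rule refine_pairs[OF Q(1,2) m1(1) N], erule all) (rule that)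
  obtain Q2 X2 B2 where 2: "finite Q2" "Q2 \<subseteq> V \<times> V" "card Q2 \<le> 2 * N * card Q1"
    "\<And>u v. (u, v) \<in> Q2 \<Longrightarrow> \<exists>r. near E u v r \<and> card (nball u (8 * r)) < m2"
    "X2 \<subseteq> E" "card X2 \<le> card V + 2 * N * card Q1"
    "finite B2" "\<And>u v. (u, v) \<in> B2 \<Longrightarrow> \<exists>r. near E u v r \<and> card (nball u (3 * r)) < m1"
    "card B2 * m2 * m2 \<le> card V * m1"
    "\<And>H t. 1 \<le> t \<Longrightarrow> X2 \<subseteq> H \<Longrightarrow> stretch_on H Q2 t \<Longrightarrow> stretch_on H B2 1 \<Longrightarrow>
      stretch_on H Q1 (t + 64 / real N)"
    by (rule refine_pairs[OF 1(1,2) m2(1) N], erule 1(4)) (rule that)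
  have exact: "\<exists>F\<subseteq>E. real (card F) \<le> 4 * n + 2 * sqrt (real M) * real (card P) \<and> stretch_on F P 1"
    if P: "finite P" "\<And>u v. (u, v) \<in> P \<Longrightarrow> \<exists>r. near E u v r \<and> card (nball u (3 * r)) < M"
      and M: "1 \<le> M" for P M
  proof -
    have "\<exists>r. near E u v r \<and> real (card {y\<in>V. near E u y (3 * r)}) \<le> real M" if "(u, v) \<in> P" for u v
      using P(2)[OF that] unfolding nball_def by (meson less_imp_le of_nat_le_iff)
    note ball = this
    have M0: "0 < real M" using M by simp
    obtain F where "F \<subseteq> E"
      "real (card F) \<le> 4 * real (card V) + 2 * sqrt (real M) * real (card P)"
      "\<And>u v r. (u, v) \<in> P \<Longrightarrow> near E u v r \<Longrightarrow> near F u v r"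
      by (rule exact_preserver[OF P(1) M0], erule ball) (rule that)
    then show ?thesis unfolding n_def stretch_on_def by (intro exI[of _ F]) auto
  qed
  obtain F1 where F1: "F1 \<subseteq> E" "real (card F1) \<le> 4 * n + 2 * sqrt (real (card V + 1)) * real (card B1)"
    "stretch_on F1 B1 1" using exact[OF 1(7,8)] by auto
  obtain F2 where F2: "F2 \<subseteq> E" "real (card F2) \<le> 4 * n + 2 * sqrt (real m1) * real (card B2)"
    "stretch_on F2 B2 1" using exact[OF 2(7,8) m1(1)] by auto
  have loc3: "\<exists>r. near E u v r \<and> card (nball u (3 * r)) < m2" if uv: "(u, v) \<in> Q2" for u v
  proof -
    obtain r where r: "near E u v r" "card (nball u (8 * r)) < m2" using 2(4)[OF uv] by blast
    have "nball u (3 * r) \<subseteq> nball u (8 * r)" using near_nonneg[OF r(1)] by (intro nball_mono) simp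
    then have "card (nball u (3 * r)) < m2" using r(2) card_nball_mono le_less_trans by blast
    then show ?thesis using r(1) by blast
  qed
  obtain F3 where F3: "F3 \<subseteq> E" "real (card F3) \<le> 4 * n + 2 * sqrt (real m2) * real (card Q2)"
    "stretch_on F3 Q2 1" using exact[OF 2(1) loc3 m2(1)] by auto
  define F where "F = X1 \<union> X2 \<union> F1 \<union> F2 \<union> F3"
  have "stretch_on F Q1 (1 + 64 / real N)"
    using stretch_on_mono[OF F2(3), of F] stretch_on_mono[OF F3(3), of F]
    by (intro 2(10)) (auto simp: F_def)
  then have "stretch_on F Q (1 + 64 / real N + 64 / real N)"
    using stretch_on_mono[OF F1(3), of F] by (intro 1(10)) (auto simp: F_def)
  moreover have "1 + 64 / real N + 64 / real N = 1 + 128 / real N" by simp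
  ultimately have stretch: "stretch_on F Q (1 + 128 / real N)" by (simp only:)
  define s where "s = sqrt n"
  have s: "1 \<le> s" "s * s = n" using n1 by (auto simp: s_def)
  have q0: "0 < q" using q(1) by simp
  have qs: "q \<le> s" unfolding s_def using qn(2) q(1) by (intro real_le_rsqrt)
  have N1: "1 \<le> real N" "real N \<le> (real N)\<^sup>2" using N by (auto simp: power2_eq_square)
  \<comment> \<open>The joining edges number O(N^2 q^4), which is affordable because q \<le> sqrt
    n.\<close>
  have q4: "q ^ 4 \<le> s * q ^ 3"
    using mult_right_mono[OF qs, of "q ^ 3"] q0 by (simp add: power_numeral_reduce)
  have sqrt2: "sqrt (2 * n) \<le> 2 * s"
    unfolding s_def real_sqrt_mult using n1 by (intro mult_right_mono) (auto intro: real_le_lsqrt)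
  have q23: "q\<^sup>2 \<le> q ^ 3" using q(1) by (intro power_increasing) auto
  have b1: "real (card B1) \<le> 2 * q\<^sup>2"
  proof -
    have "real (card B1) * (n / q) * (n / q) \<le> real (card B1) * real m1 * real m1"
      using m1(2) n1 q0 by (intro mult_mono) auto
    also have "\<dots> = real (card B1 * m1 * m1)" by simp
    also have "\<dots> \<le> real (card V * (card V + 1))" using 1(9) by (rule of_nat_mono)
    also have "\<dots> = n * (n + 1)" by (simp add: n_def algebra_simps)
    also have "\<dots> \<le> n * (2 * n)" using n1 by (intro mult_left_mono) auto
    finally have "real (card B1) * (n * n) \<le> (2 * q\<^sup>2) * (n * n)"
      using q0 by (simp add: field_simps power2_eq_square)
    then show ?thesis using n1 by simp
  qed
  have b2: "real (card B2) \<le> 2 * q ^ 3"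
  proof -
    have "real (card B2) * (n / q\<^sup>2) * (n / q\<^sup>2) \<le> real (card B2) * real m2 * real m2"
      using m2(2) n1 q0 by (intro mult_mono) auto
    also have "\<dots> = real (card B2 * m2 * m2)" by simp
    also have "\<dots> \<le> real (card V * m1)" using 2(9) by (rule of_nat_mono)
    also have "\<dots> = n * real m1" by (simp add: n_def)
    also have "\<dots> \<le> n * (2 * n / q)" using n1 m1(3) by (intro mult_left_mono) auto
    finally have "real (card B2) * (n * n) \<le> (2 * q ^ 3) * (n * n)"
      using q0 by (simp add: field_simps power_numeral_reduce)
    then show ?thesis using n1 by simp
  qed
  have c1: "real (card Q1) \<le> 2 * real N * q ^ 4"
  proof -
    have "real (card Q1) \<le> real (2 * N * card Q)" using 1(3) by (rule of_nat_mono)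
    also have "\<dots> = 2 * real N * real (card Q)" by simp
    also have "\<dots> \<le> 2 * real N * q ^ 4" using q(2) by (intro mult_left_mono) auto
    finally show ?thesis .
  qed
  have c2: "real (card Q2) \<le> 4 * (real N)\<^sup>2 * q ^ 4"
  proof -
    have "real (card Q2) \<le> real (2 * N * card Q1)" using 2(3) by (rule of_nat_mono)
    also have "\<dots> = 2 * real N * real (card Q1)" by simp
    also have "\<dots> \<le> 2 * real N * (2 * real N * q ^ 4)" using c1 by (intro mult_left_mono) auto
    finally show ?thesis by (simp add: power2_eq_square)
  qed
  define Y where "Y = (real N)\<^sup>2 * (s * q ^ 3)"
  have sq: "0 \<le> s * q ^ 3" using s q0 by simp
  have Y1: "s * q ^ 3 \<le> Y"
    unfolding Y_def using N1 mult_right_mono[OF _ sq, of 1 "(real N)\<^sup>2"] by simp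
  have x1: "real (card X1) \<le> n + 2 * Y"
  proof -
    have "real (card X1) \<le> real (card V + 2 * N * card Q)" using 1(6) by (rule of_nat_mono)
    also have "\<dots> = n + 2 * real N * real (card Q)" by (simp add: n_def)
    also have "\<dots> \<le> n + 2 * (real N)\<^sup>2 * (s * q ^ 3)"
      using q(2) q4 N1 by (intro add_left_mono mult_mono) auto
    finally show ?thesis by (simp add: Y_def)
  qed
  have x2: "real (card X2) \<le> n + 4 * Y"
  proof -
    have "real (card X2) \<le> real (card V + 2 * N * card Q1)" using 2(6) by (rule of_nat_mono)
    also have "\<dots> = n + 2 * real N * real (card Q1)" by (simp add: n_def)
    also have "\<dots> \<le> n + 2 * real N * (2 * real N * q ^ 4)"
      using c1 by (intro add_left_mono mult_left_mono) auto
    also have "\<dots> = n + 4 * (real N)\<^sup>2 * q ^ 4" by (simp add: power2_eq_square)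
    also have "\<dots> \<le> n + 4 * (real N)\<^sup>2 * (s * q ^ 3)"
      using q4 by (intro add_left_mono mult_left_mono) auto
    finally show ?thesis by (simp add: Y_def)
  qed
  have f1: "real (card F1) \<le> 4 * n + 8 * Y"
  proof -
    have "sqrt (real (card V + 1)) \<le> sqrt (2 * n)"
      using n1 by (intro real_sqrt_le_mono) (simp add: n_def)
    also note sqrt2
    finally have "sqrt (real (card V + 1)) \<le> 2 * s" .
    moreover have "real (card B1) \<le> 2 * q ^ 3" using b1 q23 by linarith
    ultimately have "sqrt (real (card V + 1)) * real (card B1) \<le> (2 * s) * (2 * q ^ 3)"
      using s(1) by (intro mult_mono) auto
    then show ?thesis using F1(2) Y1 by linarith
  qed
  have f2: "real (card F2) \<le> 4 * n + 8 * Y"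
  proof -
    have "2 * n / q \<le> 2 * n" using q(1) n1 by (simp add: field_simps)
    then have "sqrt (real m1) \<le> sqrt (2 * n)" using m1(3) by (intro real_sqrt_le_mono) linarith
    also note sqrt2
    finally have "sqrt (real m1) * real (card B2) \<le> (2 * s) * (2 * q ^ 3)"
      using b2 s(1) by (intro mult_mono) auto
    then show ?thesis using F2(2) Y1 by linarith
  qed
  have f3: "real (card F3) \<le> 4 * n + 16 * Y"
  proof -
    have "sqrt (real m2) \<le> sqrt (2 * n / q\<^sup>2)" using m2(3) by (rule real_sqrt_le_mono)
    also have "\<dots> = sqrt (2 * n) / q" using q0 by (simp add: real_sqrt_divide)
    also have "\<dots> \<le> 2 * s / q" using sqrt2 q0 by (simp add: divide_right_mono)
    finally have "sqrt (real m2) * real (card Q2) \<le> (2 * s / q) * (4 * (real N)\<^sup>2 * q ^ 4)"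
      using c2 s(1) q0 by (intro mult_mono) auto
    also have "\<dots> = 8 * Y" using q0 by (simp add: Y_def power_numeral_reduce)
    finally show ?thesis using F3(2) by linarith
  qed
  have "card F \<le> card X1 + card X2 + card F1 + card F2 + card F3"
    unfolding F_def by (intro order_trans[OF card_Un_le] add_right_mono) simp
  \<comment> \<open>14 = 1 + 1 + 4 + 4 + 4 and 38 = 2 + 4 + 8 + 8 + 16, the shares of X1, X2, F1, F2
    and F3.\<close>
  then have "real (card F) \<le> 14 * n + 38 * Y" using x1 x2 f1 f2 f3 by linarith
  moreover have "F \<subseteq> E" using 1(5) 2(5) F1(1) F2(1) F3(1) by (auto simp: F_def)
  ultimately show ?thesis using that[of F] stretch by (simp add: n_def s_def Y_def mult.assoc)
qed

end

section \<open>Spanners for arbitrary real stretch\<close>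

text \<open>For k = 1 the difference is 1 / (1 + \<delta>) - 1/2, which is 1/6 at \<delta> = 1/2 and
  tends to 0 as \<delta> tends to 1; hence the exception. For larger k it suffices to replace
  \<delta> by 1.\<close>

lemma exponent_gap:
  fixes k :: nat and \<delta> :: real
  assumes k: "1 \<le> k" and \<delta>: "0 \<le> \<delta>" "\<delta> < 1" and not: "\<not> (k = 1 \<and> 1 / 2 \<le> \<delta>)"
  shows "1 / 6 \<le> 1 + 1 / (real k + \<delta>) - 3 / 4 * (1 + 1 / real k)"
proof (cases "k = 1")
  case True
  have "2 / 3 \<le> 1 / (1 + \<delta>)" using not True \<delta> by (simp add: field_simps)
  then show ?thesis using True by simp
next
  case False
  have kr: "1 \<le> real k" using k by simp
  have "1 / (real k + 1) \<le> 1 / (real k + \<delta>)" using \<delta> kr by (intro divide_left_mono) auto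
  moreover have "1 / 6 \<le> 1 + 1 / (real k + 1) - 3 / 4 * (1 + 1 / real k)"
  proof (cases "k = 2")
    case False
    then have k3: "3 \<le> real k" using k \<open>k \<noteq> 1\<close> by linarith
    have "3 / 4 * (1 / real k) \<le> 1 / (real k + 1)" using k3 by (simp add: field_simps)
    then show ?thesis unfolding distrib_left by linarith
  qed simp
  ultimately show ?thesis by linarith
qed

text \<open>The exponent wanted for \<open>k + \<delta>\<close> is smaller than \<open>1 + 1 / k\<close>. Either the difference is worth only a
  constant factor, or \<open>\<delta>\<close> is not too small compared to \<open>ln s\<close>.\<close>

lemma exponent_dichotomy:
  fixes s \<delta> :: real and k :: nat
  assumes s: "1 \<le> s" and k: "1 \<le> k" and \<delta>: "0 \<le> \<delta>" "\<delta> < 1"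
  shows "s powr (1 + 1 / real k) \<le> 3 * s powr (1 + 1 / (real k + \<delta>)) \<or>
    0 < \<delta> \<and> (real k / \<delta>)\<^sup>2 * s powr (3 / 4 * (1 + 1 / real k)) \<le> 144 * s powr (1 + 1 / (real k + \<delta>))"
proof -
  define e where "e = real k + \<delta>"
  define L where "L = ln s"
  have kr: "1 \<le> real k" using k by simp
  have e: "1 \<le> e" "real k \<le> e" "e < real k + 1" using kr \<delta> by (auto simp: e_def)
  have L: "0 \<le> L" using s by (simp add: L_def)
  have powr: "s powr x = exp (x * L)" for x using s by (simp add: powr_def L_def)
  have diff: "1 / real k - 1 / e = \<delta> / (real k * e)" using kr e by (simp add: field_simps e_def)
  show ?thesis
  \<comment> \<open>The tested quantity is the logarithm of the ratio of the two powers of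
    s.\<close>
  proof (cases "\<delta> / (real k * e) * L \<le> 1")
    case True
    have "s powr (1 + 1 / real k) = s powr (1 / real k - 1 / e) * s powr (1 + 1 / e)"
      by (simp add: powr_add[symmetric] add.commute)
    also have "s powr (1 / real k - 1 / e) \<le> exp 1" unfolding powr diff using True by simp
    also have "exp 1 \<le> (3::real)" using exp_le by simp
    finally have "s powr (1 + 1 / real k) \<le> 3 * s powr (1 + 1 / e)" by (simp add: mult_right_mono)
    then show ?thesis by (simp add: e_def)
  next
    case False
    have \<delta>0: "0 < \<delta>" using False \<delta>(1) by (cases "\<delta> = 0") auto
    have "real k * e < \<delta> * L" using False kr e by (simp add: field_simps)
    moreover have "real k * 1 \<le> real k * e" using e kr by (intro mult_left_mono) auto
    ultimately have "real k \<le> \<delta> * L" by linarith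
    then have kL: "real k / \<delta> \<le> L" using \<delta>0 by (simp add: field_simps)
    have "(real k / \<delta>)\<^sup>2 * s powr (3 / 4 * (1 + 1 / real k)) \<le> 144 * s powr (1 + 1 / e)"
    \<comment> \<open>Here k / \<delta> \<le> 2 although the exponents may be close; otherwise k /
      \<delta> \<le> ln s, and the exponent gap absorbs its square.\<close>
    proof (cases "k = 1 \<and> 1 / 2 \<le> \<delta>")
      case True
      have "real k / \<delta> \<le> 2" using True by (simp add: field_simps)
      then have "(real k / \<delta>)\<^sup>2 \<le> 2\<^sup>2" using \<delta>0 by (intro power_mono) auto
      moreover have "1 / 2 \<le> 1 / e" using True e by (simp add: field_simps)
      then have "s powr (3 / 4 * (1 + 1 / real k)) \<le> s powr (1 + 1 / e)"
        using True s by (intro powr_mono) auto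
      ultimately have "(real k / \<delta>)\<^sup>2 * s powr (3 / 4 * (1 + 1 / real k)) \<le> 2\<^sup>2 * s powr (1 + 1 / e)"
        by (intro mult_mono) auto
      also have "\<dots> \<le> 144 * s powr (1 + 1 / e)" by (intro mult_right_mono) auto
      finally show ?thesis .
    next
      case False
      have gap: "1 / 6 + 3 / 4 * (1 + 1 / real k) \<le> 1 + 1 / e"
        using exponent_gap[OF k \<delta> False] unfolding e_def by linarith
      \<comment> \<open>The 12 is chosen so that squaring produces s powr (1 / 6), the gap from
        \<open>exponent_gap\<close>; 144 is its square.\<close>
      have "L / 12 \<le> exp (L / 12)" using exp_ge_add_one_self[of "L / 12"] by linarith
      then have "(L / 12)\<^sup>2 \<le> (exp (L / 12))\<^sup>2" using L by (intro power_mono) auto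
      also have "(exp (L / 12))\<^sup>2 = s powr (1 / 6)"
        unfolding powr by (simp add: exp_double[symmetric])
      finally have "L\<^sup>2 \<le> 144 * s powr (1 / 6)" by (simp add: power_divide)
      moreover have "(real k / \<delta>)\<^sup>2 \<le> L\<^sup>2" using kL \<delta>0 by (intro power_mono) auto
      ultimately have "(real k / \<delta>)\<^sup>2 \<le> 144 * s powr (1 / 6)" by linarith
      then have "(real k / \<delta>)\<^sup>2 * s powr (3 / 4 * (1 + 1 / real k))
          \<le> 144 * s powr (1 / 6) * s powr (3 / 4 * (1 + 1 / real k))"
        by (intro mult_right_mono) auto
      also have "\<dots> = 144 * s powr (1 / 6 + 3 / 4 * (1 + 1 / real k))" by (simp add: powr_add)
      also have "\<dots> \<le> 144 * s powr (1 + 1 / e)"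
        using gap s by (intro mult_left_mono powr_mono) auto
      finally show ?thesis .
    qed
    then show ?thesis using \<delta>0 by (simp add: e_def)
  qed
qed

section \<open>Greedy pairs of terminals, and the spanner\<close>

context wgraph begin

lemma near_along_walk:
  assumes "walk Q xs" "\<And>x y. {x, y} \<in> Q \<Longrightarrow> near F x y c"
  shows "near F (hd xs) (last xs) (real (length xs - 1) * c)"
  using assms
proof (induction xs rule: wlen.induct)
  case (1 x y zs)
  have "near F (hd (y # zs)) (last (y # zs)) (real (length (y # zs) - 1) * c)"
    using 1(1,2,3) by (auto simp: walk_def)
  moreover have "near F x y c" using 1(2,3) by (auto simp: walk_def)
  ultimately have "near F x (last (y # zs)) (c + real (length (y # zs) - 1) * c)"
    using near_trans by fastforce
  then show ?case by (simp add: algebra_simps)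
next
  case ("2_2" v)
  then show ?case by (simp add: near_refl)
qed (simp add: walk_def)

text \<open>The greedy spanner is taken of the graph of mutually reachable terminals, with distances
  as keys. A rejected pair is replaced by at most 2k - 1 kept pairs, none of them farther apart, so
  a stretch c on the kept pairs becomes (2k - 1) c on all pairs.\<close>

lemma terminal_pairs:
  assumes T: "T \<subseteq> V" and k: "1 \<le> k" and D: "card T < D ^ k"
  obtains Q where "Q \<subseteq> T \<times> T" "card Q \<le> D * card T" "\<And>u v. (u, v) \<in> Q \<Longrightarrow> \<exists>r. near E u v r"
    "\<And>F c. 0 \<le> c \<Longrightarrow> stretch_on F Q c \<Longrightarrow> stretch_on F (T \<times> T) (real (2 * k - 1) * c)"
proof -
  have finT: "finite T" using T finite_V finite_subset by blast
  define P where "P = {{a, b} | a b. a \<in> T \<and> b \<in> T \<and> a \<noteq> b \<and> (\<exists>r. near E a b r)}"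
  have PT: "f \<subseteq> T \<and> card f = 2" if "f \<in> P" for f using that by (auto simp: P_def)
  have finP: "finite P" by (rule finite_subset[of _ "Pow T"]) (use PT finT in auto)
  \<comment> \<open>The distance as a function of the unordered pair; by \<open>near_sym\<close> the
    chosen orientation does not matter.\<close>
  define key where
    "key f = (SOME d. \<exists>a b. f = {a, b} \<and> near E a b d \<and> (\<forall>s. near E a b s \<longrightarrow> d \<le> s))" for f
  have key: "near E a b (key {a, b}) \<and> (\<forall>s. near E a b s \<longrightarrow> key {a, b} \<le> s)"
    if ab: "near E a b r" for a b r
  proof -
    have "\<exists>d. near E a b d \<and> (\<forall>s. near E a b s \<longrightarrow> d \<le> s)" using ex_min_near[OF ab] by metis
    then have "\<exists>d a' b'. {a, b} = {a', b'} \<and> near E a' b' d \<and> (\<forall>s. near E a' b' s \<longrightarrow> d \<le> s)" by blast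
    from someI_ex[OF this] obtain a' b' where "{a, b} = {a', b'}" "near E a' b' (key {a, b})"
      "\<forall>s. near E a' b' s \<longrightarrow> key {a, b} \<le> s"
      unfolding key_def by blast
    then show ?thesis using near_sym by (auto simp: doubleton_eq_iff)
  qed
  obtain Q0 where Q0: "Q0 \<subseteq> P" "card Q0 \<le> D * card T"
    "\<And>a b. {a, b} \<in> P \<Longrightarrow> \<exists>xs. walk {f\<in>Q0. key f \<le> key {a, b}} xs \<and> hd xs = a \<and> last xs = b \<and>
       length xs \<le> 2 * k"
    by (rule greedy_spanner[OF finT D finP, of key], erule PT, rule k) (rule that)
  \<comment> \<open>The greedy spanner consists of unordered pairs, while preservers take ordered
    ones; either orientation will do.\<close>
  define or where "or f = (SOME p. {fst p, snd p} = f)" for f :: "'a set"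
  have or: "{fst (or f), snd (or f)} = f" if "f \<in> P" for f
  proof -
    have "\<exists>p. {fst p, snd p} = f" using that by (auto simp: P_def)
    then show ?thesis unfolding or_def by (rule someI_ex)
  qed
  have conn: "\<exists>r. near E a b r" if "{a, b} \<in> P" for a b
    using that near_sym unfolding P_def mem_Collect_eq doubleton_eq_iff by blast
  show ?thesis
  proof (rule that[of "or ` Q0"])
    show "or ` Q0 \<subseteq> T \<times> T"
    proof
      fix p assume "p \<in> or ` Q0"
      then obtain f where f: "f \<in> P" "p = or f" using Q0(1) by blast
      then have "{fst p, snd p} \<subseteq> T" using or[OF f(1)] PT[OF f(1)] by simp
      then show "p \<in> T \<times> T" by (cases p) auto
    qed
    have "finite Q0" using Q0(1) finP finite_subset by blast
    then have "card (or ` Q0) \<le> card Q0" by (rule card_image_le)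
    then show "card (or ` Q0) \<le> D * card T" using Q0(2) by linarith
    show "\<exists>r. near E u v r" if uv: "(u, v) \<in> or ` Q0" for u v
    proof -
      obtain f where f: "f \<in> P" "(u, v) = or f" using uv Q0(1) by blast
      then have "{u, v} = f" using or[OF f(1)] f(2)[symmetric] by simp
      then show ?thesis using conn f(1) by simp
    qed
    fix F c assume c: "0 \<le> c" and st: "stretch_on F (or ` Q0) c"
    have edge: "near F x y (c * key f)" if f: "f \<in> Q0" "f = {x, y}" for x y f
    proof -
      have fP: "f \<in> P" using f(1) Q0(1) by blast
      obtain a b where ab: "or f = (a, b)" by (cases "or f")
      then have eq: "{a, b} = f" using or[OF fP] by simp
      have "near E a b (key f)" using key conn fP eq by blast
      then have "near F a b (c * key f)" using stretch_onD[OF st] f(1) ab by (metis imageI)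
      moreover have "a = x \<and> b = y \<or> a = y \<and> b = x" using eq f(2) by (auto simp: doubleton_eq_iff)
      ultimately show ?thesis using near_sym by blast
    qed
    show "stretch_on F (T \<times> T) (real (2 * k - 1) * c)"
      unfolding stretch_on_def
    proof clarify
      fix a b r assume ab: "a \<in> T" "b \<in> T" and r: "near E a b r"
      have r0: "0 \<le> r" using near_nonneg[OF r] .
      show "near F a b (real (2 * k - 1) * c * r)"
      proof (cases "a = b")
        case True
        then show ?thesis using c r0 by (auto intro: near_refl)
      next
        case False
        then have P: "{a, b} \<in> P" using ab r by (auto simp: P_def)
        obtain xs where xs: "walk {f\<in>Q0. key f \<le> key {a, b}} xs" "hd xs = a" "last xs = b"
          "length xs \<le> 2 * k" using Q0(3)[OF P] by blast
        have d: "key {a, b} \<le> r" "0 \<le> key {a, b}" using key[OF r] r near_nonneg by auto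
        have "near F a b (real (length xs - 1) * (c * key {a, b}))"
          unfolding xs(2,3)[symmetric]
        proof (rule near_along_walk[OF xs(1)])
          fix x y assume xy: "{x, y} \<in> {f\<in>Q0. key f \<le> key {a, b}}"
          then have "near F x y (c * key {x, y})" using edge by blast
          moreover have "c * key {x, y} \<le> c * key {a, b}" using xy c by (intro mult_left_mono) auto
          ultimately show "near F x y (c * key {hd xs, last xs})"
            unfolding xs(2,3) by (rule near_mono[OF _ order_refl])
        qed
        moreover have "real (length xs - 1) * (c * key {a, b}) \<le> real (2 * k - 1) * (c * r)"
          using xs(4) c d by (intro mult_mono mult_left_mono mult_nonneg_nonneg of_nat_mono) auto
        ultimately have "near F a b (real (2 * k - 1) * (c * r))" by (rule near_mono[OF _ order_refl])
        then show ?thesis by (simp add: mult.assoc)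
      qed
    qed
  qed
qed

lemma stretch_on_le:
  assumes "stretch_on F Q c" "c \<le> t"
  shows "stretch_on F Q t"
  unfolding stretch_on_def
proof clarify
  fix u v r assume uv: "(u, v) \<in> Q" "near E u v r"
  have "c * r \<le> t * r" using assms(2) near_nonneg[OF uv(2)] by (rule mult_right_mono)
  then show "near F u v (t * r)" using stretch_onD[OF assms(1) uv] near_mono[OF _ order_refl] by blast
qed

theorem subset_spanner:
  assumes T: "T \<subseteq> V" and t: "1 \<le> t"
  obtains F where "F \<subseteq> E" "stretch_on F (T \<times> T) t"
    "real (card F) \<le> 200000000 *
      (real (card V) + sqrt (real (card V)) * real (card T) powr (1 + 2 / (t + 1)))"
proof (cases "T = {}")
  case True
  then show ?thesis using that[of "{}"] by (simp add: stretch_on_def)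
next
  case False
  note found = that
  have finT: "finite T" using T finite_V finite_subset by blast
  define s where "s = real (card T)"
  define n where "n = real (card V)"
  have s1: "1 \<le> s" using False finT by (simp add: s_def Suc_leI card_gt_0_iff)
  have sn: "s \<le> n" using card_mono[OF finite_V T] by (simp add: s_def n_def)
  \<comment> \<open>In these terms t = 2k - 1 + 2 \<delta>, and the wanted exponent is 1 + 1 /
    e.\<close>
  define e where "e = (t + 1) / 2"
  define k where "k = nat \<lfloor>e\<rfloor>"
  define \<delta> where "\<delta> = e - real k"
  have e1: "1 \<le> e" using t by (simp add: e_def)
  have k: "1 \<le> k" "real k \<le> e" "e < real k + 1"
    using e1 by (auto simp: k_def le_nat_iff le_floor_iff of_nat_nat)
  have \<delta>: "0 \<le> \<delta>" "\<delta> < 1" "e = real k + \<delta>" using k by (auto simp: \<delta>_def)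
  have kr: "1 \<le> real k" using k(1) by simp
  have k2: "real (2 * k - 1) = 2 * real k - 1" using k(1) by (simp add: of_nat_diff)
  have te: "t = 2 * e - 1" by (simp add: e_def field_simps)
  have ee: "1 + 2 / (t + 1) = 1 + 1 / e" by (simp add: e_def)
  \<comment> \<open>The added 1 makes D ^ k strictly larger than card T, as
    \<open>terminal_pairs\<close> requires; D is still at most twice s powr (1 / k).\<close>
  define D where "D = nat \<lfloor>s powr (1 / real k)\<rfloor> + 1"
  have p1: "1 \<le> s powr (1 / real k)" using s1 by (simp add: ge_one_powr_ge_zero)
  have D: "s powr (1 / real k) < real D" "real D \<le> 2 * s powr (1 / real k)"
    using p1 by (auto simp: D_def of_nat_nat) linarith+
  have "s = (s powr (1 / real k)) ^ k" using s1 kr by (simp add: powr_realpow[symmetric] powr_powr)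
  also have "\<dots> < real D ^ k" using D(1) k(1) p1 by (intro power_strict_mono) auto
  finally have "real (card T) < real (D ^ k)" by (simp add: s_def)
  then have Dk: "card T < D ^ k" by (simp only: of_nat_less_iff)
  obtain Q where Q: "Q \<subseteq> T \<times> T" "card Q \<le> D * card T" "\<And>u v. (u, v) \<in> Q \<Longrightarrow> \<exists>r. near E u v r"
    "\<And>F c. 0 \<le> c \<Longrightarrow> stretch_on F Q c \<Longrightarrow> stretch_on F (T \<times> T) (real (2 * k - 1) * c)"
    by (rule terminal_pairs[OF T k(1) Dk]) (rule that)
  have finQ: "finite Q" using Q(1) finT finite_subset by blast
  have QV: "Q \<subseteq> V \<times> V" using Q(1) T by blast
  have cQ: "real (card Q) \<le> 2 * s powr (1 + 1 / real k)"
  proof -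
    have "real (card Q) \<le> real D * s" using Q(2) unfolding s_def by (metis of_nat_le_iff of_nat_mult)
    also have "\<dots> \<le> 2 * s powr (1 / real k) * s" using D(2) s1 by (intro mult_right_mono) auto
    also have "\<dots> = 2 * s powr (1 + 1 / real k)" using s1 by (simp add: powr_add)
    finally show ?thesis .
  qed
  have cQ2: "real (card Q) \<le> s\<^sup>2"
  proof -
    have "card Q \<le> card (T \<times> T)" using Q(1) finT by (intro card_mono) auto
    then show ?thesis
      unfolding s_def power2_eq_square by (metis card_cartesian_product of_nat_le_iff of_nat_mult)
  qed
  define Z where "Z = s powr (1 + 1 / e)"
  have Z0: "0 \<le> Z" by (simp add: Z_def)
  have goal: thesis if F: "F \<subseteq> E" "stretch_on F Q c" "0 \<le> c" "(2 * real k - 1) * c \<le> t"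
    "real (card F) \<le> 14 * n + 200000000 * (sqrt n * Z)" for F c
  proof (rule found[of F])
    show "stretch_on F (T \<times> T) t" using stretch_on_le[OF Q(4)[OF F(3,2)]] F(4) k2 by simp
    have "14 * n \<le> 200000000 * n" using s1 sn by simp
    then show "real (card F) \<le> 200000000 *
      (real (card V) + sqrt (real (card V)) * real (card T) powr (1 + 2 / (t + 1)))"
      using F(5) unfolding ee by (simp add: n_def s_def Z_def algebra_simps)
  qed fact
  from exponent_dichotomy[OF s1 k(1) \<delta>(1,2)] consider
      (exact) "s powr (1 + 1 / real k) \<le> 3 * Z"
    | (approx) "0 < \<delta>" "(real k / \<delta>)\<^sup>2 * s powr (3 / 4 * (1 + 1 / real k)) \<le> 144 * Z"
    unfolding Z_def \<delta>(3) by blast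
  then show ?thesis
  proof cases
    case exact
    have ball: "\<exists>r. near E u v r \<and> real (card {y\<in>V. near E u y (3 * r)}) \<le> n" if uv: "(u, v) \<in> Q" for u v
    proof -
      obtain r where r: "near E u v r" using Q(3)[OF uv] by blast
      have "card {y\<in>V. near E u y (3 * r)} \<le> card V" using finite_V by (intro card_mono) auto
      then show ?thesis using r by (auto simp: n_def)
    qed
    have n0: "0 < n" using s1 sn by simp
    obtain F where F: "F \<subseteq> E" "real (card F) \<le> 4 * real (card V) + 2 * sqrt n * real (card Q)"
      "\<And>u v r. (u, v) \<in> Q \<Longrightarrow> near E u v r \<Longrightarrow> near F u v r"
      by (rule exact_preserver[OF finQ n0], erule ball) (rule that)
    have st: "stretch_on F Q 1" using F(3) by (auto simp: stretch_on_def)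
    show thesis
    proof (rule goal[OF F(1) st])
      show "(2 * real k - 1) * 1 \<le> t" using k(2) te by simp
      have "real (card Q) \<le> 6 * Z" using cQ exact by linarith
      then have "2 * (sqrt n * real (card Q)) \<le> 2 * (sqrt n * (100000000 * Z))"
        using n0 Z0 by (intro mult_left_mono) auto
      then have "2 * sqrt n * real (card Q) \<le> 200000000 * (sqrt n * Z)" by simp
      then show "real (card F) \<le> 14 * n + 200000000 * (sqrt n * Z)"
        using F(2) n0 unfolding n_def by linarith
    qed simp
  next
    case approx
    \<comment> \<open>\<open>near_exact_preserver\<close> loses 128 / N, and this N makes (2k - 1) *
      128 / N at most the slack 2 \<delta>. Rounding up adds at most 1 \<le> k / \<delta>, hence the
      129 below.\<close>
    define N where "N = nat \<lceil>128 * real k / \<delta>\<rceil>"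
    have kd: "1 \<le> real k / \<delta>" using kr approx(1) \<delta>(2) by (simp add: field_simps)
    have N: "128 * real k / \<delta> \<le> real N" "real N \<le> 129 * (real k / \<delta>)"
      using kd by (auto simp: N_def of_nat_nat) linarith+
    have "32 \<le> real N" using N(1) kd by simp
    then have N32: "32 \<le> N" by simp
    \<comment> \<open>The maximum with 1 covers an empty Q, since q must be at least 1.\<close>
    define x where "x = max 1 (real (card Q))"
    define q where "q = x powr (1 / 4)"
    have x1: "1 \<le> x" by (simp add: x_def)
    have q1: "1 \<le> q" using x1 by (simp add: q_def ge_one_powr_ge_zero)
    have q4: "q ^ 4 = x" using x1 by (simp add: q_def powr_realpow[symmetric] powr_powr)
    have q2n: "q\<^sup>2 \<le> n"
    proof (rule power2_le_imp_le)
      have "(q\<^sup>2)\<^sup>2 = x" using q4 by (simp flip: power_mult)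
      also have "\<dots> \<le> s\<^sup>2" using cQ2 s1 one_le_power[of s 2] by (simp add: x_def)
      also have "\<dots> \<le> n\<^sup>2" using sn s1 by (intro power_mono) auto
      finally show "(q\<^sup>2)\<^sup>2 \<le> n\<^sup>2" .
    qed (use s1 sn in simp)
    have q3: "q ^ 3 \<le> 2 * s powr (3 / 4 * (1 + 1 / real k))"
    proof -
      have "1 \<le> s powr (1 + 1 / real k)" using s1 by (intro ge_one_powr_ge_zero) auto
      then have "x \<le> 2 * s powr (1 + 1 / real k)" using cQ by (simp add: x_def)
      then have "x powr (3 / 4) \<le> (2 * s powr (1 + 1 / real k)) powr (3 / 4)"
        using x1 by (intro powr_mono2) auto
      also have "\<dots> = 2 powr (3 / 4) * s powr (3 / 4 * (1 + 1 / real k))"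
        using s1 by (simp add: powr_mult powr_powr mult.commute)
      also have "\<dots> \<le> 2 powr 1 * s powr (3 / 4 * (1 + 1 / real k))"
        by (intro mult_right_mono powr_mono) auto
      finally have "x powr (3 / 4) \<le> 2 * s powr (3 / 4 * (1 + 1 / real k))" by simp
      moreover have "q ^ 3 = x powr (3 / 4)"
        using x1 by (simp add: q_def powr_realpow[symmetric] powr_powr)
      ultimately show ?thesis by simp
    qed
    have cQx: "real (card Q) \<le> q ^ 4" by (simp add: q4 x_def)
    obtain F where F: "F \<subseteq> E" "stretch_on F Q (1 + 128 / real N)"
      "real (card F) \<le> 14 * real (card V) + 38 * (real N)\<^sup>2 * sqrt (real (card V)) * q ^ 3"
      by (rule near_exact_preserver[OF finQ QV _ q1 cQx q2n[unfolded n_def] N32], erule Q(3)) (rule that)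
    show thesis
    proof (rule goal[OF F(1,2)])
      have N0: "0 < real N" using \<open>32 \<le> real N\<close> by simp
      have "128 * real k \<le> real N * \<delta>" using N(1) approx(1) by (simp add: field_simps)
      then have "2 * (128 * real k) \<le> 2 * (real N * \<delta>)" by (rule mult_left_mono) simp
      moreover have "(2 * real k - 1) * 128 \<le> 2 * (128 * real k)" by simp
      ultimately have "(2 * real k - 1) * 128 \<le> 2 * (real N * \<delta>)" by (rule order_trans[rotated])
      then have "(2 * real k - 1) * (128 / real N) \<le> 2 * \<delta>" using N0 by (simp add: field_simps)
      then have "(2 * real k - 1) * (1 + 128 / real N) \<le> 2 * real k - 1 + 2 * \<delta>"
        by (simp add: algebra_simps)
      then show "(2 * real k - 1) * (1 + 128 / real N) \<le> t" using te \<delta>(3) by simp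
      have n0: "0 \<le> sqrt n" using s1 sn by simp
      have "(real N)\<^sup>2 \<le> (129 * (real k / \<delta>))\<^sup>2" using N(2) by (intro power_mono) auto
      then have "(real N)\<^sup>2 * q ^ 3 \<le> (129 * (real k / \<delta>))\<^sup>2 * (2 * s powr (3 / 4 * (1 + 1 / real k)))"
        using q3 q1 by (intro mult_mono) auto
      also have "\<dots> = 33282 * ((real k / \<delta>)\<^sup>2 * s powr (3 / 4 * (1 + 1 / real k)))"
        unfolding power_mult_distrib by simp
      also have "\<dots> \<le> 33282 * (144 * Z)" using approx(2) by (intro mult_left_mono) auto
      finally have "38 * sqrt n * ((real N)\<^sup>2 * q ^ 3) \<le> 38 * sqrt n * (33282 * (144 * Z))"
        using n0 by (intro mult_left_mono) auto
      \<comment> \<open>38 * 33282 * 144 = 182119104, where 33282 = 2 * 129^2. Rounded up, this is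
        the final constant.\<close>
      then have "38 * (real N)\<^sup>2 * sqrt n * q ^ 3 \<le> 182119104 * (sqrt n * Z)" by (simp add: mult_ac)
      moreover have "0 \<le> sqrt n * Z" using n0 Z0 by simp
      ultimately show "real (card F) \<le> 14 * n + 200000000 * (sqrt n * Z)"
        using F(3) unfolding n_def by linarith
    qed simp
  qed
qed

end

section \<open>Translation to symmetric digraphs\<close>

definition digraph_of_edges :: "'a set \<Rightarrow> 'a set set \<Rightarrow> 'a pair_pre_digraph" where
  "digraph_of_edges V F = \<lparr> pverts = V, parcs = {(u, v). {u, v} \<in> F} \<rparr>"

lemma pair_graph_digraph_of_edges:
  assumes "finite V" "\<And>f. f \<in> F \<Longrightarrow> f \<subseteq> V \<and> card f = 2"
  shows "pair_graph (digraph_of_edges V F)"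
proof -
  have V: "u \<in> V \<and> v \<in> V \<and> u \<noteq> v" if "{u, v} \<in> F" for u v
    using assms(2)[OF that] by auto
  have "finite {(u, v). {u, v} \<in> F}"
    by (rule finite_subset[of _ "V \<times> V"]) (use V assms(1) in auto)
  moreover have "sym {(u, v). {u, v} \<in> F}" by (auto simp: sym_def insert_commute)
  ultimately show ?thesis
    using V assms(1) by unfold_locales (auto simp: digraph_of_edges_def symmetric_def)
qed

lemma edges_digraph_of_edges:
  assumes "\<And>f. f \<in> F \<Longrightarrow> card f = 2"
  shows "edges (digraph_of_edges V F) = F"
proof
  show "F \<subseteq> edges (digraph_of_edges V F)"
  proof
    fix f assume f: "f \<in> F"
    then obtain u v where "f = {u, v}" using assms[OF f] by (meson card_2_iff)
    then show "f \<in> edges (digraph_of_edges V F)" using f by (auto simp: edges_def digraph_of_edges_def)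
  qed
qed (auto simp: edges_def digraph_of_edges_def)

text \<open>The membership of u in V matters for walks without edges: the list [u] is a walk for
  every u, but an \<open>awalk\<close> has to start at a vertex.\<close>

lemma (in wgraph) graph_dist_digraph_of_edges_le:
  assumes F: "F \<subseteq> E" and w: "\<And>u v. {u, v} \<in> E \<Longrightarrow> w (u, v) = wt {u, v}"
    and u: "u \<in> V" and near: "near F u v r"
  shows "graph_dist (digraph_of_edges V F) w u v \<le> ereal r"
proof -
  let ?H = "digraph_of_edges V F"
  interpret H: pair_graph ?H
    using F edge_subset card_edge finite_V by (intro pair_graph_digraph_of_edges) auto
  have walk: "\<exists>p. H.awalk (hd xs) p (last xs) \<and> H.awalk_cost w p = wlen xs"
    if "walk F xs" "hd xs \<in> V" for xs
    using that
  proof (induction xs rule: wlen.induct)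
    case (1 x y zs)
    have xy: "{x, y} \<in> F" and ys: "walk F (y # zs)" using 1(2) by (auto simp: walk_def)
    have arc: "(x, y) \<in> parcs ?H" using xy by (simp add: digraph_of_edges_def)
    have "y \<in> V" using xy F edge_subset by blast
    then obtain p where p: "H.awalk y p (last (y # zs))" "H.awalk_cost w p = wlen (y # zs)"
      using 1(1)[OF ys] by auto
    have "H.awalk x ((x, y) # p) (last (x # y # zs))"
      using p(1) arc by (simp add: H.awalk_Cons_iff)
    moreover have "H.awalk_cost w ((x, y) # p) = wlen (x # y # zs)"
      using p(2) w xy F by auto
    ultimately show ?case by (metis list.sel(1))
  next
    case ("2_2" v)
    then have "v \<in> pverts ?H" by (simp add: digraph_of_edges_def)
    then have "H.awalk v [] v" by (simp add: H.awalk_Nil_iff)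
    then show ?case by (intro exI[of _ "[]"]) simp
  qed (simp add: walk_def)
  obtain xs where xs: "walk F xs" "hd xs = u" "last xs = v" "wlen xs \<le> r"
    using near unfolding near_def by blast
  obtain p where p: "H.awalk u p v" "H.awalk_cost w p = wlen xs"
    using walk[OF xs(1)] xs(2,3) u by auto
  have "graph_dist ?H w u v \<le> ereal (H.awalk_cost w p)"
    unfolding graph_dist_def by (rule H.min_cost_le_walk_cost[OF p(1)])
  also have "\<dots> \<le> ereal r" using p(2) xs(4) by simp
  finally show ?thesis .
qed

text \<open>This direction is for the original graph, whose distance has to be bounded from
  below.\<close>

lemma awalk_near:
  assumes G: "pair_graph G" and W: "wgraph (pverts G) E wt"
    and E: "\<And>u v. (u, v) \<in> parcs G \<Longrightarrow> {u, v} \<in> E \<and> w (u, v) = wt {u, v}"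
    and p: "pre_digraph.awalk (with_proj G) u p v"
  shows "wgraph.near wt E u v (wf_digraph.awalk_cost w p)"
proof -
  interpret G: pair_graph G by (rule G)
  interpret W: wgraph "pverts G" E wt by (rule W)
  show ?thesis
    using p
  proof (induction p arbitrary: u)
    case Nil
    then show ?case by (simp add: G.awalk_Nil_iff W.near_refl)
  next
    case (Cons e p)
    obtain y where e: "e = (u, y)" "(u, y) \<in> parcs G" "G.awalk y p v"
      using Cons.prems by (cases e) (auto simp: G.awalk_Cons_iff)
    have "W.near E u y (w (u, y))" using E[OF e(2)] by (intro W.near_edge) auto
    then show ?case using W.near_trans Cons.IH[OF e(3)] e(1) by simp
  qed
qed

theorem theorem5:
  shows "\<exists>C::real. 0 < C \<and>
    (\<forall>(G :: 'a pair_pre_digraph) (w :: 'a \<times> 'a \<Rightarrow> real) (T :: 'a set) (t :: real).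
       weighted_graph G w \<longrightarrow> T \<subseteq> pverts G \<longrightarrow> 1 \<le> t \<longrightarrow>
       (\<exists>H. subsetwise_spanner G w T t H \<and>
            real (card (edges H)) \<le>
              C * (real (card (pverts G)) +
                   sqrt (real (card (pverts G))) * real (card T) powr (1 + 2 / (t + 1)))))"
proof (intro exI[of _ 200000000] conjI allI impI)
  fix G :: "'a pair_pre_digraph" and w :: "'a \<times> 'a \<Rightarrow> real" and T :: "'a set" and t :: real
  assume G: "weighted_graph G w" and T: "T \<subseteq> pverts G" and t: "1 \<le> t"
  have pg: "pair_graph G" using G by (simp add: weighted_graph_def)
  have w: "0 < w (u, v) \<and> w (u, v) = w (v, u)" if "(u, v) \<in> parcs G" for u v
    using G that unfolding weighted_graph_def by blast
  interpret G: pair_graph G by (rule pg)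
  \<comment> \<open>Weights sit on arcs. Both orientations of an edge carry the same weight, so any
    arc may be chosen for the edge.\<close>
  define wt where "wt e = w (SOME p. p \<in> parcs G \<and> {fst p, snd p} = e)" for e
  have wt: "wt {u, v} = w (u, v)" if uv: "(u, v) \<in> parcs G" for u v
  proof -
    let ?p = "SOME p. p \<in> parcs G \<and> {fst p, snd p} = {u, v}"
    have "\<exists>p. p \<in> parcs G \<and> {fst p, snd p} = {u, v}" using uv by (intro exI[of _ "(u, v)"]) simp
    then have "?p \<in> parcs G \<and> {fst ?p, snd ?p} = {u, v}" by (rule someI_ex)
    then have "?p = (u, v) \<or> ?p = (v, u)" by (cases ?p) (auto simp: doubleton_eq_iff)
    then show ?thesis using w[OF uv] by (auto simp: wt_def)
  qed
  have E: "{u, v} \<in> edges G \<longleftrightarrow> (u, v) \<in> parcs G" for u v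
    unfolding edges_def using G.arcs_symmetric by (auto simp: doubleton_eq_iff)
  have ex: "\<exists>u v. f = {u, v} \<and> (u, v) \<in> parcs G" if "f \<in> edges G" for f
    using that by (auto simp: edges_def)
  have W: "wgraph (pverts G) (edges G) wt"
  proof
    show "finite (pverts G)" by (rule G.pair_finite_verts)
    fix f assume "f \<in> edges G"
    then obtain u v where f: "f = {u, v}" "(u, v) \<in> parcs G" using ex by blast
    show "f \<subseteq> pverts G" using f G.in_arcsD1 G.in_arcsD2 by auto
    show "card f = 2" using f G.no_loops' by auto
    show "0 < wt f" using f wt w by simp
  qed
  interpret W: wgraph "pverts G" "edges G" wt by (rule W)
  obtain F where F: "F \<subseteq> edges G" "W.stretch_on F (T \<times> T) t"
    "real (card F) \<le> 200000000 * (real (card (pverts G)) +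
      sqrt (real (card (pverts G))) * real (card T) powr (1 + 2 / (t + 1)))"
    by (rule W.subset_spanner[OF T t]) (rule that)
  define H where "H = digraph_of_edges (pverts G) F"
  have two: "f \<subseteq> pverts G \<and> card f = 2" if "f \<in> F" for f
    using that F(1) W.edge_subset W.card_edge by blast
  have H: "pair_graph H" unfolding H_def using G.pair_finite_verts two by (rule pair_graph_digraph_of_edges)
  interpret H: pair_graph H by (rule H)
  show "\<exists>H. subsetwise_spanner G w T t H \<and>
      real (card (edges H)) \<le> 200000000 * (real (card (pverts G)) +
        sqrt (real (card (pverts G))) * real (card T) powr (1 + 2 / (t + 1)))"
  proof (intro exI[of _ H] conjI)
    show "real (card (edges H)) \<le> 200000000 * (real (card (pverts G)) +
        sqrt (real (card (pverts G))) * real (card T) powr (1 + 2 / (t + 1)))"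
      using F(3) two unfolding H_def by (subst edges_digraph_of_edges) auto
    show "subsetwise_spanner G w T t H"
      unfolding subsetwise_spanner_def
    proof (intro conjI ballI)
      show "pair_graph H" by (rule H)
      have "parcs H \<subseteq> parcs G" using F(1) E by (auto simp: H_def digraph_of_edges_def)
      then show "subgraph (with_proj H) (with_proj G)"
        unfolding subgraph_def compatible_def
        using G.wf_digraph_axioms H.wf_digraph_axioms by (simp add: H_def digraph_of_edges_def)
      fix u v assume uv: "u \<in> T" "v \<in> T"
      show "graph_dist H w u v \<le> ereal t * graph_dist G w u v"
      proof (cases "\<exists>p. G.awalk u p v")
        case False
        then have "graph_dist G w u v = \<infinity>"
          unfolding graph_dist_def by (intro G.shortest_path_inf) (simp add: G.reachable_awalk)
        then show ?thesis using t by simp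
      next
        case True
        have near: "W.near (edges G) u v (G.awalk_cost w p)" if "G.awalk u p v" for p
          using that by (intro awalk_near[OF pg W]) (auto simp: E wt)
        \<comment> \<open>This d is the distance in terms of \<open>near\<close>; every
          \<open>awalk\<close> costs at least d, hence so does the infimum that defines
          \<open>graph_dist\<close>.\<close>
        obtain d where d: "W.near (edges G) u v d" "\<And>s. W.near (edges G) u v s \<Longrightarrow> d \<le> s"
          using True near W.ex_min_near by metis
        have "graph_dist H w u v \<le> ereal (t * d)"
          unfolding H_def
        proof (rule W.graph_dist_digraph_of_edges_le[OF F(1)])
          show "w (x, y) = wt {x, y}" if "{x, y} \<in> edges G" for x y using that by (simp add: E wt)
          show "W.near F u v (t * d)" using W.stretch_onD[OF F(2) _ d(1)] uv by simp
        qed (use uv T in auto)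
        also have "\<dots> = ereal t * ereal d" by simp
        also have "\<dots> \<le> ereal t * graph_dist G w u v"
        proof (rule ereal_mult_left_mono)
          show "ereal d \<le> graph_dist G w u v"
            unfolding graph_dist_def G.\<mu>_def using d(2) near by (intro INF_greatest) auto
        qed (use t in simp)
        finally show ?thesis .
      qed
    qed
  qed
qed simp

end
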